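(* Let $\theta\in(0,\pi/2)$ and $E_0>1/2$ be fixed, and let $a=\tan\theta$, $E_0'=E_0-\tfrac12$. Let $\Omega=\{(x,y)\in\mathbb{R}^2: x>0,\ y>ax\}$ and $W=\{(x,y): x\ge 0,\ y=ax\}$. Consider the wedge problem $(P_\epsilon)$ and its measure solutions as defined in the context. (1) For each $\epsilon=\gamma-1\ge 0$, the problem $(P_\epsilon)$ has a measure solution. Moreover, for all sufficiently small $\epsilon>0$, the attached-shock solution $(\varrho^\epsilon,u^\epsilon,v^\epsilon,E_0)$ described in the context, with $\varrho^\epsilon=\rho^\epsilon\mathsf{I}_\Omega\mathcal{L}^2$, is a measure solution of $(P_\epsilon)$, with the associated measures $$m^0(\epsilon)=\rho^\epsilon u^\epsilon \mathsf{I}_\Omega\mathcal{L}^2,\quad m^1(\epsilon)=\rho^\epsilon (u^\epsilon)^2\mathsf{I}_\Omega\mathcal{L}^2,\quad m^2(\epsilon)=\rho^\epsilon u^\epsilon v^\epsilon\mathsf{I}_\Omega\mathcal{L}^2,\quad m^3(\epsilon)=\rho^\epsilon u^\epsilon E_0\mathsf{I}_\Omega\mathcal{L}^2,$$ $$n^0(\epsilon)=\rho^\epsilon v^\epsilon \mathsf{I}_\Omega\mathcal{L}^2,\quad n^1(\epsilon)=\rho^\epsilon u^\epsilon v^\epsilon\mathsf{I}_\Omega\mathcal{L}^2,\quad n^2(\epsilon)=\rho^\epsilon (v^\epsilon)^2\mathsf{I}_\Omega\mathcal{L}^2,\quad n^3(\epsilon)=\rho^\epsilon v^\epsilon E_0\mathsf{I}_\Omega\mathcal{L}^2,$$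 $\wp(\epsilon)=p^\epsilon\mathsf{I}_\Omega\mathcal{L}^2$, and weights $w^1_p(\epsilon)=-\frac{a}{\sqrt{1+a^2}}p_1^\epsilon$, $w^2_p(\epsilon)=\frac{1}{\sqrt{1+a^2}}p_1^\epsilon$. (2) For $\epsilon=0$, a measure solution of $(P_0)$ is given by $$\varrho=\mathsf{I}_\Omega\mathcal{L}^2+\frac{\sin\theta}{\cos^2\theta}\,x\,\delta_W,\qquad u=\mathsf{I}_\Omega+(\cos^2\theta)\,\mathsf{I}_W,\qquad v=(\sin\theta\cos\theta)\,\mathsf{I}_W,\qquad E=E_0,$$ with the associated measures $$m^0=\mathsf{I}_\Omega\mathcal{L}^2+(\sin\theta)x\,\delta_W,\qquad n^0=\frac{\sin^2\theta}{\cos\theta}x\,\delta_W,$$ $$m^1=\mathsf{I}_\Omega\mathcal{L}^2+(\sin\theta\cos^2\theta)x\,\delta_W,\qquad n^1=(\sin^2\theta\cos\theta)x\,\delta_W,$$ $$m^2=(\sin^2\theta\cos\theta)x\,\delta_W,\qquad n^2=(\sin^3\theta)x\,\delta_W,$$ $$m^3=E_0\mathsf{I}_\Omega\mathcal{L}^2+(E_0\sin\theta)x\,\delta_W,\qquad n^3=E_0\frac{\sin^2\theta}{\cos\theta}x\,\delta_W,\qquad \wp=0,$$ and weights $w^1_p=-\sin^3\theta$, $w^2_p=\sin^2\theta\cos\theta$ (so that the pressure on $W$ is $\sqrt{(w_p^1)^2+(w_p^2)^2}=\sin^2\theta$). (3) As $\epsilon\downarrow 0$ (equivalently, as the Mach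 number $M_0=(\epsilon E_0')^{-1/2}$ of the oncoming flow tends to infinity), the measure solutions given by the attached-shock solutions converge vaguely to the measure solution in (2): $\varrho^\epsilon\to\varrho$, $m^k(\epsilon)\to m^k$ and $n^k(\epsilon)\to n^k$ for $k=0,1,2,3$, and $\wp(\epsilon)\to\wp=0$, all in the sense of vague convergence of measures.
   Context: **Notation.** $\mathcal{L}^d$ is Lebesgue measure on $\mathbb{R}^d$. $\mathsf{I}_A$ is the characteristic function of a set $A$. $C_0(\mathbb{R}^2)$ (resp. $C_0^1(\mathbb{R}^2)$) denotes continuous (resp. continuously differentiable) functions with compact support in $\mathbb{R}^2$. Radon measures may be signed; measures on $\overline\Omega$ are regarded as measures on $\mathbb{R}^2$. Write $\langle m,\phi\rangle=\int\phi\,dm$. Measures $m_\epsilon$ converge vaguely to $m$ if $\langle m_\epsilon,\phi\rangle\to\langle m,\phi\rangle$ for all $\phi\in C_0(\mathbb{R}^2)$. For a locally integrable function $w$ on $[0,\infty)$, the weighted Dirac measure $w\,\delta_W$ on $W$ is defined by $$\langle w\,\delta_W,\phi\rangle=\int_0^\infty w(x)\,\phi(x,ax)\sqrt{1+a^2}\,dx ,\qquad \phi\in C_0(\mathbb{R}^2).$$ **The problem $(P_\epsilon)$.** With $\gamma=1+\epsilon$, this is the two-dimensional steady non-isentropic compressible Euler system in $\Omega$, $$\partial_x(\rho u)+\partial_y(\rho v)=0,\quad \partial_x(\rho u^2+p)+\partial_y(\rho uv)=0,\quad \partial_x(\rho uv)+\partial_y(\rho v^2+p)=0,\quad \partial_x(\rho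 uE)+\partial_y(\rho vE)=0,$$ with $p=\frac{\epsilon}{\epsilon+1}\rho\left(E-\frac12(u^2+v^2)\right)$, slip condition $v=au$ on $W$, and data $(\rho,u,v,E)=(\rho_0,u_0,v_0,E_0)=(1,1,0,E_0)$ on $\{x=0,\ y>0\}$. Put $p_0=p_0^\epsilon=\frac{\epsilon}{\epsilon+1}E_0'$. The problem is understood in the following measure sense. **Measure solution.** For $\epsilon\ge0$, $(\varrho,u,v,E)$ is a measure solution of $(P_\epsilon)$ if there are Radon measures $m^0,\dots,m^3,n^0,\dots,n^3,\wp$ on $\overline\Omega$ and locally integrable functions $w_p^1,w_p^2$ on $[0,\infty)$ such that: (i) $w_p^1+a\,w_p^2=0$ $\mathcal{L}^1$-a.e. (ii) For every $\phi\in C_0^1(\mathbb{R}^2)$, $$\langle m^0,\partial_x\phi\rangle+\langle n^0,\partial_y\phi\rangle+\int_0^\infty \rho_0u_0\,\phi(0,y)\,dy=0,$$ $$\langle m^1,\partial_x\phi\rangle+\langle n^1,\partial_y\phi\rangle+\langle\wp,\partial_x\phi\rangle+\langle w_p^1\delta_W,\phi\rangle+\int_0^\infty(\rho_0u_0^2+p_0)\,\phi(0,y)\,dy=0,$$ $$\langle m^2,\partial_x\phi\rangle+\langle n^2,\partial_y\phi\rangle+\langle\wp,\partial_y\phi\rangle+\langle w_p^2\delta_W,\phi\rangle+\int_0^\infty\rho_0u_0v_0\,\phi(0,y)\,dy=0,$$ $$\langle m^3,\partial_x\phi\rangle+\langle n^3,\partial_y\phi\rangle+\int_0^\infty\rho_0u_0E_0\,\phi(0,y)\,dy=0.$$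 (iii) $\varrho$ is a nonnegative Radon measure with $\wp\ll\varrho$, $m^0\ll\varrho$, $n^0\ll\varrho$, and $m^k\ll m^0$, $n^k\ll n^0$ for $k=1,2,3$. The functions $u,v$ are the Radon–Nikodym derivatives $u=dm^0/d\varrho$, $v=dn^0/d\varrho$, and $E$ is a $\varrho$-a.e. defined function, such that $m^1=u\,m^0$, $n^1=u\,n^0$, $m^2=v\,m^0$, $n^2=v\,n^0$, $m^3=E\,m^0$, $n^3=E\,n^0$. (iv) If in a neighborhood of a point of $\Omega$ one has $\varrho\ll\mathcal{L}^2$ with density $\rho$ and $\wp\ll\mathcal{L}^2$ with density $p$, then there $p=\frac{\epsilon}{\epsilon+1}\rho\left(E-\frac12(u^2+v^2)\right)$ $\mathcal{L}^2$-a.e., and the classical entropy condition holds at discontinuities of $\rho,u,v,E$ there (the pressure increases as the flow crosses the discontinuity). **Attached-shock solutions.** For small $\epsilon>0$, put $\lambda=\epsilon/(\epsilon+2)$ and let $u_1^\epsilon\in(0,1)$ be the root $u$ of $$(1-u)^2(u-\lambda-2\lambda E_0')=a^2u^2(1-u+2\lambda E_0')$$ that depends continuously on $\epsilon$ and tends to $\cos^2\theta$ as $\epsilon\downarrow0$ (this determines $u_1^\epsilon$ for all small $\epsilon$). Set $$v_1^\epsilon=a u_1^\epsilon,\quad \sigma^\epsilon=\tan\alpha^\epsilon=\frac{1-u_1^\epsilon}{v_1^\epsilon}\ \ (\alpha^\epsilon\in(0,\tfrac{\pi}{2})),$$ $$\rho_1^\epsilon=\frac{\epsilon+2}{\epsilon}\,\frac{\sin^2\alpha^\epsilon}{2E_0'+\sin^2\alpha^\epsilon},\quad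 p_1^\epsilon=\frac{2(\epsilon+1)\sin^2\alpha^\epsilon-\epsilon^2E_0'}{(\epsilon+1)(\epsilon+2)}.$$ The attached-shock solution is the piecewise constant function on $\Omega$ given by $$(\rho^\epsilon,u^\epsilon,v^\epsilon,p^\epsilon)=\begin{cases}(1,1,0,p_0^\epsilon), & 0\le x/y<1/\sigma^\epsilon,\\ (\rho_1^\epsilon,u_1^\epsilon,v_1^\epsilon,p_1^\epsilon), & 1/\sigma^\epsilon<x/y\le 1/a,\end{cases}$$ with total energy $E\equiv E_0$. *)

theory Defs
  imports "HOL-Analysis.Analysis"
begin

section \<open>Test functions on the plane\<close>

type_synonym plane = "real \<times> real"

definition dx :: "(plane \<Rightarrow> real) \<Rightarrow> plane \<Rightarrow> real" where
  "dx f z = frechet_derivative f (at z) (1, 0)"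

definition dy :: "(plane \<Rightarrow> real) \<Rightarrow> plane \<Rightarrow> real" where
  "dy f z = frechet_derivative f (at z) (0, 1)"

definition C1_on :: "plane set \<Rightarrow> (plane \<Rightarrow> real) \<Rightarrow> bool" where
  "C1_on V f \<longleftrightarrow> open V \<and> (\<forall>z\<in>V. f differentiable (at z)) \<and>
     continuous_on V (dx f) \<and> continuous_on V (dy f)"

definition compact_support :: "(plane \<Rightarrow> real) \<Rightarrow> bool" where
  "compact_support f \<longleftrightarrow> compact (closure {z. f z \<noteq> 0})"

definition C0_test :: "(plane \<Rightarrow> real) set" where
  "C0_test = {f. continuous_on UNIV f \<and> compact_support f}"

definition C1_test :: "(plane \<Rightarrow> real) set" where
  "C1_test = {f. C1_on UNIV f \<and> compact_support f}"

section \<open>Signed Radon measures\<close>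

definition add_measure :: "plane measure \<Rightarrow> plane measure \<Rightarrow> plane measure" where
  "add_measure M N = measure_of UNIV (sets borel) (\<lambda>A. emeasure M A + emeasure N A)"

text \<open>A signed Radon measure need not be a real-valued function on all Borel sets (both of its parts
  may be infinite), so it is represented by its Jordan decomposition, the pair of its positive and
  negative part. This representation is unique, hence equality of pairs is equality of measures.\<close>

type_synonym smeasure = "plane measure \<times> plane measure"

definition radon :: "plane measure \<Rightarrow> bool" where
  "radon M \<longleftrightarrow> sets M = sets borel \<and> (\<forall>K. compact K \<longrightarrow> emeasure M K < \<infinity>)"

definition signed_radon :: "smeasure \<Rightarrow> bool" where
  "signed_radon m \<longleftrightarrow> radon (fst m) \<and> radon (snd m) \<and>
     (\<exists>A\<in>sets borel. emeasure (fst m) (- A) = 0 \<and> emeasure (snd m) A = 0)"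

definition pos :: "plane measure \<Rightarrow> smeasure" where
  "pos M = (M, null_measure borel)"

definition variation :: "smeasure \<Rightarrow> plane measure" where
  "variation m = add_measure (fst m) (snd m)"

definition pairing :: "smeasure \<Rightarrow> (plane \<Rightarrow> real) \<Rightarrow> real" where
  "pairing m f = (\<integral>z. f z \<partial>fst m) - (\<integral>z. f z \<partial>snd m)"

text \<open>The measure \<open>f m\<close> with density \<open>f\<close> with respect to \<open>m\<close>. Since \<^const>\<open>ennreal\<close> maps negative
  numbers to 0, the four densities below are the positive and the negative part of \<open>f\<close>; if \<open>m\<close> is a
  Jordan decomposition then so is the result.\<close>

definition smul :: "(plane \<Rightarrow> real) \<Rightarrow> smeasure \<Rightarrow> smeasure" where
  "smul f m =
     (add_measure (density (fst m) (\<lambda>z. ennreal (f z))) (density (snd m) (\<lambda>z. ennreal (- f z))),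
      add_measure (density (fst m) (\<lambda>z. ennreal (- f z))) (density (snd m) (\<lambda>z. ennreal (f z))))"

definition leb :: "(plane \<Rightarrow> real) \<Rightarrow> smeasure" where
  "leb f = smul f (pos lborel)"

definition abs_cont :: "smeasure \<Rightarrow> smeasure \<Rightarrow> bool"  (infix "\<lless>" 50) where
  "m \<lless> n \<longleftrightarrow> absolutely_continuous (variation n) (variation m)"

definition supported_on :: "plane set \<Rightarrow> smeasure \<Rightarrow> bool" where
  "supported_on S m \<longleftrightarrow> emeasure (variation m) (- S) = 0"

definition vague_tendsto :: "(real \<Rightarrow> smeasure) \<Rightarrow> smeasure \<Rightarrow> real filter \<Rightarrow> bool" where
  "vague_tendsto M m F \<longleftrightarrow>
     (\<forall>\<phi>\<in>C0_test. ((\<lambda>\<epsilon>. pairing (M \<epsilon>) \<phi>) \<longlongrightarrow> pairing m \<phi>) F)"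

lemma sets_add_measure [simp]: "sets (add_measure M N) = sets borel"
  and space_add_measure [simp]: "space (add_measure M N) = UNIV"
proof -
  have s: "sigma_algebra UNIV (sets (borel :: plane measure))"
    using sets.sigma_algebra_axioms[of "borel :: plane measure"] by simp
  show "sets (add_measure M N) = sets borel"
    unfolding add_measure_def using sigma_algebra.sets_measure_of_eq[OF s] by simp
  show "space (add_measure M N) = UNIV"
    unfolding add_measure_def by (simp add: space_measure_of_conv)
qed

lemma emeasure_add_measure:
  assumes "sets M = sets borel" "sets N = sets borel" "A \<in> sets borel"
  shows "emeasure (add_measure M N) A = emeasure M A + emeasure N A"
proof (rule emeasure_measure_of[OF add_measure_def])
  show "sets (borel :: plane measure) \<subseteq> Pow UNIV" by simp
  show "A \<in> sets (add_measure M N)" using assms by simp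
  show "positive (sets (add_measure M N)) (\<lambda>A. emeasure M A + emeasure N A)"
    by (simp add: positive_def)
  show "countably_additive (sets (add_measure M N)) (\<lambda>A. emeasure M A + emeasure N A)"
  proof (rule countably_additiveI)
    fix F :: "nat \<Rightarrow> plane set"
    assume F: "range F \<subseteq> sets (add_measure M N)" "disjoint_family F"
    have "(\<Sum>i. emeasure M (F i) + emeasure N (F i)) =
        (\<Sum>i. emeasure M (F i)) + (\<Sum>i. emeasure N (F i))"
      by (rule suminf_add[symmetric]) auto
    also have "\<dots> = emeasure M (\<Union>i. F i) + emeasure N (\<Union>i. F i)"
      using F assms by (simp add: suminf_emeasure)
    finally show "(\<Sum>i. emeasure M (F i) + emeasure N (F i)) =
        emeasure M (\<Union>i. F i) + emeasure N (\<Union>i. F i)" .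
  qed
qed

section \<open>The wedge and weighted Dirac measures\<close>

definition Omega :: "real \<Rightarrow> plane set" where
  "Omega a = {(x, y). x > 0 \<and> y > a * x}"

definition Wall :: "real \<Rightarrow> plane set" where
  "Wall a = {(x, y). x \<ge> 0 \<and> y = a * x}"

definition locally_integrable :: "(real \<Rightarrow> real) \<Rightarrow> bool" where
  "locally_integrable w \<longleftrightarrow> (\<forall>R\<ge>0. set_integrable lborel {0..R} w)"

text \<open>The functional \<open>\<langle>w \<delta>\<^sub>W, \<phi>\<rangle>\<close>.\<close>

definition wall_pairing :: "real \<Rightarrow> (real \<Rightarrow> real) \<Rightarrow> (plane \<Rightarrow> real) \<Rightarrow> real" where
  "wall_pairing a w \<phi> = (LBINT x:{0..}. w x * \<phi> (x, a * x) * sqrt (1 + a\<^sup>2))"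

text \<open>For \<open>w \<ge> 0\<close>, the measure \<open>w \<delta>\<^sub>W\<close> itself.\<close>

definition wall_measure :: "real \<Rightarrow> (real \<Rightarrow> real) \<Rightarrow> plane measure" where
  "wall_measure a w =
     distr (density lborel (\<lambda>x. ennreal (indicator {0..} x * (w x * sqrt (1 + a\<^sup>2)))))
       borel (\<lambda>x. (x, a * x))"

lemma pairing_wall_measure:
  assumes [measurable]: "w \<in> borel_measurable borel" "\<phi> \<in> borel_measurable borel"
    and "\<And>x. 0 \<le> x \<Longrightarrow> 0 \<le> w x"
  shows "pairing (pos (wall_measure a w)) \<phi> = wall_pairing a w \<phi>"
proof -
  have "(\<integral>z. \<phi> z \<partial>wall_measure a w) =
      (\<integral>x. (indicator {0..} x * (w x * sqrt (1 + a\<^sup>2))) *\<^sub>R \<phi> (x, a * x) \<partial>lborel)"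
    unfolding wall_measure_def
    by (subst integral_distr, simp, simp, subst integral_density)
      (use assms(3) in \<open>auto simp: indicator_def\<close>)
  also have "\<dots> = wall_pairing a w \<phi>"
    unfolding wall_pairing_def set_lebesgue_integral_def
    by (rule Bochner_Integration.integral_cong) (auto simp: mult_ac)
  finally show ?thesis by (simp add: pairing_def pos_def)
qed

section \<open>Entropy condition\<close>

definition ess_lim :: "(plane \<Rightarrow> 'b::metric_space) \<Rightarrow> plane set \<Rightarrow> plane \<Rightarrow> 'b \<Rightarrow> bool" where
  "ess_lim f S z l \<longleftrightarrow>
     (\<forall>e>0. \<exists>r>0. AE w in lborel. w \<in> S \<and> dist w z < r \<longrightarrow> dist (f w) l < e)"

text \<open>A discontinuity at \<open>z\<close> is a jump across a \<open>C\<^sup>1\<close> curve \<open>\<psi> = 0\<close> through \<open>z\<close>: the state has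
  one-sided limits from \<open>\<psi> < 0\<close> and \<open>\<psi> > 0\<close>, and those of \<open>(\<rho>, u, v, E)\<close> differ. The flow crosses
  it from \<open>\<psi> < 0\<close> to \<open>\<psi> > 0\<close> if the mass flux along the normal \<open>\<nabla>\<psi>\<close> is positive on both sides
  (replacing \<open>\<psi>\<close> by \<open>- \<psi>\<close> covers the other direction). The limits are essential limits because
  all quantities are determined almost everywhere only.\<close>

definition entropy_at ::
  "plane set \<Rightarrow> (plane \<Rightarrow> real) \<Rightarrow> (plane \<Rightarrow> real) \<Rightarrow> (plane \<Rightarrow> real) \<Rightarrow> (plane \<Rightarrow> real) \<Rightarrow>
     (plane \<Rightarrow> real) \<Rightarrow> plane \<Rightarrow> bool" where
  "entropy_at U \<rho> u v E p z \<longleftrightarrow>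
     (\<forall>V \<psi> r1 u1 v1 E1 p1 r2 u2 v2 E2 p2.
        C1_on V \<psi> \<and> z \<in> V \<and> V \<subseteq> U \<and> \<psi> z = 0 \<and> (dx \<psi> z, dy \<psi> z) \<noteq> (0, 0) \<and>
        ess_lim (\<lambda>w. (\<rho> w, u w, v w, E w, p w)) {w\<in>V. \<psi> w < 0} z (r1, u1, v1, E1, p1) \<and>
        ess_lim (\<lambda>w. (\<rho> w, u w, v w, E w, p w)) {w\<in>V. \<psi> w > 0} z (r2, u2, v2, E2, p2) \<and>
        (r1, u1, v1, E1) \<noteq> (r2, u2, v2, E2) \<and>
        r1 * (u1 * dx \<psi> z + v1 * dy \<psi> z) > 0 \<and>
        r2 * (u2 * dx \<psi> z + v2 * dy \<psi> z) > 0
        \<longrightarrow> p1 < p2)"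

definition has_leb_density_on :: "smeasure \<Rightarrow> (plane \<Rightarrow> real) \<Rightarrow> plane set \<Rightarrow> bool" where
  "has_leb_density_on m f U \<longleftrightarrow> f \<in> borel_measurable borel \<and>
     smul (indicator U) m = leb (\<lambda>z. indicator U z * f z)"

section \<open>Measure solutions\<close>

abbreviation (input) \<rho>0 :: real where "\<rho>0 \<equiv> 1"
abbreviation (input) u0 :: real where "u0 \<equiv> 1"
abbreviation (input) v0 :: real where "v0 \<equiv> 0"

definition p0 :: "real \<Rightarrow> real \<Rightarrow> real" where
  "p0 E0 \<epsilon> = \<epsilon> / (\<epsilon> + 1) * (E0 - 1/2)"

definition inflow :: "real \<Rightarrow> (plane \<Rightarrow> real) \<Rightarrow> real" where
  "inflow c \<phi> = (LBINT y:{0..}. c * \<phi> (0, y))"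

definition measure_solution_with ::
  "real \<Rightarrow> real \<Rightarrow> real \<Rightarrow> plane measure \<Rightarrow> (plane \<Rightarrow> real) \<Rightarrow> (plane \<Rightarrow> real) \<Rightarrow> (plane \<Rightarrow> real) \<Rightarrow>
     (nat \<Rightarrow> smeasure) \<Rightarrow> (nat \<Rightarrow> smeasure) \<Rightarrow> smeasure \<Rightarrow> (real \<Rightarrow> real) \<Rightarrow> (real \<Rightarrow> real) \<Rightarrow> bool" where
  "measure_solution_with a E0 \<epsilon> \<rho> u v E m n P w1 w2 \<longleftrightarrow>
     (\<forall>k\<le>3. signed_radon (m k) \<and> supported_on (closure (Omega a)) (m k)) \<and>
     (\<forall>k\<le>3. signed_radon (n k) \<and> supported_on (closure (Omega a)) (n k)) \<and>
     signed_radon P \<and> supported_on (closure (Omega a)) P \<and>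
     locally_integrable w1 \<and> locally_integrable w2 \<and>
     (AE x in lborel. x \<ge> 0 \<longrightarrow> w1 x + a * w2 x = 0) \<and>
     (\<forall>\<phi>\<in>C1_test.
        pairing (m 0) (dx \<phi>) + pairing (n 0) (dy \<phi>) + inflow (\<rho>0 * u0) \<phi> = 0 \<and>
        pairing (m 1) (dx \<phi>) + pairing (n 1) (dy \<phi>) + pairing P (dx \<phi>) + wall_pairing a w1 \<phi>
          + inflow (\<rho>0 * u0\<^sup>2 + p0 E0 \<epsilon>) \<phi> = 0 \<and>
        pairing (m 2) (dx \<phi>) + pairing (n 2) (dy \<phi>) + pairing P (dy \<phi>) + wall_pairing a w2 \<phi>
          + inflow (\<rho>0 * u0 * v0) \<phi> = 0 \<and>
        pairing (m 3) (dx \<phi>) + pairing (n 3) (dy \<phi>) + inflow (\<rho>0 * u0 * E0) \<phi> = 0) \<and>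
     radon \<rho> \<and> supported_on (closure (Omega a)) (pos \<rho>) \<and>
     P \<lless> pos \<rho> \<and> m 0 \<lless> pos \<rho> \<and> n 0 \<lless> pos \<rho> \<and>
     (\<forall>k\<in>{1, 2, 3}. m k \<lless> m 0 \<and> n k \<lless> n 0) \<and>
     u \<in> borel_measurable borel \<and> v \<in> borel_measurable borel \<and> E \<in> borel_measurable borel \<and>
     m 0 = smul u (pos \<rho>) \<and> n 0 = smul v (pos \<rho>) \<and>
     m 1 = smul u (m 0) \<and> n 1 = smul u (n 0) \<and>
     m 2 = smul v (m 0) \<and> n 2 = smul v (n 0) \<and>
     m 3 = smul E (m 0) \<and> n 3 = smul E (n 0) \<and>
     (\<forall>U r p. open U \<and> U \<subseteq> Omega a \<and> has_leb_density_on (pos \<rho>) r U \<and> has_leb_density_on P p U \<longrightarrow>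
        (AE z in lborel. z \<in> U \<longrightarrow>
           p z = \<epsilon> / (\<epsilon> + 1) * r z * (E z - 1/2 * ((u z)\<^sup>2 + (v z)\<^sup>2))) \<and>
        (\<forall>z\<in>U. entropy_at U r u v E p z))"

definition measure_solution ::
  "real \<Rightarrow> real \<Rightarrow> real \<Rightarrow> plane measure \<Rightarrow> (plane \<Rightarrow> real) \<Rightarrow> (plane \<Rightarrow> real) \<Rightarrow> (plane \<Rightarrow> real) \<Rightarrow> bool"
  where
  "measure_solution a E0 \<epsilon> \<rho> u v E \<longleftrightarrow> (\<exists>m n P w1 w2. measure_solution_with a E0 \<epsilon> \<rho> u v E m n P w1 w2)"

section \<open>Attached-shock solutions\<close>

definition shock_branch :: "real \<Rightarrow> real \<Rightarrow> (real \<Rightarrow> real) \<Rightarrow> bool" where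
  "shock_branch \<theta> E0 U \<longleftrightarrow>
     (\<exists>e>0. continuous_on {0<..<e} U \<and>
        (\<forall>\<epsilon>\<in>{0<..<e}. U \<epsilon> \<in> {0<..<1} \<and>
           (let l = \<epsilon> / (\<epsilon> + 2); a = tan \<theta>; E0' = E0 - 1/2; u = U \<epsilon> in
            (1 - u)\<^sup>2 * (u - l - 2 * l * E0') = a\<^sup>2 * u\<^sup>2 * (1 - u + 2 * l * E0')))) \<and>
     (U \<longlongrightarrow> (cos \<theta>)\<^sup>2) (at_right 0)"

text \<open>Below, \<open>u1\<close> is the value of a shock branch at \<open>\<epsilon>\<close>.\<close>

definition shock_slope :: "real \<Rightarrow> real \<Rightarrow> real" where
  "shock_slope a u1 = (1 - u1) / (a * u1)"

definition shock_angle :: "real \<Rightarrow> real \<Rightarrow> real" where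
  "shock_angle a u1 = arctan (shock_slope a u1)"

definition rho1 :: "real \<Rightarrow> real \<Rightarrow> real \<Rightarrow> real \<Rightarrow> real" where
  "rho1 a E0 \<epsilon> u1 = (\<epsilon> + 2) / \<epsilon> *
     ((sin (shock_angle a u1))\<^sup>2 / (2 * (E0 - 1/2) + (sin (shock_angle a u1))\<^sup>2))"

definition p1 :: "real \<Rightarrow> real \<Rightarrow> real \<Rightarrow> real \<Rightarrow> real" where
  "p1 a E0 \<epsilon> u1 =
     (2 * (\<epsilon> + 1) * (sin (shock_angle a u1))\<^sup>2 - \<epsilon>\<^sup>2 * (E0 - 1/2)) / ((\<epsilon> + 1) * (\<epsilon> + 2))"

definition two_state :: "real \<Rightarrow> real \<Rightarrow> real \<Rightarrow> real \<Rightarrow> plane \<Rightarrow> real" where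
  "two_state a u1 f0 f1 = (\<lambda>(x, y). if x / y < 1 / shock_slope a u1 then f0 else f1)"

definition sh_rho :: "real \<Rightarrow> real \<Rightarrow> real \<Rightarrow> real \<Rightarrow> plane \<Rightarrow> real" where
  "sh_rho a E0 \<epsilon> u1 = two_state a u1 1 (rho1 a E0 \<epsilon> u1)"

definition sh_u :: "real \<Rightarrow> real \<Rightarrow> plane \<Rightarrow> real" where
  "sh_u a u1 = two_state a u1 1 u1"

definition sh_v :: "real \<Rightarrow> real \<Rightarrow> plane \<Rightarrow> real" where
  "sh_v a u1 = two_state a u1 0 (a * u1)"

definition sh_p :: "real \<Rightarrow> real \<Rightarrow> real \<Rightarrow> real \<Rightarrow> plane \<Rightarrow> real" where
  "sh_p a E0 \<epsilon> u1 = two_state a u1 (p0 E0 \<epsilon>) (p1 a E0 \<epsilon> u1)"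

definition sh_varrho :: "real \<Rightarrow> real \<Rightarrow> real \<Rightarrow> real \<Rightarrow> plane measure" where
  "sh_varrho a E0 \<epsilon> u1 = density lborel (\<lambda>z. ennreal (sh_rho a E0 \<epsilon> u1 z * indicator (Omega a) z))"

definition sh_wp :: "real \<Rightarrow> real \<Rightarrow> real \<Rightarrow> real \<Rightarrow> smeasure" where
  "sh_wp a E0 \<epsilon> u1 = leb (\<lambda>z. sh_p a E0 \<epsilon> u1 z * indicator (Omega a) z)"

definition sh_m :: "real \<Rightarrow> real \<Rightarrow> real \<Rightarrow> real \<Rightarrow> nat \<Rightarrow> smeasure" where
  "sh_m a E0 \<epsilon> u1 k = leb (\<lambda>z.
     [sh_rho a E0 \<epsilon> u1 z * sh_u a u1 z,
      sh_rho a E0 \<epsilon> u1 z * (sh_u a u1 z)\<^sup>2,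
      sh_rho a E0 \<epsilon> u1 z * sh_u a u1 z * sh_v a u1 z,
      sh_rho a E0 \<epsilon> u1 z * sh_u a u1 z * E0] ! k * indicator (Omega a) z)"

definition sh_n :: "real \<Rightarrow> real \<Rightarrow> real \<Rightarrow> real \<Rightarrow> nat \<Rightarrow> smeasure" where
  "sh_n a E0 \<epsilon> u1 k = leb (\<lambda>z.
     [sh_rho a E0 \<epsilon> u1 z * sh_v a u1 z,
      sh_rho a E0 \<epsilon> u1 z * sh_u a u1 z * sh_v a u1 z,
      sh_rho a E0 \<epsilon> u1 z * (sh_v a u1 z)\<^sup>2,
      sh_rho a E0 \<epsilon> u1 z * sh_v a u1 z * E0] ! k * indicator (Omega a) z)"

section \<open>The limiting solution\<close>

text \<open>\<open>b I\<^sub>\<Omega> L\<^sup>2 + c x \<delta>\<^sub>W\<close> for \<open>b, c \<ge> 0\<close>\<close>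

definition layer :: "real \<Rightarrow> real \<Rightarrow> real \<Rightarrow> plane measure" where
  "layer a b c = add_measure
     (density lborel (\<lambda>z. ennreal (b * indicator (Omega a) z))) (wall_measure a (\<lambda>x. c * x))"

definition lim_varrho :: "real \<Rightarrow> plane measure" where
  "lim_varrho \<theta> = layer (tan \<theta>) 1 (sin \<theta> / (cos \<theta>)\<^sup>2)"

definition lim_u :: "real \<Rightarrow> plane \<Rightarrow> real" where
  "lim_u \<theta> z = indicator (Omega (tan \<theta>)) z + (cos \<theta>)\<^sup>2 * indicator (Wall (tan \<theta>)) z"

definition lim_v :: "real \<Rightarrow> plane \<Rightarrow> real" where
  "lim_v \<theta> z = sin \<theta> * cos \<theta> * indicator (Wall (tan \<theta>)) z"

definition lim_m :: "real \<Rightarrow> real \<Rightarrow> nat \<Rightarrow> smeasure" where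
  "lim_m \<theta> E0 k = pos (
     [layer (tan \<theta>) 1 (sin \<theta>),
      layer (tan \<theta>) 1 (sin \<theta> * (cos \<theta>)\<^sup>2),
      layer (tan \<theta>) 0 ((sin \<theta>)\<^sup>2 * cos \<theta>),
      layer (tan \<theta>) E0 (E0 * sin \<theta>)] ! k)"

definition lim_n :: "real \<Rightarrow> real \<Rightarrow> nat \<Rightarrow> smeasure" where
  "lim_n \<theta> E0 k = pos (
     [layer (tan \<theta>) 0 ((sin \<theta>)\<^sup>2 / cos \<theta>),
      layer (tan \<theta>) 0 ((sin \<theta>)\<^sup>2 * cos \<theta>),
      layer (tan \<theta>) 0 ((sin \<theta>) ^ 3),
      layer (tan \<theta>) 0 (E0 * ((sin \<theta>)\<^sup>2 / cos \<theta>))] ! k)"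

definition mach :: "real \<Rightarrow> real \<Rightarrow> real" where
  "mach E0 \<epsilon> = (\<epsilon> * (E0 - 1/2)) powr (- 1/2)"

end

theory Submission
  imports Defs
begin

text \<open>Every measure in the problem is nonnegative and is a piecewise constant density times \<open>\<rho>\<close>, so the
  weak equations reduce to the divergence theorem on wedges \<open>{x > 0, y > b x}\<close> together with an
  integration by parts along the wall. For the limit and, with the pressure \<open>p\<^sub>0\<close> added, for every
  \<open>\<epsilon> \<ge> 0\<close> a uniform stream with a layer of mass on the wall is a solution; for the shock solution the
  weak equations are the Rankine--Hugoniot conditions.

  The shock slope \<open>\<sigma>\<close> tends to \<open>a\<close>, and \<open>\<rho>\<^sub>1 (\<sigma> - a) = \<sigma> / u\<^sub>1\<close> stays bounded. Since the integral of
  \<open>\<phi>\<close> over the wedge above slope \<open>b\<close> has derivative \<open>- \<integral> x \<phi> (x, b x) dx\<close> in \<open>b\<close>, the mass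
  between wall and shock converges to the weighted Dirac measure on the wall.\<close>

section \<open>Nonnegative measures as signed measures\<close>

text \<open>The constants of the layer come from balance laws. A stream with velocity
  \<open>(1, 0)\<close> that hits the wall inelastically keeps its tangential part, with components
  \<open>(cos \<theta>)\<^sup>2\<close> and \<open>sin \<theta> * cos \<theta>\<close>. Mass
  conservation along the wall then fixes the coefficient
  \<open>sin \<theta> / (cos \<theta>)\<^sup>2\<close>, and the lost normal momentum appears as the
  wall pressure \<open>(sin \<theta>)\<^sup>2\<close>. The layer lies outside the open wedge, so the
  equation of state and the entropy condition see only the stream. The entropy condition ranges over
  arbitrary densities and curves and speaks of essential limits. It is settled for all functions
  that take two states up to null sets: nonempty open sets are not null, so one-sided limits are
  among these states, and the sign of the mass flux decides which one is in front. Vague convergence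
  is tested with functions that are only continuous. Hence the limit rests on the dependence of
  wedge integrals on the slope, where no derivative falls on the test function, and not on the weak
  equations.\<close>

lemma add_measure_0_right:
  assumes "sets M = sets borel" "sets N = sets borel" "emeasure N UNIV = 0"
  shows "add_measure M N = M"
proof (rule measure_eqI)
  show "sets (add_measure M N) = sets M" using assms by simp
  fix A assume "A \<in> sets (add_measure M N)"
  then have A: "A \<in> sets borel" by simp
  have "emeasure N A \<le> emeasure N UNIV"
    by (rule emeasure_mono) (use assms in auto)
  then show "emeasure (add_measure M N) A = emeasure M A"
    using A assms by (simp add: emeasure_add_measure)
qed

text \<open>If \<open>f\<close> is not measurable, \<open>density_def\<close> leaves a
  \<open>measure_of\<close> whose value is either the defining integral, which is zero over the null
  measure, or the default zero. Hence \<open>smul_pos_eq\<close> holds for arbitrary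
  \<open>f\<close>.\<close>

lemma density_null_measure_UNIV: "emeasure (density (null_measure borel) f) UNIV = 0"
proof (cases "f \<in> borel_measurable (null_measure (borel :: 'a :: topological_space measure))")
  case True
  then show ?thesis by (subst emeasure_density) (auto simp: nn_integral_null_measure)
next
  case False
  have "emeasure (density (null_measure borel) f) UNIV \<le> 0"
    unfolding density_def
    by (subst emeasure_measure_of_conv) (auto simp: nn_integral_null_measure)
  then show ?thesis by simp
qed

lemma smul_pos_eq:
  assumes "sets M = sets borel"
  shows "smul f (pos M) = (density M (\<lambda>z. ennreal (f z)), density M (\<lambda>z. ennreal (- f z)))"
  unfolding smul_def pos_def
  by (simp add: add_measure_0_right assms density_null_measure_UNIV)

lemma density_0_eq_null_measure:
  assumes "sets M = sets borel"
  shows "density M (\<lambda>z. 0) = null_measure borel"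
  by (rule measure_eqI) (auto simp: assms emeasure_density)

lemma smul_pos:
  assumes "sets M = sets borel" "\<And>z. 0 \<le> f z"
  shows "smul f (pos M) = pos (density M (\<lambda>z. ennreal (f z)))"
  unfolding smul_pos_eq[OF assms(1)]
  using assms by (simp add: pos_def ennreal_neg density_0_eq_null_measure)

lemma smul_pos_density:
  assumes "sets M = sets borel" "\<And>z. 0 \<le> f z" "\<And>z. 0 \<le> g z"
    and [measurable]: "f \<in> borel_measurable borel" "g \<in> borel_measurable borel"
  shows "smul f (pos (density M (\<lambda>z. ennreal (g z)))) = pos (density M (\<lambda>z. ennreal (g z * f z)))"
proof -
  have [measurable_cong]: "sets M = sets borel" by fact
  show ?thesis
    using assms by (simp add: smul_pos density_density_eq ennreal_mult)
qed

lemma leb_eq: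
  assumes "\<And>z. 0 \<le> f z"
  shows "leb f = pos (density lborel (\<lambda>z. ennreal (f z)))"
  using assms by (simp add: leb_def smul_pos)

lemma variation_pos: "sets M = sets borel \<Longrightarrow> variation (pos M) = M"
  by (simp add: variation_def pos_def add_measure_0_right)

lemma pairing_pos: "pairing (pos M) g = (\<integral>z. g z \<partial>M)"
  by (simp add: pairing_def pos_def)

lemma pairing_density:
  assumes [measurable_cong]: "sets M = sets borel" and "\<And>z. 0 \<le> f z"
    and [measurable]: "f \<in> borel_measurable borel" "g \<in> borel_measurable borel"
  shows "pairing (pos (density M (\<lambda>z. ennreal (f z)))) g = (\<integral>z. f z * g z \<partial>M)"
  unfolding pairing_pos using assms(2) by (subst integral_density) auto

lemma signed_radon_pos: "radon M \<Longrightarrow> signed_radon (pos M)"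
  unfolding signed_radon_def pos_def radon_def
  by (auto intro!: bexI[of _ UNIV])

lemma supported_on_pos:
  "sets M = sets borel \<Longrightarrow> supported_on S (pos M) \<longleftrightarrow> emeasure M (- S) = 0"
  by (simp add: supported_on_def variation_pos)

lemma emeasure_density_le:
  assumes "sets M = sets borel" "A \<in> sets borel" "\<And>z. f z \<le> C" "f \<in> borel_measurable borel"
  shows "emeasure (density M (\<lambda>z. ennreal (f z))) A \<le> ennreal C * emeasure M A"
proof -
  have [measurable_cong]: "sets M = sets borel" by fact
  have [measurable]: "A \<in> sets borel" "f \<in> borel_measurable borel" by fact+
  have "emeasure (density M (\<lambda>z. ennreal (f z))) A = (\<integral>\<^sup>+z. ennreal (f z) * indicator A z \<partial>M)"
    by (rule emeasure_density) auto
  also have "\<dots> \<le> (\<integral>\<^sup>+z. ennreal C * indicator A z \<partial>M)"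
    by (intro nn_integral_mono mult_right_mono ennreal_leI assms) auto
  also have "\<dots> = ennreal C * emeasure M A"
    by (simp add: nn_integral_cmult_indicator assms)
  finally show ?thesis .
qed

text \<open>The upper bound controls the whole density, because \<open>ennreal\<close> sends
  negative values to zero.\<close>

lemma radon_density:
  assumes "radon M" "\<And>z. f z \<le> C" "f \<in> borel_measurable borel"
  shows "radon (density M (\<lambda>z. ennreal (f z)))"
  unfolding radon_def
proof (intro conjI allI impI)
  show s: "sets (density M (\<lambda>z. ennreal (f z))) = sets borel" using assms by (simp add: radon_def)
  fix K :: "plane set" assume K: "compact K"
  then have "emeasure (density M (\<lambda>z. ennreal (f z))) K \<le> ennreal C * emeasure M K"
    using assms by (intro emeasure_density_le) (auto simp: radon_def intro: borel_compact)
  also have "\<dots> < \<infinity>" using assms K by (simp add: radon_def ennreal_mult_less_top)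
  finally show "emeasure (density M (\<lambda>z. ennreal (f z))) K < \<infinity>" .
qed

lemma emeasure_density_null:
  assumes "sets M = sets borel" "A \<in> sets borel" "emeasure M A = 0" "f \<in> borel_measurable borel"
  shows "emeasure (density M f) A = 0"
proof -
  have "absolutely_continuous M (density M f)"
    using assms by (intro absolutely_continuousI_density) (simp cong: measurable_cong_sets)
  moreover have "A \<in> null_sets M" using assms by (simp add: null_sets_def)
  ultimately show ?thesis by (auto simp: absolutely_continuous_def null_sets_def)
qed

lemma abs_cont_density:
  assumes "sets M = sets borel" "f \<in> borel_measurable borel"
  shows "pos (density M f) \<lless> pos M"
  unfolding abs_cont_def using assms
  by (simp add: variation_pos absolutely_continuousI_density cong: measurable_cong_sets)

lemma radon_lborel: "radon lborel"
  using emeasure_bounded_finite[OF compact_imp_bounded] by (auto simp: radon_def)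

text \<open>\<open>add_measure\<close> is specified by its values on Borel sets, so the integral is
  built up from indicators. In the limit step the supremum of the sums splits because both sequences
  of integrals are increasing.\<close>

lemma nn_integral_add_measure:
  assumes [measurable_cong]: "sets M = sets borel" "sets N = sets borel"
    and "f \<in> borel_measurable borel"
  shows "(\<integral>\<^sup>+z. f z \<partial>add_measure M N) = (\<integral>\<^sup>+z. f z \<partial>M) + (\<integral>\<^sup>+z. f z \<partial>N)"
  using assms(3)
proof (induction rule: borel_measurable_induct)
  case (cong f g)
  then show ?case by simp
next
  case (set A)
  then show ?case using assms by (simp add: emeasure_add_measure)
next
  case (mult u c)
  then show ?case
    by (subst (1 2 3) nn_integral_cmult) (simp_all add: assms distrib_left cong: measurable_cong_sets)
next
  case (add u v)
  then show ?case
    by (subst (1 2 3) nn_integral_add)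
      (simp_all add: assms ac_simps cong: measurable_cong_sets)
next
  case (seq U)
  have m: "U i \<in> borel_measurable K" if "sets K = sets borel" for i and K :: "plane measure"
    using seq(1) that by (simp cong: measurable_cong_sets)
  have eq: "(\<integral>\<^sup>+z. (SUP i. U i) z \<partial>K) = (SUP i. \<integral>\<^sup>+z. U i z \<partial>K)"
    if "sets K = sets borel" for K :: "plane measure"
    using seq(3) m[OF that] by (simp add: nn_integral_monotone_convergence_SUP image_comp)
  have "(SUP i. \<integral>\<^sup>+z. U i z \<partial>add_measure M N) = (SUP i. (\<integral>\<^sup>+z. U i z \<partial>M) + (\<integral>\<^sup>+z. U i z \<partial>N))"
    using seq(5) by simp
  also have "\<dots> = (SUP i. \<integral>\<^sup>+z. U i z \<partial>M) + (SUP i. \<integral>\<^sup>+z. U i z \<partial>N)"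
    using seq(3) by (intro ennreal_SUP_add) (auto simp: incseq_def le_fun_def intro!: nn_integral_mono)
  finally show ?case by (simp only: eq assms sets_add_measure)
qed

lemma integral_add_measure:
  fixes f :: "plane \<Rightarrow> real"
  assumes s: "sets M = sets borel" "sets N = sets borel"
    and f: "integrable M f" "integrable N f"
  shows "integrable (add_measure M N) f"
    and "(\<integral>z. f z \<partial>add_measure M N) = (\<integral>z. f z \<partial>M) + (\<integral>z. f z \<partial>N)"
proof -
  have [measurable]: "f \<in> borel_measurable borel"
    using f(1) s(1) by (auto dest!: borel_measurable_integrable cong: measurable_cong_sets)
  note nn = nn_integral_add_measure[OF s]
  show i: "integrable (add_measure M N) f"
    using f unfolding real_integrable_def by (simp add: nn cong: measurable_cong_sets)
  \<comment> \<open>\<open>enn2real\<close> sends \<open>top\<close> to 0 and is additive on finite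
    values only; integrability supplies the finiteness.\<close>
  have e: "enn2real (x + y) = enn2real x + enn2real y" if "x \<noteq> top" "y \<noteq> top" for x y
    using that by (simp add: enn2real_plus less_top)
  show "(\<integral>z. f z \<partial>add_measure M N) = (\<integral>z. f z \<partial>M) + (\<integral>z. f z \<partial>N)"
    using f unfolding real_lebesgue_integral_def[OF i] real_lebesgue_integral_def[OF f(1)]
      real_lebesgue_integral_def[OF f(2)] by (simp add: nn e real_integrable_def)
qed

lemma density_add_measure:
  assumes [measurable_cong]: "sets M = sets borel" "sets N = sets borel"
    and [measurable]: "f \<in> borel_measurable borel"
  shows "density (add_measure M N) f = add_measure (density M f) (density N f)"
proof (rule measure_eqI)
  fix A assume "A \<in> sets (density (add_measure M N) f)"
  then have [measurable]: "A \<in> sets borel" by simp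
  show "emeasure (density (add_measure M N) f) A = emeasure (add_measure (density M f) (density N f)) A"
    by (simp add: emeasure_add_measure assms emeasure_density nn_integral_add_measure
        cong: measurable_cong_sets)
qed (simp)

section \<open>Lebesgue densities inside the wedge\<close>

lemma open_Omega: "open (Omega a)"
proof -
  have "Omega a = {z. 0 < fst z} \<inter> {z. a * fst z < snd z}" by (auto simp: Omega_def)
  then show ?thesis by (auto intro!: open_Int open_Collect_less continuous_intros)
qed

lemma Omega_borel [measurable]: "Omega a \<in> sets borel"
  by (simp add: open_Omega)

text \<open>Condition (iv) ranges over all Lebesgue densities \<open>r\<close> on \<open>U\<close>;
  uniqueness of densities over the sigma-finite \<open>lborel\<close> ties each of them to the one
  in use. The hypothesis \<open>eq\<close> is restricted to \<open>Omega a\<close> because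
  \<open>M\<close> may have a singular part on the wall.\<close>

lemma has_leb_density_on_AE:
  assumes s: "sets M = sets borel" and f: "f \<in> borel_measurable borel" "\<And>z. 0 \<le> f z"
    and g: "g \<in> borel_measurable borel" "\<And>z. 0 \<le> g z"
    and eq: "density M (indicator (Omega a)) = density lborel (\<lambda>z. ennreal (indicator (Omega a) z * f z))"
    and U: "open U" "U \<subseteq> Omega a"
    and r: "has_leb_density_on (pos (density M (\<lambda>z. ennreal (g z)))) r U"
  shows "AE z in lborel. z \<in> U \<longrightarrow> r z = g z * f z"
proof -
  have [measurable_cong]: "sets M = sets borel" by fact
  have [measurable]: "f \<in> borel_measurable borel" "g \<in> borel_measurable borel" "U \<in> sets borel"
    using f g U by auto
  have [measurable]: "r \<in> borel_measurable borel" using r by (simp add: has_leb_density_on_def)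
  define h where "h z = indicator U z * r z" for z
  have [measurable]: "h \<in> borel_measurable borel" unfolding h_def by measurable
  have h: "smul (indicator U) (pos (density M (\<lambda>z. ennreal (g z)))) =
      (density lborel (\<lambda>z. ennreal (h z)), density lborel (\<lambda>z. ennreal (- h z)))"
    using r unfolding has_leb_density_on_def leb_def h_def[symmetric]
    by (simp add: smul_pos_eq)
  have "smul (indicator U) (pos (density M (\<lambda>z. ennreal (g z)))) =
      pos (density M (\<lambda>z. ennreal (g z * indicator U z)))"
    by (rule smul_pos_density) (auto simp: s g)
  \<comment> \<open>As \<open>U\<close> lies in \<open>Omega a\<close>, inserting the indicator of
    \<open>Omega a\<close> changes nothing, and \<open>eq\<close> can then replace \<open>M\<close>
    by Lebesgue measure.\<close>
  also have "density M (\<lambda>z. ennreal (g z * indicator U z)) =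
      density (density M (indicator (Omega a))) (\<lambda>z. ennreal (g z * indicator U z))"
    using U by (subst density_density_eq) (auto intro!: density_cong AE_I2 simp: indicator_def)
  also have "\<dots> = density lborel (\<lambda>z. ennreal (indicator U z * (g z * f z)))"
    unfolding eq using U f g
    by (subst density_density_eq)
      (auto intro!: density_cong AE_I2 simp: indicator_def ennreal_mult[symmetric] mult.commute)
  finally have 1: "density lborel (\<lambda>z. ennreal (h z)) = density lborel (\<lambda>z. ennreal (indicator U z * (g z * f z)))"
    and 2: "density lborel (\<lambda>z. ennreal (- h z)) = null_measure borel"
    using h by (auto simp: pos_def)
  have "AE z in lborel. ennreal (h z) = ennreal (indicator U z * (g z * f z))"
    using 1 by (subst (asm) sigma_finite_measure.density_unique_iff[OF lborel.sigma_finite_measure_axioms]) auto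
  \<comment> \<open>The positive parts alone leave the sign of \<open>r\<close> open where
    \<open>g z * f z = 0\<close>; the vanishing negative part settles it.\<close>
  moreover have "density lborel (\<lambda>z. ennreal (- h z)) = density lborel (\<lambda>z. 0)"
    using 2 by (simp add: density_0_eq_null_measure)
  then have "AE z in lborel. ennreal (- h z) = 0"
    by (subst (asm) sigma_finite_measure.density_unique_iff[OF lborel.sigma_finite_measure_axioms]) auto
  ultimately show ?thesis
  proof eventually_elim
    case (elim z)
    show ?case
    proof
      assume z: "z \<in> U"
      then have "ennreal (r z) = ennreal (g z * f z)" "ennreal (- r z) = 0"
        using elim by (auto simp: h_def)
      then show "r z = g z * f z"
        using f g by (auto simp: ennreal_eq_0_iff ennreal_inj)
    qed
  qed
qed

section \<open>The entropy condition for two constant states\<close>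

text \<open>If \<open>l\<close> had positive distance from \<open>C\<close>, then almost no point
  near \<open>z\<close> could belong to \<open>S\<close>. But arbitrarily near \<open>z\<close> the
  set \<open>S\<close> contains nonempty open sets, and these are not null.\<close>

lemma ess_lim_in_closed:
  assumes "ess_lim F S z l" "closed C" "AE w in lborel. w \<in> S \<longrightarrow> F w \<in> C"
    and B: "\<And>r. r > 0 \<Longrightarrow> \<exists>B. open B \<and> B \<noteq> {} \<and> B \<subseteq> S \<inter> ball z r"
  shows "l \<in> C"
proof (rule ccontr)
  assume "l \<notin> C"
  then obtain e where e: "e > 0" "ball l e \<subseteq> - C"
    using assms(2) unfolding closed_def open_contains_ball by blast
  obtain r where r: "r > 0" "AE w in lborel. w \<in> S \<and> dist w z < r \<longrightarrow> dist (F w) l < e"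
    using assms(1) e by (auto simp: ess_lim_def)
  obtain B where B: "open B" "B \<noteq> {}" "B \<subseteq> S \<inter> ball z r" using B[OF r(1)] by auto
  from r(2) assms(3) have "AE w in lborel. w \<notin> B"
  proof eventually_elim
    case (elim w)
    show ?case
    proof
      assume "w \<in> B"
      then have "w \<in> S" "dist w z < r" using B by (auto simp: dist_commute)
      then have "F w \<in> C" "F w \<in> ball l e" using elim by (auto simp: dist_commute)
      then show False using e by blast
    qed
  qed
  then have "B \<in> null_sets lborel"
    using B by (subst (asm) AE_iff_null_sets[symmetric]) auto
  then have "negligible B" by (simp add: negligible_iff_null_sets null_sets_completionI)
  then show False using open_not_negligible B by blast
qed

lemma ess_lim_subset: "ess_lim F S z l \<Longrightarrow> T \<subseteq> S \<Longrightarrow> ess_lim F T z l"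
  unfolding ess_lim_def
proof (intro allI impI)
  fix e :: real assume "T \<subseteq> S" "0 < e"
    and "\<forall>e>0. \<exists>r>0. AE w in lborel. w \<in> S \<and> dist w z < r \<longrightarrow> dist (F w) l < e"
  then obtain r where "r > 0" "AE w in lborel. w \<in> S \<and> dist w z < r \<longrightarrow> dist (F w) l < e" by blast
  moreover from this(2) have "AE w in lborel. w \<in> T \<and> dist w z < r \<longrightarrow> dist (F w) l < e"
    by eventually_elim (use \<open>T \<subseteq> S\<close> in auto)
  ultimately show "\<exists>r>0. AE w in lborel. w \<in> T \<and> dist w z < r \<longrightarrow> dist (F w) l < e" by blast
qed

lemma C1_on_line_derivative:
  assumes "C1_on V \<psi>" "z \<in> V"
  shows "((\<lambda>t. \<psi> (z + t *\<^sub>R d)) has_real_derivative (fst d * dx \<psi> z + snd d * dy \<psi> z)) (at 0)"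
proof -
  have "(\<psi> has_derivative frechet_derivative \<psi> (at z)) (at z)"
    using assms by (auto simp: C1_on_def frechet_derivative_works)
  then have D: "(\<psi> has_derivative frechet_derivative \<psi> (at z)) (at (z + 0 *\<^sub>R d))" by simp
  interpret linear "frechet_derivative \<psi> (at z)"
    using assms by (auto simp: C1_on_def intro: linear_frechet_derivative)
  have "frechet_derivative \<psi> (at z) d = fst d * dx \<psi> z + snd d * dy \<psi> z"
  proof -
    have "d = fst d *\<^sub>R (1, 0) + snd d *\<^sub>R (0, 1)" by (cases d) auto
    then have "frechet_derivative \<psi> (at z) d =
        frechet_derivative \<psi> (at z) (fst d *\<^sub>R (1, 0) + snd d *\<^sub>R (0, 1))" by simp
    also have "\<dots> = fst d * dx \<psi> z + snd d * dy \<psi> z"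
      unfolding add scale by (simp add: dx_def dy_def)
    finally show ?thesis .
  qed
  then have d: "frechet_derivative \<psi> (at z) (t *\<^sub>R d) = t * (fst d * dx \<psi> z + snd d * dy \<psi> z)" for t
    by (simp add: scale)
  have "((\<lambda>t. \<psi> (z + t *\<^sub>R d)) has_derivative
      (\<lambda>t. frechet_derivative \<psi> (at z) (t *\<^sub>R d))) (at 0)"
    by (rule has_derivative_compose[of "\<lambda>t. z + t *\<^sub>R d" "\<lambda>t. t *\<^sub>R d", OF _ D])
      (auto intro!: derivative_eq_intros)
  then show ?thesis
    unfolding d has_field_derivative_def by (simp add: mult.commute[of _ "fst d * dx \<psi> z + snd d * dy \<psi> z"])
qed

text \<open>Moving from \<^term>\<open>z\<close> a short way along a direction in which \<open>\<psi>\<close> decreases leads into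
  \<^term>\<open>{w \<in> V. \<psi> w < 0}\<close>, which makes this set large enough to determine essential limits.\<close>

lemma C1_on_negative_side:
  assumes V: "C1_on V \<psi>" "z \<in> V" "\<psi> z = 0" and d: "fst d * dx \<psi> z + snd d * dy \<psi> z < 0" and "r > 0"
  shows "\<exists>t>0. z + t *\<^sub>R d \<in> {w\<in>V. \<psi> w < 0} \<inter> ball z r"
proof -
  obtain s1 where s1: "s1 > 0" "\<And>t. t > 0 \<Longrightarrow> t < s1 \<Longrightarrow> \<psi> (z + t *\<^sub>R d) < 0"
    using DERIV_neg_dec_right[OF C1_on_line_derivative[OF V(1,2)] d] V(3) by auto
  have "open (V \<inter> ball z r)" using V by (auto simp: C1_on_def)
  moreover have "z \<in> V \<inter> ball z r" using V assms by auto
  ultimately have "\<forall>\<^sub>F w in nhds z. w \<in> V \<inter> ball z r"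
    by (rule eventually_nhds_in_open)
  moreover have "((\<lambda>t. z + t *\<^sub>R d) \<longlongrightarrow> z + 0 *\<^sub>R d) (at_right 0)"
    by (intro tendsto_intros)
  ultimately have "\<forall>\<^sub>F t in at_right 0. z + t *\<^sub>R d \<in> V \<inter> ball z r"
    by (auto simp: filterlim_iff dest: spec[of _ "\<lambda>w. w \<in> V \<inter> ball z r"])
  then obtain s2 where s2: "s2 > 0" "\<And>t. t > 0 \<Longrightarrow> t < s2 \<Longrightarrow> z + t *\<^sub>R d \<in> V \<inter> ball z r"
    by (auto simp: eventually_at_right_field)
  show ?thesis
    by (rule exI[of _ "min s1 s2 / 2"]) (use s1(1) s1(2)[of "min s1 s2 / 2"] s2(1) s2(2)[of "min s1 s2 / 2"] in auto)
qed

lemma open_C1_on_sublevel: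
  assumes "C1_on V \<psi>"
  shows "open {w\<in>V. \<psi> w < 0}"
proof -
  have "continuous_on V \<psi>"
    using assms by (auto simp: C1_on_def intro!: continuous_at_imp_continuous_on differentiable_imp_continuous_within)
  then have "open (\<psi> -` {..<0} \<inter> V)"
    using assms by (subst (asm) continuous_on_open_vimage) (auto simp: C1_on_def)
  moreover have "\<psi> -` {..<0} \<inter> V = {w\<in>V. \<psi> w < 0}" by auto
  ultimately show ?thesis by simp
qed

text \<open>Makes the results on the side \<open>\<psi> < 0\<close> available on the side
  \<open>\<psi> > 0\<close>.\<close>

lemma C1_on_uminus:
  assumes "C1_on V \<psi>"
  shows "C1_on V (\<lambda>w. - \<psi> w)" "z \<in> V \<Longrightarrow> dx (\<lambda>w. - \<psi> w) z = - dx \<psi> z"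
    "z \<in> V \<Longrightarrow> dy (\<lambda>w. - \<psi> w) z = - dy \<psi> z"
proof -
  have *: "frechet_derivative (\<lambda>w. - \<psi> w) (at z) = (\<lambda>d. - frechet_derivative \<psi> (at z) d)" if "z \<in> V" for z
    using assms that
    by (intro frechet_derivative_at[symmetric] derivative_intros)
      (auto simp: C1_on_def frechet_derivative_works)
  then show x: "z \<in> V \<Longrightarrow> dx (\<lambda>w. - \<psi> w) z = - dx \<psi> z" and y: "z \<in> V \<Longrightarrow> dy (\<lambda>w. - \<psi> w) z = - dy \<psi> z" for z
    by (auto simp: dx_def dy_def)
  show "C1_on V (\<lambda>w. - \<psi> w)"
    using assms unfolding C1_on_def
    by (auto intro!: derivative_intros continuous_intros simp: x y cong: continuous_on_cong)
qed

text \<open>If the state on \<open>\<psi> < 0\<close> were not \<open>S0\<close>, the one on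
  \<open>\<psi> > 0\<close> would be \<open>S0\<close>, whose flux is \<open>dx \<psi> z\<close>; so
  \<open>\<psi>\<close> would increase in the x direction. As the line
  \<open>y = \<sigma> * x\<close> has positive slope, moving left from a point on or above it enters
  the region of \<open>S0\<close>, and a short move right from a point below it stays in that of
  \<open>S1\<close>. Either way one limit gets the wrong value. So the flow passes from
  \<open>S0\<close> to \<open>S1\<close>, where the pressure is larger. The case
  \<open>S0 = S1\<close> is the uniform stream, which has no jump.\<close>

lemma entropy_at_two_states:
  fixes S0 S1 :: "real \<times> real \<times> real \<times> real \<times> real"
  assumes F: "AE w in lborel. w \<in> U \<longrightarrow>
      (\<rho> w, u w, v w, E w, p w) = (if snd w > \<sigma> * fst w then S0 else S1)"
    and S0: "S0 = (1, 1, 0, E0, q0)" and S1: "S1 = (r1, u1, v1, e1, q1)"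
    and S: "S0 = S1 \<or> q0 < q1" and \<sigma>: "\<sigma> > 0" and z: "z \<in> U"
  shows "entropy_at U \<rho> u v E p z"
  unfolding entropy_at_def
proof (intro allI impI, elim conjE)
  fix V \<psi> and ra ua va Ea pa rb ub vb Eb pb :: real
  let ?F = "\<lambda>w. (\<rho> w, u w, v w, E w, p w)"
  let ?la = "(ra, ua, va, Ea, pa)" and ?lb = "(rb, ub, vb, Eb, pb)"
  assume V: "C1_on V \<psi>" "z \<in> V" "V \<subseteq> U" "\<psi> z = 0" "(dx \<psi> z, dy \<psi> z) \<noteq> (0, 0)"
    and la: "ess_lim ?F {w\<in>V. \<psi> w < 0} z ?la" and lb: "ess_lim ?F {w\<in>V. 0 < \<psi> w} z ?lb"
    and ne: "(ra, ua, va, Ea) \<noteq> (rb, ub, vb, Eb)"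
    and fb: "0 < rb * (ub * dx \<psi> z + vb * dy \<psi> z)"
  let ?g = "(dx \<psi> z)\<^sup>2 + (dy \<psi> z)\<^sup>2"
  have g: "?g > 0" using V(5) by (auto simp: sum_power2_gt_zero_iff)
  note N = C1_on_uminus(1)[OF V(1)] and N' = C1_on_uminus(2,3)[OF V(1,2)]
  have z': "- \<psi> z = 0" using V(4) by simp
  have lb': "ess_lim ?F {w\<in>V. - \<psi> w < 0} z ?lb" using lb by simp
  \<comment> \<open>Each side of the curve has nonempty open parts arbitrarily near
    \<open>z\<close>, so each one-sided limit is one of the two states.\<close>
  have gen: "l \<in> {S0, S1}"
    if h: "ess_lim ?F {w\<in>V. \<eta> w < 0} z l" "C1_on V \<eta>" "\<eta> z = 0"
      "fst d * dx \<eta> z + snd d * dy \<eta> z < 0" for \<eta> l d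
  proof (rule ess_lim_in_closed[OF h(1)])
    show "AE w in lborel. w \<in> {w \<in> V. \<eta> w < 0} \<longrightarrow> ?F w \<in> {S0, S1}"
      using F by eventually_elim (use V(3) in auto)
    fix r :: real assume r: "r > 0"
    obtain t where t: "z + t *\<^sub>R d \<in> {w\<in>V. \<eta> w < 0} \<inter> ball z r"
      using C1_on_negative_side[OF h(2) V(2) h(3,4) r] by blast
    then show "\<exists>B. open B \<and> B \<noteq> {} \<and> B \<subseteq> {w\<in>V. \<eta> w < 0} \<inter> ball z r"
      using open_C1_on_sublevel[OF h(2)] by (intro exI[of _ "{w\<in>V. \<eta> w < 0} \<inter> ball z r"]) blast
  qed auto
  \<comment> \<open>The direction is minus the gradient, along which the derivative of
    \<open>\<psi>\<close> is \<open>- ?g\<close>.\<close>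
  have a: "?la \<in> {S0, S1}"
    using g by (intro gen[OF la V(1,4), of "(- dx \<psi> z, - dy \<psi> z)"]) (auto simp: power2_eq_square)
  have b: "?lb \<in> {S0, S1}"
    using g V(2,4) by (intro gen[OF lb' N, of "(dx \<psi> z, dy \<psi> z)"]) (auto simp: power2_eq_square N')
  have "S0 \<noteq> S1" using a b ne by auto
  then have q: "q0 < q1" using S by simp
  have "?la = S0"
  proof (rule ccontr)
    assume "?la \<noteq> S0"
    then have "?lb = S0" using a b ne by auto
    then have dx: "dx \<psi> z > 0" using fb S0 by auto
    show False
    proof (cases "snd z \<ge> \<sigma> * fst z")
      case True
      let ?T = "{w\<in>V. \<psi> w < 0} \<inter> {w. snd w > \<sigma> * fst w}"
      have T: "open ?T" by (intro open_Int open_C1_on_sublevel V open_Collect_less continuous_intros)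
      have "?la \<in> {S0}"
      proof (rule ess_lim_in_closed[OF ess_lim_subset[OF la, of ?T]])
        show "AE w in lborel. w \<in> ?T \<longrightarrow> ?F w \<in> {S0}"
          using F by eventually_elim (use V(3) in auto)
        fix r :: real assume r: "r > 0"
        have "fst (-1, 0) * dx \<psi> z + snd (-1, 0) * dy \<psi> z < 0" using dx by simp
        then obtain t where t: "t > 0" "z + t *\<^sub>R (-1, 0) \<in> {w\<in>V. \<psi> w < 0} \<inter> ball z r"
          using C1_on_negative_side[OF V(1,2,4) _ r] by blast
        have "0 < \<sigma> * t" using t \<sigma> by simp
        then have "snd (z + t *\<^sub>R (-1, 0)) > \<sigma> * fst (z + t *\<^sub>R (-1, 0))"
          using True by (cases z) (simp add: algebra_simps)
        with t have "z + t *\<^sub>R (-1, 0) \<in> ?T \<inter> ball z r" by blast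
        then show "\<exists>B. open B \<and> B \<noteq> {} \<and> B \<subseteq> ?T \<inter> ball z r"
          using T by (intro exI[of _ "?T \<inter> ball z r"]) blast
      qed auto
      with \<open>?la \<noteq> S0\<close> show False by simp
    next
      case False
      let ?T = "{w\<in>V. - \<psi> w < 0} \<inter> {w. snd w < \<sigma> * fst w}"
      have T: "open ?T" by (intro open_Int open_C1_on_sublevel N open_Collect_less continuous_intros)
      have "?lb \<in> {S1}"
      proof (rule ess_lim_in_closed[OF ess_lim_subset[OF lb', of ?T]])
        show "AE w in lborel. w \<in> ?T \<longrightarrow> ?F w \<in> {S1}"
          using F by eventually_elim (use V(3) in auto)
        fix r :: real assume r: "r > 0"
        have "open {w. snd w < \<sigma> * fst w}" by (intro open_Collect_less continuous_intros)
        moreover have "z \<in> {w. snd w < \<sigma> * fst w}" using False by simp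
        ultimately obtain r' where r': "r' > 0" "ball z r' \<subseteq> {w. snd w < \<sigma> * fst w}"
          by (rule openE)
        \<comment> \<open>Only short steps to the right stay below the line, hence the smaller
          radius.\<close>
        have mr: "min r r' > 0" using r r' by simp
        have "fst (1, 0) * dx (\<lambda>w. - \<psi> w) z + snd (1, 0) * dy (\<lambda>w. - \<psi> w) z < 0"
          using dx N' by simp
        then obtain t where "z + t *\<^sub>R (1, 0) \<in> {w\<in>V. - \<psi> w < 0} \<inter> ball z (min r r')"
          using C1_on_negative_side[OF N V(2) z' _ mr] by blast
        then have "z + t *\<^sub>R (1, 0) \<in> ?T \<inter> ball z r"
          using subsetD[OF r'(2), of "z + t *\<^sub>R (1, 0)"] by simp
        then show "\<exists>B. open B \<and> B \<noteq> {} \<and> B \<subseteq> ?T \<inter> ball z r"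
          using T by (intro exI[of _ "?T \<inter> ball z r"]) blast
      qed auto
      with \<open>?lb = S0\<close> \<open>S0 \<noteq> S1\<close> show False by simp
    qed
  qed
  moreover from this have "?lb = S1" using b ne by auto
  ultimately show "pa < pb" using q S0 S1 by auto
qed

section \<open>The divergence theorem on wedges\<close>

definition wedge_integral :: "real \<Rightarrow> (plane \<Rightarrow> real) \<Rightarrow> real" where
  "wedge_integral b g = (\<integral>z. indicator (Omega b) z * g z \<partial>lborel)"

text \<open>Parametrised by \<open>x\<close> and not by arc length: the factor
  \<open>sqrt (1 + a\<^sup>2)\<close> of the wall measure stays outside, so that the same integral
  serves rays of every slope.\<close>

definition ray_integral :: "real \<Rightarrow> (real \<Rightarrow> real) \<Rightarrow> (plane \<Rightarrow> real) \<Rightarrow> real" where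
  "ray_integral b w g = (\<integral>x. indicator {0..} x * (w x * g (x, b * x)) \<partial>lborel)"

lemma C0_test_continuous: "g \<in> C0_test \<Longrightarrow> continuous_on UNIV g"
  by (simp add: C0_test_def)

lemma C0_test_measurable: "g \<in> C0_test \<Longrightarrow> g \<in> borel_measurable borel"
  by (simp add: C0_test_def borel_measurable_continuous_onI)

lemma C0_test_support:
  assumes "g \<in> C0_test"
  obtains R where "R > 0" "\<And>x y. R \<le> \<bar>x\<bar> \<or> R \<le> \<bar>y\<bar> \<Longrightarrow> g (x, y) = 0"
proof -
  have "bounded (closure {z. g z \<noteq> 0})"
    using assms by (auto simp: C0_test_def compact_support_def compact_imp_bounded)
  then obtain B where B: "\<And>z. z \<in> closure {z. g z \<noteq> 0} \<Longrightarrow> norm z \<le> B"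
    by (auto simp: bounded_iff)
  show ?thesis
  proof (rule that[of "max B 0 + 1"])
    fix x y :: real assume xy: "max B 0 + 1 \<le> \<bar>x\<bar> \<or> max B 0 + 1 \<le> \<bar>y\<bar>"
    show "g (x, y) = 0"
    proof (rule ccontr)
      assume "g (x, y) \<noteq> 0"
      then have "(x, y) \<in> closure {z. g z \<noteq> 0}" by (intro subsetD[OF closure_subset]) simp
      from B[OF this] have "norm (x, y) \<le> B" .
      moreover have "\<bar>x\<bar> \<le> norm (x, y)" "\<bar>y\<bar> \<le> norm (x, y)"
        using norm_fst_le[of x y] norm_snd_le[of y x] by auto
      ultimately show False using xy by auto
    qed
  qed auto
qed

lemma C0_test_integrable:
  assumes "g \<in> C0_test"
  shows "integrable lborel g"
proof -
  let ?S = "closure {z. g z \<noteq> 0}"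
  have "integrable lborel (\<lambda>z. indicator ?S z *\<^sub>R g z)"
    using assms by (intro borel_integrable_compact)
      (auto simp: C0_test_def compact_support_def intro: continuous_on_subset)
  moreover have "(\<lambda>z. indicator ?S z *\<^sub>R g z) = g"
    using closure_subset[of "{z. g z \<noteq> 0}"] by (auto simp: indicator_def fun_eq_iff)
  ultimately show ?thesis by simp
qed

lemma integrable_indicator_mult:
  assumes "integrable lborel g" "A \<in> sets borel"
  shows "integrable lborel (\<lambda>z::'a::euclidean_space. indicator A z * g z :: real)"
  using integrable_mult_indicator[of A lborel g] assms by simp

lemma integrable_real_compact_support:
  fixes f :: "real \<Rightarrow> real"
  assumes "continuous_on UNIV f" "\<And>x. R \<le> \<bar>x\<bar> \<Longrightarrow> f x = 0"
  shows "integrable lborel f"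
proof -
  have "integrable lborel (\<lambda>x. indicator {-R..R} x *\<^sub>R f x)"
    using assms(1) by (intro borel_integrable_compact) (auto intro: continuous_on_subset)
  moreover have "(\<lambda>x. indicator {-R..R} x *\<^sub>R f x) = f"
    using assms(2) by (force simp: indicator_def)
  ultimately show ?thesis by simp
qed

lemma C0_test_continuous_compose:
  assumes "g \<in> C0_test" "continuous_on S p" "continuous_on S q"
  shows "continuous_on S (\<lambda>x. g (p x, q x))"
  by (rule continuous_on_compose2[OF C0_test_continuous[OF assms(1)]])
    (auto intro!: continuous_intros assms)

lemma integrable_ray:
  assumes g: "g \<in> C0_test" and w: "continuous_on UNIV w"
  shows "integrable lborel (\<lambda>x. w x * g (x, b * x))"
proof -
  obtain R where R: "R > 0" "\<And>x y. R \<le> \<bar>x\<bar> \<or> R \<le> \<bar>y\<bar> \<Longrightarrow> g (x, y) = 0"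
    using C0_test_support[OF g] by blast
  show ?thesis
    by (rule integrable_real_compact_support[of _ R])
      (auto intro!: continuous_intros C0_test_continuous_compose g w simp: R)
qed

lemma C1_on_line_derivative_at:
  assumes "C1_on UNIV \<phi>"
  shows "((\<lambda>t. \<phi> (z + t *\<^sub>R d)) has_real_derivative
    (fst d * dx \<phi> (z + t *\<^sub>R d) + snd d * dy \<phi> (z + t *\<^sub>R d))) (at t)"
proof -
  have "((\<lambda>s. \<phi> ((z + t *\<^sub>R d) + s *\<^sub>R d)) has_real_derivative
      (fst d * dx \<phi> (z + t *\<^sub>R d) + snd d * dy \<phi> (z + t *\<^sub>R d))) (at 0)"
    using assms by (rule C1_on_line_derivative) simp
  moreover have "(z + t *\<^sub>R d) + s *\<^sub>R d = z + (s + t) *\<^sub>R d" for s by (simp add: algebra_simps)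
  ultimately show ?thesis
    using DERIV_shift[of "\<lambda>t. \<phi> (z + t *\<^sub>R d)" _ 0 t] by simp
qed

text \<open>The complement of the closed support is open and \<open>\<phi>\<close> vanishes on it,
  so the derivatives vanish there too and have their supports in the same compact set.\<close>

lemma C1_test_C0_test:
  assumes "\<phi> \<in> C1_test"
  shows "\<phi> \<in> C0_test" "dx \<phi> \<in> C0_test" "dy \<phi> \<in> C0_test"
proof -
  have C1: "C1_on UNIV \<phi>" and cs: "compact_support \<phi>" using assms by (auto simp: C1_test_def)
  then show "\<phi> \<in> C0_test"
    by (auto simp: C0_test_def C1_on_def intro!: continuous_at_imp_continuous_on
        differentiable_imp_continuous_within)
  let ?S = "closure {z. \<phi> z \<noteq> 0}"
  have 0: "frechet_derivative \<phi> (at z) = (\<lambda>_. 0)" if "z \<notin> ?S" for z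
  proof (rule frechet_derivative_at[symmetric])
    have "((\<lambda>_. 0) has_derivative (\<lambda>_. 0)) (at z)" by simp
    then show "(\<phi> has_derivative (\<lambda>_. 0)) (at z)"
    proof (rule has_derivative_transform_within_open)
      show "open (- ?S)" by auto
      show "z \<in> - ?S" using that by simp
      show "0 = \<phi> w" if "w \<in> - ?S" for w
        using that closure_subset[of "{z. \<phi> z \<noteq> 0}"] by auto
    qed
  qed
  have cl: "compact (closure {z. f z \<noteq> 0})" if "\<And>z. z \<notin> ?S \<Longrightarrow> f z = 0" for f :: "plane \<Rightarrow> real"
  proof -
    have "closure {z. f z \<noteq> 0} \<subseteq> ?S"
      by (rule closure_minimal) (use that in auto)
    then show ?thesis
      using cs unfolding compact_support_def by (metis closed_closure compact_Int_closed inf.absorb_iff2)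
  qed
  show "dx \<phi> \<in> C0_test" "dy \<phi> \<in> C0_test"
    using C1 by (auto simp: C0_test_def C1_on_def compact_support_def dx_def dy_def 0
        simp del: compact_closure intro!: cl)
qed

section \<open>Integration of derivatives over half-lines and wedges\<close>

lemma integral_FTC_Ioi:
  fixes F f :: "real \<Rightarrow> real"
  assumes F: "\<And>x. (F has_real_derivative f x) (at x)" and f: "continuous_on UNIV f"
    and R: "\<And>x. R \<le> x \<Longrightarrow> F x = 0" "\<And>x. R \<le> x \<Longrightarrow> f x = 0"
  shows "(\<integral>x. indicator {c<..} x * f x \<partial>lborel) = - F c"
proof -
  \<comment> \<open>The maximum keeps the interval nonempty when \<open>c\<close> lies beyond
    \<open>R\<close>; in both cases \<open>F\<close> vanishes at its right end.\<close>
  let ?M = "max c R"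
  have [measurable]: "f \<in> borel_measurable borel" using f by (rule borel_measurable_continuous_onI)
  have "(\<integral>x. indicator {c<..} x * f x \<partial>lborel) = (\<integral>x. f x * indicator {c..?M} x \<partial>lborel)"
  proof (rule integral_cong_AE)
    show "AE x in lborel. indicator {c<..} x * f x = f x * indicator {c..?M} x"
      using AE_lborel_singleton[of c] by eventually_elim (auto simp: indicator_def R)
  qed auto
  also have "\<dots> = F ?M - F c"
    using f by (intro integral_FTC_Icc_real F) (auto simp: continuous_on_eq_continuous_at)
  finally show ?thesis by (simp add: R)
qed

lemma wedge_integral_iterated:
  assumes "g \<in> C0_test"
  shows "wedge_integral b g =
      (\<integral>x. indicator {0<..} x * (\<integral>y. indicator {b * x<..} y * g (x, y) \<partial>lborel) \<partial>lborel)"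
    and "integrable lborel (\<lambda>x. indicator {0<..} x * (\<integral>y. indicator {b * x<..} y * g (x, y) \<partial>lborel))"
proof -
  have i: "integrable (lborel \<Otimes>\<^sub>M lborel) (\<lambda>z. indicator (Omega b) z * g z)"
    using assms by (simp add: lborel_prod integrable_indicator_mult C0_test_integrable)
  have e: "(\<integral>y. indicator (Omega b) (x, y) * g (x, y) \<partial>lborel) =
      indicator {0<..} x * (\<integral>y. indicator {b * x<..} y * g (x, y) \<partial>lborel)" for x
    by (auto simp: indicator_def Omega_def)
  show "wedge_integral b g =
      (\<integral>x. indicator {0<..} x * (\<integral>y. indicator {b * x<..} y * g (x, y) \<partial>lborel) \<partial>lborel)"
    using lborel_pair.integral_fst'[OF i] by (simp add: e wedge_integral_def lborel_prod)
  show "integrable lborel (\<lambda>x. indicator {0<..} x * (\<integral>y. indicator {b * x<..} y * g (x, y) \<partial>lborel))"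
    using lborel_pair.integrable_fst'[OF i] by (simp add: e)
qed

lemma integral_Ioi_eq_Ici:
  fixes f :: "real \<Rightarrow> real"
  assumes "f \<in> borel_measurable borel"
  shows "(\<integral>x. indicator {c<..} x * f x \<partial>lborel) = (\<integral>x. indicator {c..} x * f x \<partial>lborel)"
proof (rule integral_cong_AE)
  have [measurable]: "f \<in> borel_measurable borel" by fact
  show "(\<lambda>x. indicator {c<..} x * f x) \<in> borel_measurable lborel"
    "(\<lambda>x. indicator {c..} x * f x) \<in> borel_measurable lborel" by measurable
  show "AE x in lborel. indicator {c<..} x * f x = indicator {c..} x * f x"
    using AE_lborel_singleton[of c] by eventually_elim (auto simp: indicator_def)
qed

text \<open>Vertical sections of the wedge are half-lines, so only their lower ends, the points of
  the ray, contribute.\<close>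

lemma wedge_integral_dy:
  assumes "\<phi> \<in> C1_test"
  shows "wedge_integral b (dy \<phi>) = - ray_integral b (\<lambda>_. 1) \<phi>"
proof -
  note C0 = C1_test_C0_test[OF assms]
  have C1: "C1_on UNIV \<phi>" using assms by (simp add: C1_test_def)
  obtain R where R: "R > 0" "\<And>x y. R \<le> \<bar>x\<bar> \<or> R \<le> \<bar>y\<bar> \<Longrightarrow> \<phi> (x, y) = 0" using C0_test_support[OF C0(1)] by blast
  obtain R' where R': "R' > 0" "\<And>x y. R' \<le> \<bar>x\<bar> \<or> R' \<le> \<bar>y\<bar> \<Longrightarrow> dy \<phi> (x, y) = 0"
    using C0_test_support[OF C0(3)] by blast
  have "(\<integral>y. indicator {b * x<..} y * dy \<phi> (x, y) \<partial>lborel) = - \<phi> (x, b * x)" for x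
  proof (rule integral_FTC_Ioi[of "\<lambda>y. \<phi> (x, y)" _ "max R R'"])
    show "((\<lambda>y. \<phi> (x, y)) has_real_derivative dy \<phi> (x, y)) (at y)" for y
      using C1_on_line_derivative_at[OF C1, of "(x, 0)" "(0, 1)" y] by simp
  qed (auto intro!: C0_test_continuous_compose C0 continuous_intros
      simp: R R' order_trans[OF _ abs_ge_self])
  then have "wedge_integral b (dy \<phi>) = - (\<integral>x. indicator {0<..} x * \<phi> (x, b * x) \<partial>lborel)"
    by (simp add: wedge_integral_iterated C0)
  also have "(\<lambda>x. \<phi> (x, b * x)) \<in> borel_measurable borel"
    by (intro borel_measurable_continuous_onI C0_test_continuous_compose C0 continuous_intros)
  then have "(\<integral>x. indicator {0<..} x * \<phi> (x, b * x) \<partial>lborel) = ray_integral b (\<lambda>_. 1) \<phi>"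
    by (simp add: integral_Ioi_eq_Ici ray_integral_def)
  finally show ?thesis .
qed

text \<open>Horizontal sections run from the inflow line \<open>x = 0\<close> to the ray at
  \<open>x = y / b\<close>. The near ends give the inflow term; the far ends, after the substitution
  \<open>y = b * x\<close>, give the ray integral with its factor \<open>b\<close>.\<close>

lemma wedge_integral_dx:
  assumes "\<phi> \<in> C1_test" and b: "b > 0"
  shows "wedge_integral b (dx \<phi>) = b * ray_integral b (\<lambda>_. 1) \<phi> - inflow 1 \<phi>"
proof -
  note C0 = C1_test_C0_test[OF assms(1)]
  have C1: "C1_on UNIV \<phi>" using assms by (simp add: C1_test_def)
  have cont: "continuous_on UNIV (\<lambda>y. \<phi> (y / b, y))" "continuous_on UNIV (\<lambda>y. \<phi> (0, y))"
    "continuous_on UNIV (\<lambda>x. \<phi> (x, b * x))"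
    using b by (auto intro!: C0_test_continuous_compose C0 continuous_intros)
  note [measurable] = cont[THEN borel_measurable_continuous_onI]
  obtain R where R: "R > 0" "\<And>x y. R \<le> \<bar>x\<bar> \<or> R \<le> \<bar>y\<bar> \<Longrightarrow> \<phi> (x, y) = 0" using C0_test_support[OF C0(1)] by blast
  have int: "integrable lborel (\<lambda>y. \<phi> (y / b, y))" "integrable lborel (\<lambda>y. \<phi> (0, y))"
    by (rule integrable_real_compact_support[of _ R]; use cont R in auto)+
  have i: "integrable (lborel \<Otimes>\<^sub>M lborel) (\<lambda>(x, y). indicator (Omega b) (x, y) * dx \<phi> (x, y))"
    using integrable_indicator_mult[OF C0_test_integrable[OF C0(2)] Omega_borel[of b]]
    by (simp add: lborel_prod case_prod_beta')
  have inner: "(\<integral>x. indicator (Omega b) (x, y) * dx \<phi> (x, y) \<partial>lborel) =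
      indicator {0<..} y * \<phi> (y / b, y) - indicator {0<..} y * \<phi> (0, y)" for y
  proof (cases "y > 0")
    case True
    have [measurable]: "(\<lambda>x. dx \<phi> (x, y)) \<in> borel_measurable borel"
      by (intro borel_measurable_continuous_onI C0_test_continuous_compose C0 continuous_intros)
    have "(\<integral>x. indicator (Omega b) (x, y) * dx \<phi> (x, y) \<partial>lborel) =
        (\<integral>x. dx \<phi> (x, y) * indicator {0..y / b} x \<partial>lborel)"
    proof (rule integral_cong_AE)
      show "AE x in lborel. indicator (Omega b) (x, y) * dx \<phi> (x, y) = dx \<phi> (x, y) * indicator {0..y / b} x"
        using AE_lborel_singleton[of 0] AE_lborel_singleton[of "y / b"] 
        by eventually_elim (use b in \<open>auto simp: indicator_def Omega_def field_simps\<close>)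
      have "(\<lambda>x. (x, y)) \<in> borel \<rightarrow>\<^sub>M borel" 
        by (intro borel_measurable_continuous_onI continuous_intros)
      then have "(\<lambda>x. indicat_real (Omega b) (x, y)) \<in> borel_measurable borel"
        by measurable
      then show "(\<lambda>x. indicator (Omega b) (x, y) * dx \<phi> (x, y)) \<in> borel_measurable lborel" by simp
    qed auto
    also have "\<dots> = \<phi> (y / b, y) - \<phi> (0, y)"
    proof (rule integral_FTC_Icc_real[of _ _ "\<lambda>x. \<phi> (x, y)"])
      show "((\<lambda>x. \<phi> (x, y)) has_real_derivative dx \<phi> (x, y)) (at x)" for x
        using C1_on_line_derivative_at[OF C1, of "(0, y)" "(1, 0)" x] by simp
      have "continuous_on UNIV (\<lambda>x. dx \<phi> (x, y))"
        by (intro C0_test_continuous_compose C0 continuous_intros)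
      then show "isCont (\<lambda>x. dx \<phi> (x, y)) x" for x by (simp add: continuous_on_eq_continuous_at)
      show "0 \<le> y / b" using True b by simp
    qed
    finally show ?thesis using True by simp
  next
    case False
    have "indicator (Omega b) (x, y) = (0 :: real)" for x
      using False b by (auto simp: indicator_def Omega_def dest: mult_pos_pos[of b x])
    then show ?thesis using False by simp
  qed
  have "wedge_integral b (dx \<phi>) =
      (\<integral>y. (\<integral>x. indicator (Omega b) (x, y) * dx \<phi> (x, y) \<partial>lborel) \<partial>lborel)"
    unfolding lborel_pair.integral_snd[OF i]
    by (simp add: lborel_prod case_prod_beta' wedge_integral_def)
  also have "\<dots> = (\<integral>y. indicator {0<..} y * \<phi> (y / b, y) \<partial>lborel) - (\<integral>y. indicator {0<..} y * \<phi> (0, y) \<partial>lborel)"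
    unfolding inner
    by (intro Bochner_Integration.integral_diff integrable_indicator_mult int) auto
  also have "(\<integral>y. indicator {0<..} y * \<phi> (0, y) \<partial>lborel) = inflow 1 \<phi>"
    by (simp add: integral_Ioi_eq_Ici inflow_def set_lebesgue_integral_def)
  also have "(\<integral>y. indicator {0<..} y * \<phi> (y / b, y) \<partial>lborel) =
      b * (\<integral>x. indicator {0<..} (b * x) * \<phi> (x, b * x) \<partial>lborel)"
    using b lborel_integral_real_affine[of b "\<lambda>y. indicator {0<..} y * \<phi> (y / b, y)" 0] by simp
  also have "(\<lambda>x. indicator {0<..} (b * x) * \<phi> (x, b * x)) = (\<lambda>x. indicator {0<..} x * \<phi> (x, b * x))"
    using b by (auto simp: indicator_def zero_less_mult_iff)
  also have "(\<integral>x. indicator {0<..} x * \<phi> (x, b * x) \<partial>lborel) = ray_integral b (\<lambda>_. 1) \<phi>"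
    by (simp add: integral_Ioi_eq_Ici ray_integral_def)
  finally show ?thesis .
qed

text \<open>The derivative of \<open>x * \<phi> (x, b * x)\<close> is integrated along the ray, and
  the weight \<open>x\<close> removes the boundary term at the apex. This is the balance law for a
  layer whose mass grows in proportion to \<open>x\<close>.\<close>

lemma ray_integral_derivative:
  assumes "\<phi> \<in> C1_test"
  shows "ray_integral b (\<lambda>x. x) (dx \<phi>) + b * ray_integral b (\<lambda>x. x) (dy \<phi>) = - ray_integral b (\<lambda>_. 1) \<phi>"
proof -
  note C0 = C1_test_C0_test[OF assms(1)]
  have C1: "C1_on UNIV \<phi>" using assms by (simp add: C1_test_def)
  let ?f = "\<lambda>x. 1 * \<phi> (x, b * x)" and ?fx = "\<lambda>x. x * dx \<phi> (x, b * x)" and ?fy = "\<lambda>x. x * dy \<phi> (x, b * x)"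
  obtain R where R: "R > 0" "\<And>x y. R \<le> \<bar>x\<bar> \<or> R \<le> \<bar>y\<bar> \<Longrightarrow> \<phi> (x, y) = 0" using C0_test_support[OF C0(1)] by blast
  obtain Rx where Rx: "Rx > 0" "\<And>x y. Rx \<le> \<bar>x\<bar> \<or> Rx \<le> \<bar>y\<bar> \<Longrightarrow> dx \<phi> (x, y) = 0"
    using C0_test_support[OF C0(2)] by blast
  obtain Ry where Ry: "Ry > 0" "\<And>x y. Ry \<le> \<bar>x\<bar> \<or> Ry \<le> \<bar>y\<bar> \<Longrightarrow> dy \<phi> (x, y) = 0"
    using C0_test_support[OF C0(3)] by blast
  have cont: "continuous_on UNIV ?f" "continuous_on UNIV ?fx" "continuous_on UNIV ?fy"
    by (auto intro!: C0_test_continuous_compose C0 continuous_intros)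
  have int: "integrable lborel ?f" "integrable lborel ?fx" "integrable lborel ?fy"
    by (intro integrable_ray C0 continuous_intros)+
  have "(\<integral>x. indicator {0<..} x * (?f x + ?fx x + b * ?fy x) \<partial>lborel) = - (0 * \<phi> (0, b * 0))"
  proof (rule integral_FTC_Ioi[of "\<lambda>x. x * \<phi> (x, b * x)" _ "max R (max Rx Ry)"])
    show "((\<lambda>x. x * \<phi> (x, b * x)) has_real_derivative ?f x + ?fx x + b * ?fy x) (at x)" for x
      using DERIV_mult[OF DERIV_ident C1_on_line_derivative_at[OF C1, of "(0, 0)" "(1, b)" x]]
      by (simp add: algebra_simps)
    show "continuous_on UNIV (\<lambda>x. ?f x + ?fx x + b * ?fy x)"
      by (intro continuous_on_add continuous_on_mult_left cont)
  qed (auto simp: R Rx Ry order_trans[OF _ abs_ge_self])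
  then have "(\<integral>x. indicator {0..} x * (?f x + ?fx x + b * ?fy x) \<partial>lborel) = 0"
    using int by (subst (asm) integral_Ioi_eq_Ici) (auto intro!: borel_measurable_add borel_measurable_times cont[THEN borel_measurable_continuous_onI, simplified])
  also have "(\<lambda>x. indicator {0..} x * (?f x + ?fx x + b * ?fy x)) =
      (\<lambda>x. indicator {0..} x * ?f x + indicator {0..} x * ?fx x + b * (indicator {0..} x * ?fy x))"
    by (auto simp: algebra_simps)
  also have "(\<integral>x. indicator {0..} x * ?f x + indicator {0..} x * ?fx x + b * (indicator {0..} x * ?fy x) \<partial>lborel) =
      ray_integral b (\<lambda>_. 1) \<phi> + ray_integral b (\<lambda>x. x) (dx \<phi>) + b * ray_integral b (\<lambda>x. x) (dy \<phi>)"
    unfolding ray_integral_def using int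
    by (subst Bochner_Integration.integral_add Bochner_Integration.integral_mult_right_zero,
        (intro Bochner_Integration.integrable_add integrable_mult_right integrable_indicator_mult; simp)+)+ simp
  finally show ?thesis by simp
qed

section \<open>Dependence of a wedge integral on its slope\<close>

lemma integral_lborel_eq_Icc:
  fixes f :: "real \<Rightarrow> real"
  assumes "integrable lborel f" "\<And>x. x \<notin> {a..b} \<Longrightarrow> f x = 0"
  shows "f integrable_on {a..b}" "(\<integral>x. f x \<partial>lborel) = integral {a..b} f"
proof -
  have e: "(\<lambda>x. if x \<in> {a..b} then f x else 0) = f" using assms(2) by auto
  show "f integrable_on {a..b}"
    using Henstock_Kurzweil_Integration.integrable_restrict_UNIV[of "{a..b}" f]
      integrable_on_lborel[OF assms(1)] by (simp only: e)
  show "(\<integral>x. f x \<partial>lborel) = integral {a..b} f"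
    using Henstock_Kurzweil_Integration.integral_restrict_UNIV[of "{a..b}" f]
      integral_lborel[OF assms(1)] by (simp only: e)
qed

text \<open>The slope enters only through the lower end \<open>s * x\<close> of the inner integral,
  so differentiation evaluates \<open>g\<close> on the ray and works for continuous
  \<open>g\<close>. The cutoffs below bring the integral into the form of the Leibniz rule, an
  integral over a fixed compact interval.\<close>

lemma wedge_integral_has_derivative:
  assumes g: "g \<in> C0_test" and b: "b > 0"
  shows "((\<lambda>s. wedge_integral s g) has_real_derivative - ray_integral b (\<lambda>x. x) g) (at b)"
proof -
  obtain R where R: "R > 0" "\<And>x y. R \<le> \<bar>x\<bar> \<or> R \<le> \<bar>y\<bar> \<Longrightarrow> g (x, y) = 0"
    using C0_test_support[OF g] by blast
  \<comment> \<open>For \<open>s < 2 * b\<close> and \<open>x \<le> R\<close> the lower end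
    \<open>s * x\<close> is at most \<open>2 * b * R\<close>, so it lies in \<open>{0..B}\<close>;
    and \<open>B \<ge> R\<close> means that \<open>g\<close> vanishes above
    \<open>B\<close>.\<close>
  define B where "B = 2 * b * R + R"
  define U where "U = {0<..<2 * b}"
  define f where "f s x = integral {s * x..B} (\<lambda>y. g (x, y))" for s x
  define fx where "fx s x = - g (x, s * x) * x" for s x
  have U: "open U" "convex U" "b \<in> U" using b by (auto simp: U_def)
  have cont: "continuous_on S (\<lambda>y. g (x, y))" for S x
    by (intro C0_test_continuous_compose g continuous_intros)
  have range: "s * x \<in> {0..B}" if "s \<in> U" "x \<in> {0..R}" for s x
  proof -
    have "s * x \<le> (2 * b) * R" using that b by (intro mult_mono) (auto simp: U_def)
    then show ?thesis using that R by (auto simp: U_def B_def)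
  qed
  have eq: "wedge_integral s g = integral {0..R} (f s) \<and> f s integrable_on {0..R}" if s: "s \<in> U" for s
  proof -
    let ?G = "\<lambda>x. indicator {0<..} x * (\<integral>y. indicator {s * x<..} y * g (x, y) \<partial>lborel)"
    have "?G x = 0" if "x \<notin> {0..R}" for x
      using that by (auto simp: indicator_def R order_trans[OF _ abs_ge_self])
    then have G: "?G integrable_on {0..R}" "wedge_integral s g = integral {0..R} ?G"
      using integral_lborel_eq_Icc[of ?G 0 R] wedge_integral_iterated[OF g, of s] by simp_all
    \<comment> \<open>The point \<open>x = 0\<close> is excluded: the open half-line in
      \<open>?G\<close> gives 0 there, whereas \<open>f s 0\<close> may be nonzero. One point is
      negligible.\<close>
    have e: "f s x = ?G x" if "x \<in> {0..R} - {0}" for x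
    proof -
      have m: "(\<lambda>y. g (x, y)) \<in> borel_measurable borel"
        by (intro borel_measurable_continuous_onI cont)
      have B: "R \<le> B" using b R by (simp add: B_def)
      have "(\<integral>y. indicator {s * x<..} y * g (x, y) \<partial>lborel) = (\<integral>y. indicator {s * x..} y * g (x, y) \<partial>lborel)"
        by (rule integral_Ioi_eq_Ici[OF m])
      also have "(\<lambda>y. indicator {s * x..} y * g (x, y)) = (\<lambda>y. indicator {s * x..B} y * g (x, y))"
        using B R by (fastforce simp: indicator_def fun_eq_iff)
      also have "(\<integral>y. indicator {s * x..B} y * g (x, y) \<partial>lborel) = integral {s * x..B} (\<lambda>y. g (x, y))"
        using set_borel_integral_eq_integral(2)[of "{s * x..B}" "\<lambda>y. g (x, y)"]
          borel_integrable_compact[of "{s * x..B}" "\<lambda>y. g (x, y)"] cont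
        by (simp add: set_integrable_def set_lebesgue_integral_def)
      finally show ?thesis using that by (simp add: f_def)
    qed
    have n: "negligible {0::real}" by simp
    show ?thesis
      using integrable_spike[OF G(1) n e] integral_spike[OF n, of "{0..R}" "f s" ?G] e G(2) by simp
  qed
  have "((\<lambda>s. integral (cbox 0 R) (f s)) has_field_derivative integral (cbox 0 R) (fx b)) (at b within U)"
  proof (rule leibniz_rule_field_derivative)
    fix s x assume s: "s \<in> U" and x: "x \<in> cbox 0 R"
    have "((\<lambda>t. integral {t..B} (\<lambda>y. g (x, y))) has_real_derivative - g (x, s * x)) (at (s * x) within {0..B})"
      using range[OF s] x by (intro integral_has_real_derivative' cont) auto
    then have "((\<lambda>t. integral {t..B} (\<lambda>y. g (x, y))) has_real_derivative - g (x, s * x))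
        (at (s * x) within (\<lambda>s. s * x) ` U)"
      by (rule DERIV_subset) (use range x in auto)
    moreover have "((\<lambda>s. s * x) has_real_derivative x) (at s within U)"
      by (auto intro!: derivative_eq_intros)
    ultimately show "((\<lambda>s. f s x) has_field_derivative fx s x) (at s within U)"
      using DERIV_image_chain[of "\<lambda>t. integral {t..B} (\<lambda>y. g (x, y))" "- g (x, s * x)" "\<lambda>s. s * x" s U x]
      by (auto simp: o_def f_def fx_def)
  next
    show "f s integrable_on cbox 0 R" if "s \<in> U" for s using eq[OF that] by simp
    show "continuous_on (U \<times> cbox 0 R) (\<lambda>(s, x). fx s x)"
      unfolding fx_def case_prod_beta
      by (intro C0_test_continuous_compose g continuous_intros)
  qed (use U in auto)
  then have "((\<lambda>s. integral {0..R} (f s)) has_real_derivative integral {0..R} (fx b)) (at b)"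
    unfolding at_within_open[OF U(3,1)] by simp
  then have "((\<lambda>s. wedge_integral s g) has_real_derivative integral {0..R} (fx b)) (at b)"
    by (rule has_field_derivative_transform_within_open[OF _ U(1,3)]) (rule eq[THEN conjunct1, symmetric])
  moreover have "integral {0..R} (fx b) = - ray_integral b (\<lambda>x. x) g"
  proof -
    let ?h = "\<lambda>x. indicator {0..} x * (x * g (x, b * x))"
    have "integrable lborel ?h"
      by (rule integrable_indicator_mult[OF integrable_ray[OF g]]) (simp_all add: continuous_on_id)
    moreover have "?h x = 0" if "x \<notin> {0..R}" for x
      using that by (auto simp: indicator_def R order_trans[OF _ abs_ge_self])
    ultimately have "ray_integral b (\<lambda>x. x) g = integral {0..R} ?h"
      unfolding ray_integral_def by (rule integral_lborel_eq_Icc)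
    also have "\<dots> = integral {0..R} (\<lambda>x. - fx b x)"
      by (rule Henstock_Kurzweil_Integration.integral_cong) (simp add: fx_def mult.commute)
    also have "\<dots> = - integral {0..R} (fx b)"
      by (rule Henstock_Kurzweil_Integration.integral_neg)
    finally show ?thesis by simp
  qed
  ultimately show ?thesis by simp
qed

section \<open>Piecewise constant measure solutions\<close>

lemma inflow_cmult: "inflow c \<phi> = c * inflow 1 \<phi>"
  unfolding inflow_def set_lebesgue_integral_def
  by (simp add: mult.left_commute flip: integral_mult_right_zero)

lemma wall_pairing_eq: "wall_pairing a (\<lambda>x. c * w x) \<phi> = c * sqrt (1 + a\<^sup>2) * ray_integral a w \<phi>"
  unfolding wall_pairing_def set_lebesgue_integral_def ray_integral_def
  by (simp add: ac_simps flip: integral_mult_right_zero)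

lemma le_3_cases:
  fixes k :: nat
  assumes "k \<le> 3" "P 0" "P 1" "P 2" "P 3"
  shows "P k"
proof -
  have "k = 0 \<or> k = 1 \<or> k = 2 \<or> k = 3" using assms(1) by auto
  then show ?thesis using assms by auto
qed

text \<open>One criterion for the layer and for the shock solution. All measures are densities with
  respect to \<open>M\<close>, including the pressure, so \<open>q\<close> is pressure per unit of
  \<open>M\<close>; inside the wedge, where \<open>M\<close> has Lebesgue density \<open>f\<close>,
  the pressure is \<open>q z * f z\<close>. What remains to be checked are three integral identities
  and pointwise facts on \<open>Omega a\<close>.\<close>

lemma measure_solution_withI:
  fixes S0 S1 :: "real \<times> real \<times> real \<times> real \<times> real"
  assumes M: "radon M" "emeasure M (- closure (Omega a)) = 0"
    and f: "f \<in> borel_measurable borel" "\<And>z. 0 \<le> f z"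
    and Mf: "density M (indicator (Omega a)) = density lborel (\<lambda>z. ennreal (indicator (Omega a) z * f z))"
    and u: "u \<in> borel_measurable borel" "\<And>z. 0 \<le> u z" "\<And>z. u z \<le> C"
    and v: "v \<in> borel_measurable borel" "\<And>z. 0 \<le> v z" "\<And>z. v z \<le> C"
    and q: "q \<in> borel_measurable borel" "\<And>z. 0 \<le> q z" "\<And>z. q z \<le> C"
    and E0: "0 \<le> E0"
    and m: "\<And>k. k \<le> 3 \<Longrightarrow>
      m k = pos (density M (\<lambda>z. ennreal ([u z, (u z)\<^sup>2, u z * v z, u z * E0] ! k)))"
    and n: "\<And>k. k \<le> 3 \<Longrightarrow>
      n k = pos (density M (\<lambda>z. ennreal ([v z, u z * v z, (v z)\<^sup>2, v z * E0] ! k)))"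
    and P: "P = pos (density M (\<lambda>z. ennreal (q z)))"
    and c: "c1 + a * c2 = 0"
    and mass: "\<And>\<phi>. \<phi> \<in> C1_test \<Longrightarrow> (\<integral>z. u z * dx \<phi> z \<partial>M) + (\<integral>z. v z * dy \<phi> z \<partial>M) + inflow 1 \<phi> = 0"
    and momx: "\<And>\<phi>. \<phi> \<in> C1_test \<Longrightarrow>
      (\<integral>z. (u z)\<^sup>2 * dx \<phi> z \<partial>M) + (\<integral>z. u z * v z * dy \<phi> z \<partial>M) + (\<integral>z. q z * dx \<phi> z \<partial>M)
      + c1 * sqrt (1 + a\<^sup>2) * ray_integral a (\<lambda>_. 1) \<phi> + (1 + p0 E0 \<epsilon>) * inflow 1 \<phi> = 0"
    and momy: "\<And>\<phi>. \<phi> \<in> C1_test \<Longrightarrow>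
      (\<integral>z. u z * v z * dx \<phi> z \<partial>M) + (\<integral>z. (v z)\<^sup>2 * dy \<phi> z \<partial>M) + (\<integral>z. q z * dy \<phi> z \<partial>M)
      + c2 * sqrt (1 + a\<^sup>2) * ray_integral a (\<lambda>_. 1) \<phi> = 0"
    and eos: "\<And>z. z \<in> Omega a \<Longrightarrow>
      q z * f z = \<epsilon> / (\<epsilon> + 1) * f z * (E0 - 1/2 * ((u z)\<^sup>2 + (v z)\<^sup>2))"
    and F: "\<And>z. z \<in> Omega a \<Longrightarrow>
      (f z, u z, v z, E0, q z * f z) = (if snd z > \<sigma> * fst z then S0 else S1)"
    and S: "S0 = (1, 1, 0, E0, q0)" "S1 = (r1, u1, v1, e1, q1)" "S0 = S1 \<or> q0 < q1" "0 < \<sigma>"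
  shows "measure_solution_with a E0 \<epsilon> M u v (\<lambda>_. E0) m n P (\<lambda>_. c1) (\<lambda>_. c2)"
proof -
  have sM [measurable_cong]: "sets M = sets borel" using M by (simp add: radon_def)
  note [measurable] = u(1) v(1) q(1) f(1)
  define um where "um k z = [u z, (u z)\<^sup>2, u z * v z, u z * E0] ! k" for k z
  define vm where "vm k z = [v z, u z * v z, (v z)\<^sup>2, v z * E0] ! k" for k z
  have um: "um k \<in> borel_measurable borel \<and> (\<forall>z. 0 \<le> um k z \<and> um k z \<le> max C (max (C * C) (C * E0)))"
    if "k \<le> 3" for k
    using that
    by (rule le_3_cases) (auto simp: um_def[abs_def] power2_eq_square numeral_2_eq_2 numeral_3_eq_3 u v E0
        le_max_iff_disj order_trans[OF u(2,3)] intro!: mult_mono)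
  have vm: "vm k \<in> borel_measurable borel \<and> (\<forall>z. 0 \<le> vm k z \<and> vm k z \<le> max C (max (C * C) (C * E0)))"
    if "k \<le> 3" for k
    using that
    by (rule le_3_cases) (auto simp: vm_def[abs_def] power2_eq_square numeral_2_eq_2 numeral_3_eq_3 u v E0
        le_max_iff_disj order_trans[OF u(2,3)] intro!: mult_mono)
  note m = m[folded um_def] and n = n[folded vm_def]
  have dens: "signed_radon (pos (density M (\<lambda>z. ennreal (h z)))) \<and>
      supported_on (closure (Omega a)) (pos (density M (\<lambda>z. ennreal (h z))))"
    if "h \<in> borel_measurable borel" "\<And>z. h z \<le> D" for h D
    using that M sM
    by (auto intro!: signed_radon_pos radon_density simp: supported_on_pos emeasure_density_null)
  have m': "signed_radon (m k) \<and> supported_on (closure (Omega a)) (m k)" if "k \<le> 3" for k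
    using dens[of "um k"] um[OF that] by (auto simp: m[OF that])
  have n': "signed_radon (n k) \<and> supported_on (closure (Omega a)) (n k)" if "k \<le> 3" for k
    using dens[of "vm k"] vm[OF that] by (auto simp: n[OF that])
  have P': "signed_radon P \<and> supported_on (closure (Omega a)) P"
    using dens[of q] q by (auto simp: P)
  have m_simps: "m 0 = pos (density M (\<lambda>z. ennreal (u z)))" "m 1 = pos (density M (\<lambda>z. ennreal (u z * u z)))"
    "m 2 = pos (density M (\<lambda>z. ennreal (u z * v z)))" "m 3 = pos (density M (\<lambda>z. ennreal (u z * E0)))"
    by (simp_all add: m um_def power2_eq_square)
  have n_simps: "n 0 = pos (density M (\<lambda>z. ennreal (v z)))" "n 1 = pos (density M (\<lambda>z. ennreal (v z * u z)))"
    "n 2 = pos (density M (\<lambda>z. ennreal (v z * v z)))" "n 3 = pos (density M (\<lambda>z. ennreal (v z * E0)))"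
    by (simp_all add: n vm_def power2_eq_square mult.commute)
  have smul: "m 0 = smul u (pos M)" "n 0 = smul v (pos M)"
    "m 1 = smul u (m 0)" "n 1 = smul u (n 0)" "m 2 = smul v (m 0)" "n 2 = smul v (n 0)"
    "m 3 = smul (\<lambda>_. E0) (m 0)" "n 3 = smul (\<lambda>_. E0) (n 0)"
    unfolding m_simps n_simps
    by (simp_all only: smul_pos[OF sM u(2)] smul_pos[OF sM v(2)] smul_pos_density[OF sM]
        u v E0 borel_measurable_const)
  have ac: "smul h (pos (density M g)) \<lless> pos (density M g)"
    if "h \<in> borel_measurable borel" "\<And>z. 0 \<le> h z" for h g
    using that sM by (simp add: smul_pos abs_cont_density)
  have acm: "smul h (m 0) \<lless> m 0" "smul h (n 0) \<lless> n 0"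
    if "h \<in> borel_measurable borel" "\<And>z. 0 \<le> h z" for h
    unfolding m_simps n_simps using that by (auto intro: ac)
  have "m 1 \<lless> m 0" "n 1 \<lless> n 0" "m 2 \<lless> m 0" "n 2 \<lless> n 0" "m 3 \<lless> m 0" "n 3 \<lless> n 0"
    by (simp_all only: smul(3-8) acm u v E0 borel_measurable_const)
  then have ac1: "m k \<lless> m 0 \<and> n k \<lless> n 0" if "k \<in> {1, 2, 3}" for k
    using that by blast
  have ac0: "P \<lless> pos M" "m 0 \<lless> pos M" "n 0 \<lless> pos M"
    using sM by (auto simp: P m_simps n_simps intro!: abs_cont_density)
  have weak: "pairing (m 0) (dx \<phi>) + pairing (n 0) (dy \<phi>) + inflow (1 * 1) \<phi> = 0 \<and>
        pairing (m 1) (dx \<phi>) + pairing (n 1) (dy \<phi>) + pairing P (dx \<phi>) + wall_pairing a (\<lambda>_. c1) \<phi>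
          + inflow (1 * 1\<^sup>2 + p0 E0 \<epsilon>) \<phi> = 0 \<and>
        pairing (m 2) (dx \<phi>) + pairing (n 2) (dy \<phi>) + pairing P (dy \<phi>) + wall_pairing a (\<lambda>_. c2) \<phi>
          + inflow (1 * 1 * 0) \<phi> = 0 \<and>
        pairing (m 3) (dx \<phi>) + pairing (n 3) (dy \<phi>) + inflow (1 * 1 * E0) \<phi> = 0"
    if \<phi>: "\<phi> \<in> C1_test" for \<phi>
  proof -
    note [measurable] = C1_test_C0_test(2,3)[OF \<phi>, THEN C0_test_measurable]
    have pm: "pairing (m k) (dx \<phi>) = (\<integral>z. um k z * dx \<phi> z \<partial>M)" if "k \<le> 3" for k
      using um[OF that] by (subst m[OF that], intro pairing_density sM) auto
    have pn: "pairing (n k) (dy \<phi>) = (\<integral>z. vm k z * dy \<phi> z \<partial>M)" if "k \<le> 3" for k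
      using vm[OF that] by (subst n[OF that], intro pairing_density sM) auto
    have pP: "pairing P g = (\<integral>z. q z * g z \<partial>M)" if [measurable]: "g \<in> borel_measurable borel" for g
      unfolding P by (intro pairing_density sM q) auto
    have w: "wall_pairing a (\<lambda>_. d) \<phi> = d * sqrt (1 + a\<^sup>2) * ray_integral a (\<lambda>_. 1) \<phi>" for d
      using wall_pairing_eq[of a d "\<lambda>_. 1" \<phi>] by simp
    have E: "(\<integral>z. h z * E0 * g z \<partial>M) = E0 * (\<integral>z. h z * g z \<partial>M)" for g h :: "plane \<Rightarrow> real"
      by (simp add: ac_simps flip: integral_mult_right_zero)
    \<comment> \<open>The total energy is constant, so the energy balance is \<open>E0\<close> times
      the mass balance.\<close>
    have "E0 * ((\<integral>z. u z * dx \<phi> z \<partial>M) + (\<integral>z. v z * dy \<phi> z \<partial>M) + inflow 1 \<phi>) = 0"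
      using mass[OF \<phi>] by simp
    then show ?thesis
      using mass[OF \<phi>] momx[OF \<phi>] momy[OF \<phi>]
      by (simp add: pm pn pP w um_def vm_def E inflow_cmult[of "_ + _"] inflow_cmult[of E0]
          inflow_cmult[of 0] algebra_simps)
  qed
  have li: "locally_integrable (\<lambda>_. d)" for d
    by (auto simp: locally_integrable_def set_integrable_def)
  have last: "(AE z in lborel. z \<in> U \<longrightarrow> p z = \<epsilon> / (\<epsilon> + 1) * r z * (E0 - 1/2 * ((u z)\<^sup>2 + (v z)\<^sup>2))) \<and>
      (\<forall>z\<in>U. entropy_at U r u v (\<lambda>_. E0) p z)"
    if U: "open U" "U \<subseteq> Omega a" "has_leb_density_on (pos M) r U" "has_leb_density_on P p U" for U r p
  proof -
    \<comment> \<open>Writing \<open>M\<close> as its own density 1 brings it under the same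
      uniqueness lemma as the pressure.\<close>
    have "M = density M (\<lambda>z. ennreal 1)" by (simp add: density_1)
    then have r: "AE z in lborel. z \<in> U \<longrightarrow> r z = 1 * f z"
      using U sM f Mf by (intro has_leb_density_on_AE[where M = M and a = a]) auto
    have p: "AE z in lborel. z \<in> U \<longrightarrow> p z = q z * f z"
      using U sM f Mf q unfolding P by (intro has_leb_density_on_AE[where M = M and a = a])
    have "AE z in lborel. z \<in> U \<longrightarrow>
        (r z, u z, v z, E0, p z) = (if snd z > \<sigma> * fst z then S0 else S1)"
      using r p
    proof eventually_elim
      case (elim z)
      show ?case
      proof
        assume "z \<in> U"
        then have "r z = f z" "p z = q z * f z" "z \<in> Omega a" using elim U by auto
        then show "(r z, u z, v z, E0, p z) = (if snd z > \<sigma> * fst z then S0 else S1)"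
          using F[of z] by simp
      qed
    qed
    then have "\<forall>z\<in>U. entropy_at U r u v (\<lambda>_. E0) p z"
      using entropy_at_two_states[of U r u v "\<lambda>_. E0" p \<sigma> S0 S1] S by blast
    moreover have "AE z in lborel. z \<in> U \<longrightarrow>
        p z = \<epsilon> / (\<epsilon> + 1) * r z * (E0 - 1/2 * ((u z)\<^sup>2 + (v z)\<^sup>2))"
      using r p by eventually_elim (use eos U in auto)
    ultimately show ?thesis by blast
  qed
  show ?thesis
    unfolding measure_solution_with_def
    using m' n' P' M c weak ac0 ac1 u(1) v(1) sM smul last
    by (intro conjI allI impI ballI) (auto simp: li supported_on_pos)
qed

section \<open>Measures with a layer on the wedge\<close>

lemma Wall_closed: "closed (Wall a)"
proof -
  have "Wall a = {z. 0 \<le> fst z} \<inter> {z. snd z = a * fst z}" by (auto simp: Wall_def)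
  then show ?thesis by (auto intro!: closed_Int closed_Collect_le closed_Collect_eq continuous_intros)
qed

lemma Wall_borel [measurable]: "Wall a \<in> sets borel"
  by (simp add: Wall_closed)

lemma Omega_Wall_disjoint: "z \<in> Omega a \<Longrightarrow> z \<notin> Wall a"
  by (auto simp: Omega_def Wall_def)

lemma Wall_subset_closure_Omega: "Wall a \<subseteq> closure (Omega a)"
proof
  fix z assume "z \<in> Wall a"
  then obtain x where x: "x \<ge> 0" "z = (x, a * x)" by (auto simp: Wall_def)
  \<comment> \<open>The slope \<open>\<bar>a\<bar> + 1\<close> of this approach exceeds
    \<open>a\<close> for either sign of \<open>a\<close>, so the path runs strictly inside the wedge
    for \<open>t > 0\<close>.\<close>
  let ?w = "\<lambda>t. (x + t, a * x + (\<bar>a\<bar> + 1) * t)"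
  show "z \<in> closure (Omega a)"
  proof (rule Lim_in_closed_set)
    show "(?w \<longlongrightarrow> z) (at_right 0)"
      unfolding x(2) by (auto intro!: tendsto_eq_intros)
    have "?w t \<in> closure (Omega a)" if "t > 0" for t
    proof -
      have "a * t \<le> \<bar>a\<bar> * t" using that by (intro mult_right_mono) auto
      then have "a * (x + t) < a * x + (\<bar>a\<bar> + 1) * t"
        using that unfolding distrib_left distrib_right by linarith
      then have "?w t \<in> Omega a" using that x by (simp add: Omega_def)
      then show ?thesis using closure_subset by blast
    qed
    then show "\<forall>\<^sub>F t in at_right 0. ?w t \<in> closure (Omega a)"
      by (auto simp: eventually_at_right_field intro: exI[of _ 1])
  qed auto
qed

section \<open>Wall measures and layers\<close>

lemma ray_measurable [measurable]: "(\<lambda>x. (x, a * x)) \<in> borel_measurable (borel :: real measure)"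
  by (intro borel_measurable_continuous_onI continuous_intros)

lemma sets_wall_measure [simp]: "sets (wall_measure a w) = sets borel"
  by (simp add: wall_measure_def)

lemma sets_layer [simp, measurable_cong]: "sets (layer a b c) = sets borel"
  by (simp add: layer_def)

lemma emeasure_wall_measure:
  assumes [measurable]: "A \<in> sets borel" "w \<in> borel_measurable borel"
  shows "emeasure (wall_measure a w) A =
    (\<integral>\<^sup>+x. ennreal (indicator {0..} x * (w x * sqrt (1 + a\<^sup>2))) * indicator A (x, a * x) \<partial>lborel)"
proof -
  have "(\<lambda>x. (x, a * x)) -` A \<in> sets borel"
    using measurable_sets[OF ray_measurable, of A a] by simp
  then show ?thesis
    unfolding wall_measure_def
    by (subst emeasure_distr) (auto simp: emeasure_density indicator_def intro!: nn_integral_cong)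
qed

lemma radon_wall_measure:
  assumes "0 \<le> c"
  shows "radon (wall_measure a (\<lambda>x. c * x))"
  unfolding radon_def
proof (intro conjI allI impI)
  fix K :: "plane set" assume K: "compact K"
  then obtain R where R: "\<And>z. z \<in> K \<Longrightarrow> norm z \<le> R"
    using compact_imp_bounded bounded_iff by metis
  have [measurable]: "K \<in> sets borel" using K by (rule borel_compact)
  have "emeasure (wall_measure a (\<lambda>x. c * x)) K \<le>
      (\<integral>\<^sup>+x. ennreal (c * R * sqrt (1 + a\<^sup>2)) * indicator {0..R} x \<partial>lborel)"
  proof (subst emeasure_wall_measure, simp, simp, rule nn_integral_mono)
    fix x
    have "ennreal (c * x * sqrt (1 + a\<^sup>2)) \<le> ennreal (c * R * sqrt (1 + a\<^sup>2))" "x \<le> R"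
      if "0 \<le> x" "(x, a * x) \<in> K"
    proof -
      have "\<bar>x\<bar> \<le> R" using R[OF that(2)] norm_fst_le[of x "a * x"] by simp
      then show "ennreal (c * x * sqrt (1 + a\<^sup>2)) \<le> ennreal (c * R * sqrt (1 + a\<^sup>2))" "x \<le> R"
        using assms that by (auto intro!: ennreal_leI mult_right_mono mult_left_mono)
    qed
    then show "ennreal (indicator {0..} x * (c * x * sqrt (1 + a\<^sup>2))) * indicator K (x, a * x) \<le>
        ennreal (c * R * sqrt (1 + a\<^sup>2)) * indicator {0..R} x"
      by (auto simp: indicator_def)
  qed
  also have "\<dots> < \<infinity>"
    by (simp add: nn_integral_cmult_indicator ennreal_mult_less_top emeasure_lborel_Icc_eq)
  finally show "emeasure (wall_measure a (\<lambda>x. c * x)) K < \<infinity>" .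
qed simp

lemma radon_layer:
  assumes "0 \<le> b" "0 \<le> c"
  shows "radon (layer a b c)"
proof -
  have "radon (density lborel (\<lambda>z. ennreal (b * indicator (Omega a) z)))"
    by (rule radon_density[OF radon_lborel, of _ b]) (use assms in \<open>auto simp: indicator_def\<close>)
  then show ?thesis
    using radon_wall_measure[OF assms(2), of a]
    by (auto simp: radon_def layer_def emeasure_add_measure borel_compact)
qed

lemma emeasure_layer_Compl_closure: "emeasure (layer a b c) (- closure (Omega a)) = 0"
proof -
  have "(\<lambda>z. ennreal (b * indicator (Omega a) z) * indicator (- closure (Omega a)) z) = (\<lambda>_. 0)"
    using closure_subset[of "Omega a"] by (auto simp: indicator_def fun_eq_iff)
  then have 1: "emeasure (density lborel (\<lambda>z. ennreal (b * indicator (Omega a) z))) (- closure (Omega a)) = 0"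
    by (subst emeasure_density) simp_all
  have "(\<lambda>x. ennreal (indicator {0..} x * (c * x * sqrt (1 + a\<^sup>2))) *
      indicator (- closure (Omega a)) (x, a * x)) = (\<lambda>_. 0)"
    using Wall_subset_closure_Omega[of a] by (auto simp: indicator_def Wall_def fun_eq_iff subset_iff)
  then have "emeasure (wall_measure a (\<lambda>x. c * x)) (- closure (Omega a)) = 0"
    by (simp add: emeasure_wall_measure)
  with 1 show ?thesis by (simp add: layer_def emeasure_add_measure)
qed

text \<open>A layer charges only the open wedge and the wall, so the values of \<open>h\<close> on
  these two sets determine the result.\<close>

lemma density_layer:
  assumes [measurable]: "h \<in> borel_measurable borel"
    and h: "\<And>z. z \<in> Omega a \<Longrightarrow> h z = \<beta>" "\<And>z. z \<in> Wall a \<Longrightarrow> h z = d"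
    and nn: "0 \<le> b" "0 \<le> \<beta>" "0 \<le> c" "0 \<le> d"
  shows "density (layer a b c) (\<lambda>z. ennreal (h z)) = layer a (b * \<beta>) (c * d)"
proof -
  have 1: "density (density lborel (\<lambda>z. ennreal (b * indicator (Omega a) z))) (\<lambda>z. ennreal (h z)) =
      density lborel (\<lambda>z. ennreal (b * \<beta> * indicator (Omega a) z))"
    by (subst density_density_eq)
      (use h nn in \<open>auto intro!: density_cong AE_I2 simp: indicator_def ennreal_mult[symmetric]\<close>)
  have "density (wall_measure a (\<lambda>x. c * x)) (\<lambda>z. ennreal (h z)) =
      distr (density (density lborel (\<lambda>x. ennreal (indicator {0..} x * (c * x * sqrt (1 + a\<^sup>2)))))
        (\<lambda>x. ennreal (h (x, a * x)))) borel (\<lambda>x. (x, a * x))"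
    unfolding wall_measure_def by (rule density_distr) auto
  also have "density (density lborel (\<lambda>x. ennreal (indicator {0..} x * (c * x * sqrt (1 + a\<^sup>2)))))
        (\<lambda>x. ennreal (h (x, a * x))) =
      density lborel (\<lambda>x. ennreal (indicator {0..} x * (c * d * x * sqrt (1 + a\<^sup>2))))"
    by (subst density_density_eq)
      (use h nn in \<open>auto intro!: density_cong AE_I2 simp: indicator_def ennreal_mult[symmetric] Wall_def ac_simps\<close>)
  finally have 2: "density (wall_measure a (\<lambda>x. c * x)) (\<lambda>z. ennreal (h z)) = wall_measure a (\<lambda>x. c * d * x)"
    by (simp add: wall_measure_def)
  show ?thesis
    unfolding layer_def by (subst density_add_measure) (simp_all add: 1 2)
qed

lemma layer_0_right:
  "layer a b 0 = density lborel (\<lambda>z. ennreal (b * indicator (Omega a) z))"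
  unfolding layer_def
  by (intro add_measure_0_right) (simp_all add: emeasure_wall_measure)

lemma layer_0_0: "layer a 0 0 = null_measure borel"
  by (simp add: layer_0_right density_0_eq_null_measure)

lemma integral_layer:
  assumes g: "g \<in> C0_test" and nn: "0 \<le> b" "0 \<le> c"
  shows "(\<integral>z. g z \<partial>layer a b c) =
    b * wedge_integral a g + c * sqrt (1 + a\<^sup>2) * ray_integral a (\<lambda>x. x) g"
proof -
  note [measurable] = C0_test_measurable[OF g]
  let ?w = "\<lambda>x. indicator {0..} x * (c * x * sqrt (1 + a\<^sup>2))"
  have w: "?w x \<ge> 0" for x using nn by (simp add: indicator_def)
  have 1: "integrable (density lborel (\<lambda>z. ennreal (b * indicator (Omega a) z))) g"
    using integrable_mult_right[OF integrable_indicator_mult[OF C0_test_integrable[OF g] Omega_borel[of a]], of b] nn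
    by (subst integrable_density) (auto simp: ac_simps)
  have "integrable lborel (\<lambda>x. indicator {0..} x * (x * g (x, a * x)))"
    by (rule integrable_indicator_mult[OF integrable_ray[OF g]]) (simp_all add: continuous_on_id)
  from integrable_mult_right[OF this, of "c * sqrt (1 + a\<^sup>2)"]
  have "integrable lborel (\<lambda>x. ?w x *\<^sub>R g (x, a * x))"
    by (simp add: ac_simps)
  then have 2: "integrable (wall_measure a (\<lambda>x. c * x)) g"
    unfolding wall_measure_def
    by (subst integrable_distr_eq, simp, simp, subst integrable_density) (use w in auto)
  have "(\<integral>z. g z \<partial>density lborel (\<lambda>z. ennreal (b * indicator (Omega a) z))) = b * wedge_integral a g"
    using nn unfolding wedge_integral_def
    by (subst integral_density) (auto simp: mult.assoc)
  moreover have "(\<integral>z. g z \<partial>wall_measure a (\<lambda>x. c * x)) = c * sqrt (1 + a\<^sup>2) * ray_integral a (\<lambda>x. x) g"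
    using pairing_wall_measure[of "\<lambda>x. c * x" g a] nn wall_pairing_eq[of a c "\<lambda>x. x" g]
    by (simp add: pairing_pos)
  ultimately show ?thesis
    unfolding layer_def using 1 2 by (simp add: integral_add_measure)
qed

lemma integral_density_layer:
  assumes g: "g \<in> C0_test" and h[measurable]: "h \<in> borel_measurable borel" "\<And>z. 0 \<le> h z"
    and hv: "\<And>z. z \<in> Omega a \<Longrightarrow> h z = \<beta>" "\<And>z. z \<in> Wall a \<Longrightarrow> h z = d"
    and nn: "0 \<le> b" "0 \<le> \<beta>" "0 \<le> c" "0 \<le> d"
  shows "(\<integral>z. h z * g z \<partial>layer a b c) =
    b * \<beta> * wedge_integral a g + c * d * sqrt (1 + a\<^sup>2) * ray_integral a (\<lambda>x. x) g"
proof -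
  note [measurable] = C0_test_measurable[OF g]
  have "(\<integral>z. h z * g z \<partial>layer a b c) = (\<integral>z. g z \<partial>density (layer a b c) (\<lambda>z. ennreal (h z)))"
    using h by (subst integral_density) auto
  also have "\<dots> = (\<integral>z. g z \<partial>layer a (b * \<beta>) (c * d))"
    using assms by (simp add: density_layer)
  finally show ?thesis using g nn by (simp add: integral_layer)
qed

section \<open>The layer solution\<close>

text \<open>For \<^term>\<open>\<epsilon> > 0\<close> the uniform oncoming flow in \<open>\<Omega>\<close> carries the pressure \<open>p\<^sub>0\<close>; adding \<open>p\<^sub>0\<close> to the
  pressure on the wall then yields a measure solution with the same layer as for \<open>\<epsilon> = 0\<close>.\<close>

lemma layer_measure_solution:
  assumes \<theta>: "0 < \<theta>" "\<theta> < pi / 2" and E0: "1 / 2 < E0" and \<epsilon>: "0 \<le> \<epsilon>"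
  shows "measure_solution_with (tan \<theta>) E0 \<epsilon> (lim_varrho \<theta>) (lim_u \<theta>) (lim_v \<theta>) (\<lambda>_. E0)
    (lim_m \<theta> E0) (lim_n \<theta> E0) (pos (layer (tan \<theta>) (p0 E0 \<epsilon>) 0))
    (\<lambda>_. - (sin \<theta> * (p0 E0 \<epsilon> + (sin \<theta>)\<^sup>2))) (\<lambda>_. cos \<theta> * (p0 E0 \<epsilon> + (sin \<theta>)\<^sup>2))"
proof -
  define a where "a = tan \<theta>"
  \<comment> \<open>Mass balance: the layer moves with speed \<open>cos \<theta>\<close>, so its
    flux at \<open>x\<close> is \<open>\<kappa> * cos \<theta> * x\<close>. This has to equal the
    inflow \<open>a * x\<close> that the wall has intercepted up to \<open>x\<close>.\<close>
  define \<kappa> where "\<kappa> = sin \<theta> / (cos \<theta>)\<^sup>2"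
  have sin: "0 < sin \<theta>" and cos: "0 < cos \<theta>"
    using \<theta> by (auto intro: sin_gt_zero cos_gt_zero_pi)
  have sc: "(sin \<theta>)\<^sup>2 = 1 - (cos \<theta>)\<^sup>2" by (simp add: sin_squared_eq)
  have p0: "0 \<le> p0 E0 \<epsilon>" using E0 \<epsilon> by (simp add: p0_def)
  have \<kappa>: "0 \<le> \<kappa>" using sin by (simp add: \<kappa>_def)
  have M: "lim_varrho \<theta> = layer a 1 \<kappa>" by (simp add: lim_varrho_def a_def \<kappa>_def)
  have a: "a = sin \<theta> / cos \<theta>" by (simp add: a_def tan_def)
  have a0: "0 < a" using sin cos by (simp add: a)
  have s: "sqrt (1 + a\<^sup>2) = 1 / cos \<theta>"
  proof (rule real_sqrt_unique)
    show "(1 / cos \<theta>)\<^sup>2 = 1 + a\<^sup>2" using cos by (simp add: a power_divide field_simps)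
  qed (use cos in simp)
  define q where "q z = p0 E0 \<epsilon> * indicator (Omega a) z" for z
  have meas: "lim_u \<theta> \<in> borel_measurable borel" "lim_v \<theta> \<in> borel_measurable borel"
    "q \<in> borel_measurable borel"
    unfolding lim_u_def[abs_def] lim_v_def[abs_def] q_def[abs_def] by measurable
  note [measurable] = meas
  have \<Omega>: "lim_u \<theta> z = 1" "lim_v \<theta> z = 0" "q z = p0 E0 \<epsilon>" if "z \<in> Omega a" for z
    using that Omega_Wall_disjoint[OF that] by (auto simp: lim_u_def lim_v_def q_def a_def indicator_def)
  \<comment> \<open>The velocity on the wall is the projection of \<open>(1, 0)\<close> onto the
    wall direction \<open>(cos \<theta>, sin \<theta>)\<close>.\<close>
  have W: "lim_u \<theta> z = (cos \<theta>)\<^sup>2" "lim_v \<theta> z = sin \<theta> * cos \<theta>" "q z = 0" if "z \<in> Wall a" for z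
    using that Omega_Wall_disjoint[of z a] by (auto simp: lim_u_def lim_v_def q_def a_def indicator_def)
  have u0: "0 \<le> lim_u \<theta> z" and v0: "0 \<le> lim_v \<theta> z" and q0: "0 \<le> q z" for z
    using sin cos p0 by (simp_all add: lim_u_def lim_v_def q_def)
  define C where "C = 2 + p0 E0 \<epsilon>"
  have uC: "lim_u \<theta> z \<le> C" for z
    using Omega_Wall_disjoint[of z "tan \<theta>"] p0 sc zero_le_power2[of "sin \<theta>"]
    by (auto simp: lim_u_def C_def indicator_def)
  have "sin \<theta> * cos \<theta> \<le> 1 * 1" using sin cos by (intro mult_mono) auto
  then have vC: "lim_v \<theta> z \<le> C" for z
    using p0 by (auto simp: lim_v_def C_def indicator_def)
  have qC: "q z \<le> C" for z
    using p0 by (auto simp: q_def C_def indicator_def)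
  have dens: "density (layer a 1 \<kappa>) (\<lambda>z. ennreal (h z)) = layer a \<beta> c"
    if "h \<in> borel_measurable borel" "\<And>z. z \<in> Omega a \<Longrightarrow> h z = \<beta>" "\<And>z. z \<in> Wall a \<Longrightarrow> h z = d" "0 \<le> \<beta>" "0 \<le> d" "\<kappa> * d = c"
    for h \<beta> c d
    using density_layer[where a = a and b = 1 and c = \<kappa>, OF that(1-3)] that \<kappa> by simp
  have int: "(\<integral>z. h z * g z \<partial>layer a 1 \<kappa>) =
      \<beta> * wedge_integral a g + \<kappa> * d / cos \<theta> * ray_integral a (\<lambda>x. x) g"
    if "g \<in> C0_test" "h \<in> borel_measurable borel" "\<And>z. 0 \<le> h z"
      "\<And>z. z \<in> Omega a \<Longrightarrow> h z = \<beta>" "\<And>z. z \<in> Wall a \<Longrightarrow> h z = d" "0 \<le> \<beta>" "0 \<le> d" for h g \<beta> d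
    using integral_density_layer[where a = a and b = 1 and c = \<kappa>, OF that(1-5)] that \<kappa> by (simp add: s)
  note lim_m = lim_m_def[of \<theta> E0, folded a_def] and lim_n = lim_n_def[of \<theta> E0, folded a_def]
  show ?thesis
    unfolding M a_def[symmetric]
  \<comment> \<open>The flow in the open wedge is uniform, so both states agree and the slope 1 of
    the dividing line is an arbitrary positive choice.\<close>
  proof (rule measure_solution_withI[where f = "\<lambda>_. 1" and q = q and \<sigma> = 1 and C = C
        and ?S0.0 = "(1, 1, 0, E0, p0 E0 \<epsilon>)" and ?S1.0 = "(1, 1, 0, E0, p0 E0 \<epsilon>)"])
    show "radon (layer a 1 \<kappa>)" using \<kappa> by (intro radon_layer) auto
    show "emeasure (layer a 1 \<kappa>) (- closure (Omega a)) = 0" by (rule emeasure_layer_Compl_closure)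
    show "density (layer a 1 \<kappa>) (indicator (Omega a)) =
        density lborel (\<lambda>z. ennreal (indicator (Omega a) z * 1))"
    proof -
      have "indicat_real (Omega a) z = 0" if "z \<in> Wall a" for z
        using that Omega_Wall_disjoint[of z a] by (auto simp: indicator_def)
      then show ?thesis
        using dens[of "indicator (Omega a)" 1 0 0] by (simp add: layer_0_right ennreal_indicator)
    qed
    show "lim_m \<theta> E0 k = pos (density (layer a 1 \<kappa>)
        (\<lambda>z. ennreal ([lim_u \<theta> z, (lim_u \<theta> z)\<^sup>2, lim_u \<theta> z * lim_v \<theta> z, lim_u \<theta> z * E0] ! k)))" if "k \<le> 3" for k
      using that
    proof (rule le_3_cases)
      have e: "\<kappa> * (cos \<theta>)\<^sup>2 = sin \<theta>" using cos by (simp add: \<kappa>_def)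
      show "lim_m \<theta> E0 0 = pos (density (layer a 1 \<kappa>)
          (\<lambda>z. ennreal ([lim_u \<theta> z, (lim_u \<theta> z)\<^sup>2, lim_u \<theta> z * lim_v \<theta> z, lim_u \<theta> z * E0] ! 0)))"
        by (simp add: lim_m dens[where \<beta> = 1, OF _ _ _ _ _ e] \<Omega> W)
      have e: "\<kappa> * ((cos \<theta>)\<^sup>2)\<^sup>2 = sin \<theta> * (cos \<theta>)\<^sup>2" using cos by (simp add: \<kappa>_def power2_eq_square)
      show "lim_m \<theta> E0 1 = pos (density (layer a 1 \<kappa>)
          (\<lambda>z. ennreal ([lim_u \<theta> z, (lim_u \<theta> z)\<^sup>2, lim_u \<theta> z * lim_v \<theta> z, lim_u \<theta> z * E0] ! 1)))"
        by (simp add: lim_m dens[where \<beta> = 1, OF _ _ _ _ _ e] \<Omega> W)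
      have e: "\<kappa> * ((cos \<theta>)\<^sup>2 * (sin \<theta> * cos \<theta>)) = (sin \<theta>)\<^sup>2 * cos \<theta>" using cos by (simp add: \<kappa>_def power2_eq_square)
      show "lim_m \<theta> E0 2 = pos (density (layer a 1 \<kappa>)
          (\<lambda>z. ennreal ([lim_u \<theta> z, (lim_u \<theta> z)\<^sup>2, lim_u \<theta> z * lim_v \<theta> z, lim_u \<theta> z * E0] ! 2)))"
        using sin cos by (simp add: lim_m dens[where \<beta> = 0, OF _ _ _ _ _ e] \<Omega> W)
      have e: "\<kappa> * ((cos \<theta>)\<^sup>2 * E0) = E0 * sin \<theta>" using cos by (simp add: \<kappa>_def)
      show "lim_m \<theta> E0 3 = pos (density (layer a 1 \<kappa>)
          (\<lambda>z. ennreal ([lim_u \<theta> z, (lim_u \<theta> z)\<^sup>2, lim_u \<theta> z * lim_v \<theta> z, lim_u \<theta> z * E0] ! 3)))"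
        using E0 by (simp add: lim_m dens[where \<beta> = E0, OF _ _ _ _ _ e] \<Omega> W)
    qed
    show "lim_n \<theta> E0 k = pos (density (layer a 1 \<kappa>)
        (\<lambda>z. ennreal ([lim_v \<theta> z, lim_u \<theta> z * lim_v \<theta> z, (lim_v \<theta> z)\<^sup>2, lim_v \<theta> z * E0] ! k)))" if "k \<le> 3" for k
      using that
    proof (rule le_3_cases)
      have e: "\<kappa> * (sin \<theta> * cos \<theta>) = (sin \<theta>)\<^sup>2 / cos \<theta>" using cos by (simp add: \<kappa>_def power2_eq_square)
      show "lim_n \<theta> E0 0 = pos (density (layer a 1 \<kappa>)
          (\<lambda>z. ennreal ([lim_v \<theta> z, lim_u \<theta> z * lim_v \<theta> z, (lim_v \<theta> z)\<^sup>2, lim_v \<theta> z * E0] ! 0)))"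
        using sin cos by (simp add: lim_n dens[where \<beta> = 0, OF _ _ _ _ _ e] \<Omega> W)
      have e: "\<kappa> * ((cos \<theta>)\<^sup>2 * (sin \<theta> * cos \<theta>)) = (sin \<theta>)\<^sup>2 * cos \<theta>" using cos by (simp add: \<kappa>_def power2_eq_square)
      show "lim_n \<theta> E0 1 = pos (density (layer a 1 \<kappa>)
          (\<lambda>z. ennreal ([lim_v \<theta> z, lim_u \<theta> z * lim_v \<theta> z, (lim_v \<theta> z)\<^sup>2, lim_v \<theta> z * E0] ! 1)))"
        using sin cos by (simp add: lim_n dens[where \<beta> = 0, OF _ _ _ _ _ e] \<Omega> W)
      have e: "\<kappa> * (sin \<theta> * cos \<theta>)\<^sup>2 = sin \<theta> ^ 3"
        using cos by (simp add: \<kappa>_def power2_eq_square power3_eq_cube)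
      show "lim_n \<theta> E0 2 = pos (density (layer a 1 \<kappa>)
          (\<lambda>z. ennreal ([lim_v \<theta> z, lim_u \<theta> z * lim_v \<theta> z, (lim_v \<theta> z)\<^sup>2, lim_v \<theta> z * E0] ! 2)))"
        by (simp add: lim_n dens[where \<beta> = 0, OF _ _ _ _ _ e] \<Omega> W)
      have e: "\<kappa> * (sin \<theta> * cos \<theta> * E0) = E0 * ((sin \<theta>)\<^sup>2 / cos \<theta>)"
        using cos by (simp add: \<kappa>_def power2_eq_square)
      show "lim_n \<theta> E0 3 = pos (density (layer a 1 \<kappa>)
          (\<lambda>z. ennreal ([lim_v \<theta> z, lim_u \<theta> z * lim_v \<theta> z, (lim_v \<theta> z)\<^sup>2, lim_v \<theta> z * E0] ! 3)))"
        using E0 sin cos by (simp add: lim_n dens[where \<beta> = 0, OF _ _ _ _ _ e] \<Omega> W)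
    qed
    show "pos (layer a (p0 E0 \<epsilon>) 0) = pos (density (layer a 1 \<kappa>) (\<lambda>z. ennreal (q z)))"
      using p0 by (simp add: dens[of q "p0 E0 \<epsilon>" 0 0] meas \<Omega> W)
    show "- (sin \<theta> * (p0 E0 \<epsilon> + (sin \<theta>)\<^sup>2)) + a * (cos \<theta> * (p0 E0 \<epsilon> + (sin \<theta>)\<^sup>2)) = 0"
      using cos by (simp add: a)
    show "q z * 1 = \<epsilon> / (\<epsilon> + 1) * 1 * (E0 - 1/2 * ((lim_u \<theta> z)\<^sup>2 + (lim_v \<theta> z)\<^sup>2))" if "z \<in> Omega a" for z
      using that by (simp add: \<Omega> p0_def)
    show "(1, lim_u \<theta> z, lim_v \<theta> z, E0, q z * 1) =
      (if snd z > 1 * fst z then (1, 1, 0, E0, p0 E0 \<epsilon>) else (1, 1, 0, E0, p0 E0 \<epsilon>))" if "z \<in> Omega a" for z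
      using that by (simp add: \<Omega>)
  next
    fix \<phi> assume \<phi>: "\<phi> \<in> C1_test"
    note C0 = C1_test_C0_test(2,3)[OF \<phi>]
    let ?J = "ray_integral a (\<lambda>_. 1) \<phi>"
    let ?Rx = "ray_integral a (\<lambda>x. x) (dx \<phi>)" and ?Ry = "ray_integral a (\<lambda>x. x) (dy \<phi>)"
    have J: "?Rx + a * ?Ry = - ?J" by (rule ray_integral_derivative[OF \<phi>])
    have A: "wedge_integral a (dx \<phi>) = a * ?J - inflow 1 \<phi>" "wedge_integral a (dy \<phi>) = - ?J"
      by (rule wedge_integral_dx[OF \<phi> a0], rule wedge_integral_dy[OF \<phi>])
    have iu: "(\<integral>z. lim_u \<theta> z * g z \<partial>layer a 1 \<kappa>) = wedge_integral a g + a * ray_integral a (\<lambda>x. x) g"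
      if "g \<in> C0_test" for g
      using int[OF that, of "lim_u \<theta>" 1 "(cos \<theta>)\<^sup>2"] cos by (simp add: \<Omega> W u0 \<kappa>_def a)
    have iv: "(\<integral>z. lim_v \<theta> z * g z \<partial>layer a 1 \<kappa>) = a * (a * ray_integral a (\<lambda>x. x) g)"
      if "g \<in> C0_test" for g
      using int[OF that, of "lim_v \<theta>" 0 "sin \<theta> * cos \<theta>"] sin cos
      by (simp add: \<Omega> W v0 \<kappa>_def a power2_eq_square)
    have iuu: "(\<integral>z. (lim_u \<theta> z)\<^sup>2 * g z \<partial>layer a 1 \<kappa>) =
        wedge_integral a g + sin \<theta> * cos \<theta> * ray_integral a (\<lambda>x. x) g" if "g \<in> C0_test" for g
      using int[OF that, of "\<lambda>z. (lim_u \<theta> z)\<^sup>2" 1 "((cos \<theta>)\<^sup>2)\<^sup>2"] cos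
      by (simp add: \<Omega> W \<kappa>_def power2_eq_square)
    have iuv: "(\<integral>z. lim_u \<theta> z * lim_v \<theta> z * g z \<partial>layer a 1 \<kappa>) =
        sin \<theta> * cos \<theta> * (a * ray_integral a (\<lambda>x. x) g)" if "g \<in> C0_test" for g
      using int[OF that, of "\<lambda>z. lim_u \<theta> z * lim_v \<theta> z" 0 "(cos \<theta>)\<^sup>2 * (sin \<theta> * cos \<theta>)"] sin cos
      by (simp add: \<Omega> W u0 v0 \<kappa>_def a power2_eq_square)
    have ivv: "(\<integral>z. (lim_v \<theta> z)\<^sup>2 * g z \<partial>layer a 1 \<kappa>) =
        (sin \<theta>)\<^sup>2 * (a * ray_integral a (\<lambda>x. x) g)" if "g \<in> C0_test" for g
      using int[OF that, of "\<lambda>z. (lim_v \<theta> z)\<^sup>2" 0 "(sin \<theta> * cos \<theta>)\<^sup>2"] sin cos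
      by (simp add: \<Omega> W \<kappa>_def a power2_eq_square)
    have iq: "(\<integral>z. q z * g z \<partial>layer a 1 \<kappa>) = p0 E0 \<epsilon> * wedge_integral a g" if "g \<in> C0_test" for g
      using int[OF that, of q "p0 E0 \<epsilon>" 0] p0 by (simp add: \<Omega> W q0)
    have "a * (?Rx + a * ?Ry) = - (a * ?J)" by (simp add: J)
    then show "(\<integral>z. lim_u \<theta> z * dx \<phi> z \<partial>layer a 1 \<kappa>) + (\<integral>z. lim_v \<theta> z * dy \<phi> z \<partial>layer a 1 \<kappa>)
        + inflow 1 \<phi> = 0"
      unfolding iu[OF C0(1)] iv[OF C0(2)] A by (simp add: algebra_simps)
    have R: "sin \<theta> * cos \<theta> * ?Rx + sin \<theta> * cos \<theta> * (a * ?Ry) = - (sin \<theta> * cos \<theta> * ?J)"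
      unfolding distrib_left[symmetric] J by simp
    have w: "- (sin \<theta> * (p0 E0 \<epsilon> + (sin \<theta>)\<^sup>2)) * (1 / cos \<theta>) = - (a * (p0 E0 \<epsilon> + (sin \<theta>)\<^sup>2))"
      by (simp add: a)
    \<comment> \<open>The x-momentum that reaches the wall splits into the part carried off by the
      layer and the part taken up by the wall; the splitting is
      \<open>1 = (cos \<theta>)\<^sup>2 + (sin \<theta>)\<^sup>2\<close>.\<close>
    have "a * (cos \<theta>)\<^sup>2 = sin \<theta> * cos \<theta>" using cos by (simp add: a power2_eq_square)
    then have t: "a * ?J = sin \<theta> * cos \<theta> * ?J + a * (sin \<theta>)\<^sup>2 * ?J"
      unfolding distrib_right[symmetric] by (simp add: sc algebra_simps)
    show "(\<integral>z. (lim_u \<theta> z)\<^sup>2 * dx \<phi> z \<partial>layer a 1 \<kappa>)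
        + (\<integral>z. lim_u \<theta> z * lim_v \<theta> z * dy \<phi> z \<partial>layer a 1 \<kappa>) + (\<integral>z. q z * dx \<phi> z \<partial>layer a 1 \<kappa>)
        + - (sin \<theta> * (p0 E0 \<epsilon> + (sin \<theta>)\<^sup>2)) * sqrt (1 + a\<^sup>2) * ?J + (1 + p0 E0 \<epsilon>) * inflow 1 \<phi> = 0"
      unfolding iuu[OF C0(1)] iuv[OF C0(2)] iq[OF C0(1)] A s w
      using R t by algebra
    \<comment> \<open>The y-momentum flux of the layer is \<open>(sin \<theta>)\<^sup>2 * x\<close>;
      its growth is paid for by the wall force beyond \<open>p0\<close>.\<close>
    have "sin \<theta> * cos \<theta> * a = (sin \<theta>)\<^sup>2" using cos by (simp add: a power2_eq_square)
    then have e: "sin \<theta> * cos \<theta> * (a * x) + (sin \<theta>)\<^sup>2 * (a * y) = (sin \<theta>)\<^sup>2 * (x + a * y)" for x y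
      by (simp add: algebra_simps)
    show "(\<integral>z. lim_u \<theta> z * lim_v \<theta> z * dx \<phi> z \<partial>layer a 1 \<kappa>)
        + (\<integral>z. (lim_v \<theta> z)\<^sup>2 * dy \<phi> z \<partial>layer a 1 \<kappa>) + (\<integral>z. q z * dy \<phi> z \<partial>layer a 1 \<kappa>)
        + cos \<theta> * (p0 E0 \<epsilon> + (sin \<theta>)\<^sup>2) * sqrt (1 + a\<^sup>2) * ?J = 0"
      unfolding iuv[OF C0(1)] ivv[OF C0(2)] iq[OF C0(2)] A s e J using cos by (simp add: algebra_simps)
  qed (use meas u0 v0 q0 uC vC qC E0 in auto)
qed

section \<open>Attached-shock solutions\<close>

text \<open>The Rankine--Hugoniot conditions in closed form: with \<^term>\<open>v = a * u\<close>, the shock relations give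
  \<open>\<rho>\<^sub>1 = (1 - u) / ((1 - u) u - v\<^sup>2)\<close> and \<open>p\<^sub>1 = p\<^sub>0 + 1 - u\<close>; the equation of state then is
  the equation that defines the branch.\<close>

lemma shock_state:
  assumes \<epsilon>: "0 < \<epsilon>" and a: "0 < a" and E0: "1 / 2 < E0" and u: "0 < u" "u < 1"
    and branch: "(1 - u)\<^sup>2 * (u - \<epsilon> / (\<epsilon> + 2) - 2 * (\<epsilon> / (\<epsilon> + 2)) * (E0 - 1/2)) =
      a\<^sup>2 * u\<^sup>2 * (1 - u + 2 * (\<epsilon> / (\<epsilon> + 2)) * (E0 - 1/2))"
  shows "rho1 a E0 \<epsilon> u * ((1 - u) * u - (a * u)\<^sup>2) = 1 - u" "0 < rho1 a E0 \<epsilon> u"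
    and "p1 a E0 \<epsilon> u = p0 E0 \<epsilon> + (1 - u)"
    and "p1 a E0 \<epsilon> u = \<epsilon> / (\<epsilon> + 1) * rho1 a E0 \<epsilon> u * (E0 - 1/2 * (u\<^sup>2 + (a * u)\<^sup>2))"
    and "a < shock_slope a u"
    and "rho1 a E0 \<epsilon> u * u * (shock_slope a u - a) = shock_slope a u"
proof -
  define e where "e = E0 - 1/2"
  define q where "q = 1 - u"
  define v where "v = a * u"
  define l where "l = \<epsilon> / (\<epsilon> + 2)"
  define D where "D = q\<^sup>2 + v\<^sup>2"
  have e: "0 < e" and q: "0 < q" and v: "0 < v" and l: "0 < l"
    using \<epsilon> E0 a u by (auto simp: e_def q_def v_def l_def)
  have D: "0 < D" using q v by (simp add: D_def add_pos_pos)
  have "q\<^sup>2 * (u - l - 2 * l * e) = v\<^sup>2 * (q + 2 * l * e)"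
    using branch by (simp add: q_def v_def l_def e_def power_mult_distrib)
  \<comment> \<open>The branch equation with the terms in \<open>l\<close> collected. Its right side
    is positive, and this yields the positivity of \<open>q * u - v\<^sup>2\<close>, the denominator
    of the density behind the shock.\<close>
  then have B: "q * (q * u - v\<^sup>2) = l * (q\<^sup>2 + 2 * e * D)"
    unfolding D_def by algebra
  have "0 < l * (q\<^sup>2 + 2 * e * D)" using l q e D by (intro mult_pos_pos add_pos_pos) auto
  then have N: "0 < q * u - v\<^sup>2" using B q by (metis zero_less_mult_pos)
  \<comment> \<open>The tangent of the shock angle is \<open>q / v\<close>, and \<open>D\<close> is
    the squared hypotenuse.\<close>
  have S: "(sin (shock_angle a u))\<^sup>2 = q\<^sup>2 / D"
  proof -
    have s: "shock_slope a u = q / v" by (simp add: shock_slope_def q_def v_def)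
    have "1 + (q / v)\<^sup>2 = D / v\<^sup>2" using v by (simp add: D_def power_divide field_simps)
    moreover have "(sin (arctan x))\<^sup>2 = x\<^sup>2 / (1 + x\<^sup>2)" for x
      by (simp add: sin_arctan power_divide)
    ultimately show ?thesis
      unfolding shock_angle_def s using v by (simp add: power_divide[of q v])
  qed
  have "2 * e + q\<^sup>2 / D = (q\<^sup>2 + 2 * e * D) / D" using D by (simp add: field_simps)
  then have "rho1 a E0 \<epsilon> u = 1 / l * (q\<^sup>2 / D / ((q\<^sup>2 + 2 * e * D) / D))"
    unfolding rho1_def S e_def[symmetric] by (simp add: l_def)
  also have "\<dots> = q\<^sup>2 / (l * (q\<^sup>2 + 2 * e * D))" using D by simp
  also have "\<dots> = q / (q * u - v\<^sup>2)" unfolding B[symmetric] using q by (simp add: power2_eq_square[of q])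
  finally have r: "rho1 a E0 \<epsilon> u = q / (q * u - v\<^sup>2)" .
  show 1: "rho1 a E0 \<epsilon> u * ((1 - u) * u - (a * u)\<^sup>2) = 1 - u"
    using N unfolding r q_def v_def by simp
  show 2: "0 < rho1 a E0 \<epsilon> u" using N q by (simp add: r)
  have l1: "l * (\<epsilon> + 2) = \<epsilon>" using \<epsilon> by (simp add: l_def)
  have p1': "p1 a E0 \<epsilon> u * ((\<epsilon> + 1) * (\<epsilon> + 2)) = 2 * (\<epsilon> + 1) * (q\<^sup>2 / D) - \<epsilon>\<^sup>2 * e"
    unfolding p1_def S e_def[symmetric] using \<epsilon> by simp
  have p0': "p0 E0 \<epsilon> * (\<epsilon> + 1) = \<epsilon> * e" unfolding p0_def e_def[symmetric] using \<epsilon> by simp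
  have SD: "q\<^sup>2 / D * D = q\<^sup>2" using D by simp
  have uq: "u = 1 - q" by (simp add: q_def)
  have B': "(\<epsilon> + 2) * (q * (q * u - v\<^sup>2)) = \<epsilon> * (q\<^sup>2 + 2 * e * D)"
    using B l1 by algebra
  have "q\<^sup>2 / D * 2 = (\<epsilon> + 2) * q + 2 * \<epsilon> * e"
  proof -
    \<comment> \<open>As \<open>u = 1 - q\<close>, the factor \<open>q * u - v\<^sup>2\<close>
      equals \<open>q - D\<close>, so the terms with \<open>q\<^sup>2\<close> in \<open>B'\<close>
      combine to \<open>2 * q\<^sup>2\<close>.\<close>
    have "2 * q\<^sup>2 = D * ((\<epsilon> + 2) * q + 2 * \<epsilon> * e)"
      using B' uq D_def by algebra
    then show ?thesis using D by (simp add: field_simps)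
  qed
  then have "p1 a E0 \<epsilon> u * ((\<epsilon> + 1) * (\<epsilon> + 2)) = (p0 E0 \<epsilon> + q) * ((\<epsilon> + 1) * (\<epsilon> + 2))"
    using p1' p0' by algebra
  then show 3: "p1 a E0 \<epsilon> u = p0 E0 \<epsilon> + (1 - u)"
    using \<epsilon> by (simp add: q_def)
  then have "p1 a E0 \<epsilon> u * (\<epsilon> + 1) = \<epsilon> * e + q * (\<epsilon> + 1)"
    using p0' q_def by algebra
  \<comment> \<open>Prepares the equation of state multiplied by \<open>q * u - v\<^sup>2\<close>,
    which turns the density into \<open>q\<close>; the factor is cancelled at the end by
    \<open>N\<close>.\<close>
  moreover have "(q * u - v\<^sup>2) * (2 * (\<epsilon> * e + q * (\<epsilon> + 1))) = \<epsilon> * q * (2 * e + 1 - (u\<^sup>2 + v\<^sup>2))"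
    using B' uq D_def by algebra
  moreover have rN: "rho1 a E0 \<epsilon> u * (q * u - v\<^sup>2) = q" using N by (simp add: r)
  moreover have E: "2 * e + 1 = 2 * E0" by (simp add: e_def)
  ultimately have "(q * u - v\<^sup>2) * (2 * (p1 a E0 \<epsilon> u * (\<epsilon> + 1))) =
      (q * u - v\<^sup>2) * (2 * (\<epsilon> * rho1 a E0 \<epsilon> u * (E0 - 1/2 * (u\<^sup>2 + v\<^sup>2))))"
    by algebra
  then have "p1 a E0 \<epsilon> u * (\<epsilon> + 1) = \<epsilon> * rho1 a E0 \<epsilon> u * (E0 - 1/2 * (u\<^sup>2 + v\<^sup>2))"
    using N by simp
  then show "p1 a E0 \<epsilon> u = \<epsilon> / (\<epsilon> + 1) * rho1 a E0 \<epsilon> u * (E0 - 1/2 * (u\<^sup>2 + (a * u)\<^sup>2))"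
    using \<epsilon> by (simp add: v_def field_simps)
  \<comment> \<open>Positivity of the denominator also says \<open>q / v > v / u\<close>, that is,
    the shock lies above the wall.\<close>
  have "v\<^sup>2 < q * u" using N by simp
  then have "a * (a * u) < q" using u by (simp add: v_def power2_eq_square)
  then show "a < shock_slope a u"
    using a u by (simp add: shock_slope_def q_def pos_less_divide_eq ac_simps)
  have \<sigma>: "shock_slope a u * v = q" using a u by (simp add: shock_slope_def q_def v_def)
  have "v * (rho1 a E0 \<epsilon> u * u * (shock_slope a u - a)) =
      rho1 a E0 \<epsilon> u * (shock_slope a u * v * u - v * (a * u))"
    by (simp add: algebra_simps)
  also have "\<dots> = q"
    unfolding \<sigma> using rN by (simp add: v_def power2_eq_square)
  finally have "v * (rho1 a E0 \<epsilon> u * u * (shock_slope a u - a)) = v * shock_slope a u"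
    using \<sigma> by (simp add: mult.commute)
  then show "rho1 a E0 \<epsilon> u * u * (shock_slope a u - a) = shock_slope a u"
    using v by simp
qed

section \<open>Functions with two constant states\<close>

lemma two_state_Omega:
  assumes "z \<in> Omega a" "0 < a" "0 < shock_slope a u"
  shows "two_state a u f0 f1 z = (if snd z > shock_slope a u * fst z then f0 else f1)"
proof (cases z)
  case (Pair x y)
  then have "0 < a * x" "a * x < y" using assms by (auto simp: Omega_def)
  \<comment> \<open>The quotient \<open>x / y\<close> can be cleared because \<open>y\<close> is
    positive in the wedge.\<close>
  then have "0 < y" by linarith
  then have "x / y < 1 / shock_slope a u \<longleftrightarrow> shock_slope a u * x < y"
    using assms(3) by (simp add: field_simps)
  then show ?thesis by (simp add: two_state_def Pair)
qed

lemma two_state_measurable [measurable]: "two_state a u f0 f1 \<in> borel_measurable borel"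
proof -
  have "(\<lambda>z::plane. fst z / snd z) \<in> borel_measurable borel"
    by (intro borel_measurable_divide borel_measurable_continuous_onI continuous_intros)
  then have "{z::plane. fst z / snd z < 1 / shock_slope a u} \<in> sets borel" by measurable
  then show ?thesis
    unfolding two_state_def case_prod_beta by (intro measurable_If) auto
qed

lemma two_state_nonneg: "0 \<le> f0 \<Longrightarrow> 0 \<le> f1 \<Longrightarrow> 0 \<le> two_state a u f0 f1 z"
  by (simp add: two_state_def split: prod.split)

lemma two_state_le: "two_state a u f0 f1 z \<le> max f0 f1"
  by (simp add: two_state_def split: prod.split)

text \<open>Keeps all products of flow quantities in the same form, so that one integral formula
  serves every term.\<close>

lemma two_state_mult:
  "two_state a u f0 f1 z * two_state a u g0 g1 z = two_state a u (f0 * g0) (f1 * g1) z"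
  by (simp add: two_state_def split: prod.split)

text \<open>The shock is steeper than the wall, so the region in front of it is a smaller wedge and
  the region behind it is a difference of nested wedges.\<close>

lemma integral_two_state:
  assumes g: "g \<in> C0_test" and a: "0 < a" "a < shock_slope a u"
  shows "(\<integral>z. two_state a u f0 f1 z * indicator (Omega a) z * g z \<partial>lborel) =
    f0 * wedge_integral (shock_slope a u) g +
    f1 * (wedge_integral a g - wedge_integral (shock_slope a u) g)"
proof -
  let ?\<sigma> = "shock_slope a u"
  have i: "integrable lborel (\<lambda>z. indicator (Omega b) z * g z)" for b
    by (rule integrable_indicator_mult[OF C0_test_integrable[OF g] Omega_borel])
  have sub: "z \<in> Omega a \<and> ?\<sigma> * fst z < snd z \<longleftrightarrow> z \<in> Omega ?\<sigma>" for z
  proof (cases z)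
    case (Pair x y)
    have "0 < x \<Longrightarrow> a * x < ?\<sigma> * x" using a by simp
    with less_trans[of "a * x" "?\<sigma> * x" y] show ?thesis
      unfolding Omega_def Pair mem_Collect_eq prod.case fst_conv snd_conv by blast
  qed
  have "two_state a u f0 f1 z * indicator (Omega a) z * g z =
      f0 * (indicator (Omega ?\<sigma>) z * g z) +
      f1 * (indicator (Omega a) z * g z - indicator (Omega ?\<sigma>) z * g z)" for z
  proof (cases "z \<in> Omega a")
    case True
    then show ?thesis using two_state_Omega[OF True, of u f0 f1] sub[of z] a by (simp add: indicator_def)
  next
    case False
    then show ?thesis using sub[of z] by (simp add: indicator_def)
  qed
  then have "(\<integral>z. two_state a u f0 f1 z * indicator (Omega a) z * g z \<partial>lborel) =
      (\<integral>z. f0 * (indicator (Omega ?\<sigma>) z * g z) +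
        f1 * (indicator (Omega a) z * g z - indicator (Omega ?\<sigma>) z * g z) \<partial>lborel)" by simp
  also have "\<dots> = f0 * wedge_integral ?\<sigma> g + f1 * (wedge_integral a g - wedge_integral ?\<sigma> g)"
    unfolding wedge_integral_def using i
    by (subst Bochner_Integration.integral_add) simp_all
  finally show ?thesis .
qed

text \<open>After the divergence theorem on both wedges, the coefficients of the ray integral along
  the shock cancel by the jump conditions, and along the wall only the pressure remains, since
  \<open>(u, a * u)\<close> is tangential to it.\<close>

lemma shock_measure_solution:
  assumes \<epsilon>: "0 < \<epsilon>" and a: "0 < a" and E0: "1 / 2 < E0" and u: "0 < u" "u < 1"
    and branch: "(1 - u)\<^sup>2 * (u - \<epsilon> / (\<epsilon> + 2) - 2 * (\<epsilon> / (\<epsilon> + 2)) * (E0 - 1/2)) =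
      a\<^sup>2 * u\<^sup>2 * (1 - u + 2 * (\<epsilon> / (\<epsilon> + 2)) * (E0 - 1/2))"
  shows "measure_solution_with a E0 \<epsilon> (sh_varrho a E0 \<epsilon> u) (sh_u a u) (sh_v a u) (\<lambda>_. E0)
    (sh_m a E0 \<epsilon> u) (sh_n a E0 \<epsilon> u) (sh_wp a E0 \<epsilon> u)
    (\<lambda>_. - a / sqrt (1 + a\<^sup>2) * p1 a E0 \<epsilon> u) (\<lambda>_. 1 / sqrt (1 + a\<^sup>2) * p1 a E0 \<epsilon> u)"
proof -
  define \<sigma> where "\<sigma> = shock_slope a u"
  define r where "r = rho1 a E0 \<epsilon> u"
  define P1 where "P1 = p1 a E0 \<epsilon> u"
  note st = shock_state[OF assms, folded \<sigma>_def r_def P1_def]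
  have \<sigma>: "0 < \<sigma>" "0 < shock_slope a u" using st(5) a by (auto simp: \<sigma>_def)
  have p0: "0 \<le> p0 E0 \<epsilon>" using E0 \<epsilon> by (simp add: p0_def)
  have P1: "0 \<le> P1" "p0 E0 \<epsilon> < P1" using st(3) p0 u by auto
  \<comment> \<open>The tangential velocity is continuous across the shock: the jump
    \<open>(u - 1, a * u)\<close> is orthogonal to the direction
    \<open>(1, \<sigma>)\<close>.\<close>
  have \<sigma>q: "\<sigma> * (a * u) = 1 - u" using a u by (simp add: \<sigma>_def shock_slope_def)
  \<comment> \<open>The jump condition for mass.\<close>
  have rh: "\<sigma> * (1 - r * u) + r * (a * u) = 0"
    using st(6) by (simp add: algebra_simps)
  let ?ts = "two_state a u"
  \<comment> \<open>The pressure in \<open>?q\<close> is taken relative to the density, hence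
    \<open>P1 / r\<close> behind the shock.\<close>
  let ?\<rho> = "?ts 1 r" and ?u = "?ts 1 u" and ?v = "?ts 0 (a * u)" and ?q = "?ts (p0 E0 \<epsilon>) (P1 / r)"
  have sh: "sh_rho a E0 \<epsilon> u = ?\<rho>" "sh_u a u = ?u" "sh_v a u = ?v" "sh_p a E0 \<epsilon> u = ?ts (p0 E0 \<epsilon>) P1"
    by (auto simp: sh_rho_def sh_u_def sh_v_def sh_p_def r_def P1_def)
  have E0': "?ts E0 E0 = (\<lambda>_. E0)" by (auto simp: two_state_def)
  have sq: "(?ts f0 f1 z)\<^sup>2 = ?ts (f0\<^sup>2) (f1\<^sup>2) z" for f0 f1 z
    by (simp add: power2_eq_square two_state_mult)
  have mE: "?ts f0 f1 z * E0 = ?ts (f0 * E0) (f1 * E0) z" for f0 f1 z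
    using two_state_mult[of a u f0 f1 z E0 E0] by (simp add: E0')
  note ts = two_state_mult sq mE
  let ?M = "sh_varrho a E0 \<epsilon> u"
  have M: "?M = density lborel (\<lambda>z. ennreal (?\<rho> z * indicator (Omega a) z))"
    by (simp add: sh_varrho_def sh)
  have \<rho>0: "0 \<le> ?\<rho> z" for z using st(2) by (intro two_state_nonneg) auto
  have dens: "density ?M (\<lambda>z. ennreal (?ts h0 h1 z)) =
      density lborel (\<lambda>z. ennreal (?ts h0 (r * h1) z * indicator (Omega a) z))"
    if "0 \<le> h0" "0 \<le> h1" for h0 h1
    unfolding M using two_state_nonneg[OF that] \<rho>0
    by (subst density_density_eq)
      (auto intro!: density_cong AE_I2 simp: ennreal_mult[symmetric] ts ac_simps split: split_indicator)
  have leb: "leb (\<lambda>z. ?ts h0 (r * h1) z * indicator (Omega a) z) = pos (density ?M (\<lambda>z. ennreal (?ts h0 h1 z)))"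
    if "0 \<le> h0" "0 \<le> h1" for h0 h1
    using that st(2) by (subst leb_eq) (auto simp: dens two_state_nonneg)
  have int: "(\<integral>z. ?ts h0 h1 z * g z \<partial>?M) =
      h0 * wedge_integral \<sigma> g + r * h1 * (wedge_integral a g - wedge_integral \<sigma> g)"
    if "g \<in> C0_test" for g h0 h1
  proof -
    note [measurable] = C0_test_measurable[OF that]
    have "(?\<rho> z * indicator (Omega a) z) *\<^sub>R (?ts h0 h1 z * g z) =
        ?ts h0 (r * h1) z * indicator (Omega a) z * g z" for z
      using two_state_mult[of a u 1 r z h0 h1] by (simp add: ac_simps)
    note e = this
    have "(\<integral>z. ?ts h0 h1 z * g z \<partial>?M) =
        (\<integral>z. (?\<rho> z * indicator (Omega a) z) *\<^sub>R (?ts h0 h1 z * g z) \<partial>lborel)"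
      unfolding M using \<rho>0 by (intro integral_density) auto
    also have "\<dots> = (\<integral>z. ?ts h0 (r * h1) z * indicator (Omega a) z * g z \<partial>lborel)"
      unfolding e ..
    finally have "(\<integral>z. ?ts h0 h1 z * g z \<partial>?M) = \<dots>" .
    then show ?thesis
      using integral_two_state[OF that a, of u h0 "r * h1"] st(5) by (simp add: \<sigma>_def)
  qed
  define C where "C = 2 + a * u + p0 E0 \<epsilon> + P1 / r"
  have Pr: "0 \<le> P1 / r" using P1 st(2) by simp
  have au: "0 < a * u" using a u by simp
  have auE: "0 \<le> a * (u * E0)" using a u E0 by simp
  show ?thesis
    unfolding sh P1_def[symmetric]
  proof (rule measure_solution_withI[where f = ?\<rho> and q = ?q and \<sigma> = \<sigma> and C = C
        and ?S0.0 = "(1, 1, 0, E0, p0 E0 \<epsilon>)" and ?S1.0 = "(r, u, a * u, E0, P1)"])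
    show "radon ?M"
      unfolding M
    proof (rule radon_density[OF radon_lborel])
      show "?\<rho> z * indicator (Omega a) z \<le> max 1 r" for z
        using two_state_le[of a u 1 r z] by (auto simp: indicator_def)
    qed auto
    have "(\<lambda>z. ennreal (?\<rho> z * indicator (Omega a) z) * indicator (- closure (Omega a)) z) = (\<lambda>_. 0)"
      using closure_subset[of "Omega a"] by (auto simp: indicator_def fun_eq_iff)
    then show "emeasure ?M (- closure (Omega a)) = 0"
      unfolding M by (subst emeasure_density) simp_all
    show "density ?M (indicator (Omega a)) = density lborel (\<lambda>z. ennreal (indicator (Omega a) z * ?\<rho> z))"
      unfolding M by (subst density_density_eq)
        (auto intro!: density_cong AE_I2 split: split_indicator)
    show "sh_m a E0 \<epsilon> u k = pos (density ?M
        (\<lambda>z. ennreal ([?u z, (?u z)\<^sup>2, ?u z * ?v z, ?u z * E0] ! k)))" if "k \<le> 3" for k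
      using that
      by (rule le_3_cases) (use u au E0 in \<open>simp_all add: sh_m_def sh ts leb[symmetric] mult.assoc
          flip: power2_eq_square\<close>)
    show "sh_n a E0 \<epsilon> u k = pos (density ?M
        (\<lambda>z. ennreal ([?v z, ?u z * ?v z, (?v z)\<^sup>2, ?v z * E0] ! k)))" if "k \<le> 3" for k
      using that
      by (rule le_3_cases) (use u au E0 auE in \<open>simp_all add: sh_n_def sh ts leb[symmetric] mult.assoc
          flip: power2_eq_square\<close>)
    show "sh_wp a E0 \<epsilon> u = pos (density ?M (\<lambda>z. ennreal (?q z)))"
      using p0 Pr st(2) leb[of "p0 E0 \<epsilon>" "P1 / r"] by (simp add: sh_wp_def sh)
    show "- a / sqrt (1 + a\<^sup>2) * P1 + a * (1 / sqrt (1 + a\<^sup>2) * P1) = 0" by simp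
    show "?q z * ?\<rho> z = \<epsilon> / (\<epsilon> + 1) * ?\<rho> z * (E0 - 1/2 * ((?u z)\<^sup>2 + (?v z)\<^sup>2))" if "z \<in> Omega a" for z
      using st(2,4) by (simp add: two_state_Omega[OF that a \<sigma>(2)] p0_def)
    show "(?\<rho> z, ?u z, ?v z, E0, ?q z * ?\<rho> z) =
      (if snd z > \<sigma> * fst z then (1, 1, 0, E0, p0 E0 \<epsilon>) else (r, u, a * u, E0, P1))" if "z \<in> Omega a" for z
      using st(2) by (simp add: two_state_Omega[OF that a \<sigma>(2)] \<sigma>_def)
    have "1 \<le> C" "u \<le> C" "0 \<le> C" "a * u \<le> C" "p0 E0 \<epsilon> \<le> C" "P1 / r \<le> C"
      using u au p0 Pr by (simp_all add: C_def)
    then show "?u z \<le> C" "?v z \<le> C" "?q z \<le> C" for z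
      by (auto intro: order_trans[OF two_state_le])
  next
    fix \<phi> assume \<phi>: "\<phi> \<in> C1_test"
    note C0 = C1_test_C0_test(2,3)[OF \<phi>]
    have A: "wedge_integral b (dx \<phi>) = b * ray_integral b (\<lambda>_. 1) \<phi> - inflow 1 \<phi>"
      "wedge_integral b (dy \<phi>) = - ray_integral b (\<lambda>_. 1) \<phi>" if "0 < b" for b
      by (rule wedge_integral_dx[OF \<phi> that], rule wedge_integral_dy[OF \<phi>])
    have s: "sqrt (1 + a\<^sup>2) \<noteq> 0" by (simp add: add_nonneg_eq_0_iff)
    have w1: "- a / sqrt (1 + a\<^sup>2) * P1 * sqrt (1 + a\<^sup>2) = - a * P1" using s by simp
    have w2: "1 / sqrt (1 + a\<^sup>2) * P1 * sqrt (1 + a\<^sup>2) = P1" using s by simp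
    have rP: "r * (P1 / r) = P1" using st(2) by simp
    show "(\<integral>z. ?u z * dx \<phi> z \<partial>?M) + (\<integral>z. ?v z * dy \<phi> z \<partial>?M) + inflow 1 \<phi> = 0"
      unfolding ts int[OF C0(1)] int[OF C0(2)] A[OF a] A[OF \<sigma>(1)]
      using rh by algebra
    show "(\<integral>z. (?u z)\<^sup>2 * dx \<phi> z \<partial>?M) + (\<integral>z. ?u z * ?v z * dy \<phi> z \<partial>?M) + (\<integral>z. ?q z * dx \<phi> z \<partial>?M)
        + - a / sqrt (1 + a\<^sup>2) * P1 * sqrt (1 + a\<^sup>2) * ray_integral a (\<lambda>_. 1) \<phi>
        + (1 + p0 E0 \<epsilon>) * inflow 1 \<phi> = 0"
      unfolding ts int[OF C0(1)] int[OF C0(2)] A[OF a] A[OF \<sigma>(1)] w1 rP one_power2 mult_zero_right mult_zero_left mult_1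
      using rh st(3) by algebra
    show "(\<integral>z. ?u z * ?v z * dx \<phi> z \<partial>?M) + (\<integral>z. (?v z)\<^sup>2 * dy \<phi> z \<partial>?M) + (\<integral>z. ?q z * dy \<phi> z \<partial>?M)
        + 1 / sqrt (1 + a\<^sup>2) * P1 * sqrt (1 + a\<^sup>2) * ray_integral a (\<lambda>_. 1) \<phi> = 0"
      unfolding ts int[OF C0(1)] int[OF C0(2)] A[OF a] A[OF \<sigma>(1)] w2 rP zero_power2 mult_zero_right mult_zero_left mult_1
      using rh st(3) \<sigma>q by algebra
  qed (use p0 P1 Pr \<sigma> E0 u au st(2) in \<open>auto intro!: two_state_nonneg\<close>)
qed

section \<open>Existence of the shock branch\<close>

text \<open>In the variable \<^term>\<open>t = u / (1 - u)\<close> the branch equation is \<open>\<lambda> = branch_map a e t\<close> with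
  \<open>\<lambda> = \<epsilon> / (\<epsilon> + 2)\<close>, so that the branch is the inverse of a decreasing function near its zero
  \<open>t = 1 / a\<^sup>2\<close>, that is \<open>u = 1 / (1 + a\<^sup>2) = cos\<^sup>2 \<theta>\<close>.\<close>

definition branch_map :: "real \<Rightarrow> real \<Rightarrow> real \<Rightarrow> real" where
  "branch_map a e t = t * (1 - a\<^sup>2 * t) / ((1 + t) * (1 + 2 * e * (1 + a\<^sup>2 * t\<^sup>2)))"

text \<open>Beyond the vertex \<open>1 / (2 * a\<^sup>2)\<close> of the parabola
  \<open>t * (1 - a\<^sup>2 * t)\<close> the numerator decreases while the denominator increases. Up
  to \<open>1 / a\<^sup>2\<close> the numerator is nonnegative, as the comparison of the fractions
  requires.\<close>

lemma branch_map_strict_antimono: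
  assumes a: "0 < a" and e: "0 < e" and st: "1 / (2 * a\<^sup>2) \<le> s" "s < t" "t \<le> 1 / a\<^sup>2"
  shows "branch_map a e t < branch_map a e s"
proof -
  have a2: "0 < a\<^sup>2" using a by simp
  have s0: "0 < s" by (rule less_le_trans[OF _ st(1)]) (use a2 in simp)
  have "a\<^sup>2 * (1 / (2 * a\<^sup>2)) = 1 / 2" using a2 by simp
  then have s2: "1 / 2 \<le> a\<^sup>2 * s" using mult_left_mono[OF st(1), of "a\<^sup>2"] a2 by simp
  have t1: "a\<^sup>2 * t \<le> 1" using mult_left_mono[OF st(3), of "a\<^sup>2"] a2 by simp
  have "a\<^sup>2 * s < a\<^sup>2 * t" using st a2 by simp
  then have "0 < (t - s) * (a\<^sup>2 * s + a\<^sup>2 * t - 1)" using s2 st by (intro mult_pos_pos) auto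
  then have "t * (1 - a\<^sup>2 * t) < s * (1 - a\<^sup>2 * s)" by (simp add: algebra_simps)
  moreover have "0 \<le> t * (1 - a\<^sup>2 * t)" using t1 s0 st by simp
  moreover have "0 < (1 + s) * (1 + 2 * e * (1 + a\<^sup>2 * s\<^sup>2))"
    using s0 e by (intro mult_pos_pos add_pos_nonneg) auto
  moreover have "(1 + s) * (1 + 2 * e * (1 + a\<^sup>2 * s\<^sup>2)) \<le> (1 + t) * (1 + 2 * e * (1 + a\<^sup>2 * t\<^sup>2))"
    using s0 e st by (intro mult_mono add_mono mult_left_mono power_mono) auto
  ultimately show ?thesis unfolding branch_map_def by (intro frac_less)
qed

text \<open>A continuous injective function on a compact interval has a continuous inverse, here
  \<open>H\<close>; this replaces an implicit function argument. The intermediate value theorem puts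
  all of \<open>{0..L}\<close> into the domain of \<open>H\<close>.\<close>

lemma shock_branch_exists:
  assumes \<theta>: "0 < \<theta>" "\<theta> < pi / 2" and E0: "1 / 2 < E0"
  shows "\<exists>U. shock_branch \<theta> E0 U"
proof -
  define a where "a = tan \<theta>"
  define e where "e = E0 - 1/2"
  define I where "I = {1 / (2 * a\<^sup>2)..1 / a\<^sup>2}"
  let ?G = "branch_map a e"
  have sin: "0 < sin \<theta>" and cos: "0 < cos \<theta>"
    using \<theta> by (auto intro: sin_gt_zero cos_gt_zero_pi)
  have a: "0 < a" using sin cos by (simp add: a_def tan_def)
  then have a2: "0 < a\<^sup>2" by simp
  have e: "0 < e" using E0 by (simp add: e_def)
  have I0: "0 < t" if "t \<in> I" for t
    by (rule less_le_trans[of _ "1 / (2 * a\<^sup>2)"]) (use that a2 in \<open>auto simp: I_def\<close>)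
  have Ile: "1 / (2 * a\<^sup>2) \<le> 1 / a\<^sup>2" using a2 by (intro divide_left_mono) auto
  have cont: "continuous_on I ?G"
    unfolding branch_map_def
  proof (intro continuous_intros ballI)
    fix t assume "t \<in> I"
    then have "0 < (1 + t) * (1 + 2 * e * (1 + a\<^sup>2 * t\<^sup>2))"
      using I0 e by (intro mult_pos_pos add_pos_nonneg) (auto intro: less_imp_le)
    then show "(1 + t) * (1 + 2 * e * (1 + a\<^sup>2 * t\<^sup>2)) \<noteq> 0" by (metis less_irrefl)
  qed
  have inj: "inj_on ?G I"
  proof (rule linorder_inj_onI')
    show "?G s \<noteq> ?G t" if "s \<in> I" "t \<in> I" "s < t" for s t
      using branch_map_strict_antimono[OF a e, of s t] that by (auto simp: I_def)
  qed
  define L where "L = ?G (1 / (2 * a\<^sup>2))"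
  have G0: "?G (1 / a\<^sup>2) = 0" using a2 by (simp add: branch_map_def)
  have L: "0 < L"
    using branch_map_strict_antimono[OF a e, of "1 / (2 * a\<^sup>2)" "1 / a\<^sup>2"] a2
    by (simp add: G0 L_def field_simps)
  have sub: "{0..L} \<subseteq> ?G ` I"
  proof
    fix y assume y: "y \<in> {0..L}"
    then have "\<exists>t\<ge>1 / (2 * a\<^sup>2). t \<le> 1 / a\<^sup>2 \<and> ?G t = y"
      using cont Ile by (intro IVT2') (auto simp: G0 L_def I_def)
    then show "y \<in> ?G ` I" by (auto simp: I_def)
  qed
  define H where "H = the_inv_into I ?G"
  have "compact I" by (simp add: I_def)
  from continuous_on_inv_into[OF cont this inj] have "continuous_on (?G ` I) H"
    by (simp add: H_def)
  then have Hc: "continuous_on {0..L} H" by (rule continuous_on_subset[OF _ sub])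
  have H: "H y \<in> I" "?G (H y) = y" if "y \<in> {0..L}" for y
    using the_inv_into_into[OF inj, of y I] f_the_inv_into_f[OF inj, of y] subsetD[OF sub that]
    by (auto simp: H_def)
  have H0: "H 0 = 1 / a\<^sup>2"
    using Ile the_inv_into_f_f[OF inj, of "1 / a\<^sup>2"] G0 unfolding H_def by (simp add: I_def)
  let ?l = "\<lambda>\<epsilon>::real. \<epsilon> / (\<epsilon> + 2)"
  let ?U = "\<lambda>\<epsilon>. H (?l \<epsilon>) / (1 + H (?l \<epsilon>))"
  \<comment> \<open>The parameter range \<open>2 * L\<close> is chosen because
    \<open>\<epsilon> / (\<epsilon> + 2) \<le> \<epsilon> / 2\<close>.\<close>
  have l: "?l \<epsilon> \<in> {0..L}" if "\<epsilon> \<in> {0<..<2 * L}" for \<epsilon>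
  proof -
    have "?l \<epsilon> \<le> \<epsilon> / 2" using that by (intro divide_left_mono) auto
    also have "\<epsilon> / 2 \<le> L" using that by simp
    finally show ?thesis using that by simp
  qed
  have "continuous_on {0<..<2 * L} (\<lambda>\<epsilon>. H (?l \<epsilon>))"
    by (rule continuous_on_compose2[OF Hc]) (use l in \<open>auto intro!: continuous_intros\<close>)
  moreover have "1 + H (?l \<epsilon>) \<noteq> 0" if "\<epsilon> \<in> {0<..<2 * L}" for \<epsilon>
    using I0[OF H(1)[OF l[OF that]]] by simp
  ultimately have "continuous_on {0<..<2 * L} ?U"
    by (intro continuous_intros) auto
  moreover have "?U \<epsilon> \<in> {0<..<1} \<and> (1 - ?U \<epsilon>)\<^sup>2 * (?U \<epsilon> - ?l \<epsilon> - 2 * ?l \<epsilon> * (E0 - 1/2)) =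
      (tan \<theta>)\<^sup>2 * (?U \<epsilon>)\<^sup>2 * (1 - ?U \<epsilon> + 2 * ?l \<epsilon> * (E0 - 1/2))" if \<epsilon>: "\<epsilon> \<in> {0<..<2 * L}" for \<epsilon>
  proof -
    define t where "t = H (?l \<epsilon>)"
    define q where "q = 1 / (1 + t)"
    define u where "u = ?U \<epsilon>"
    have t: "0 < t" "?G t = ?l \<epsilon>" using H[OF l[OF \<epsilon>]] I0 by (auto simp: t_def)
    have q: "q * (1 + t) = 1" using t by (simp add: q_def)
    have u: "u = t * q" by (simp add: u_def q_def t_def)
    have u': "1 - u = q" using q by (simp add: u algebra_simps)
    have "0 < (1 + t) * (1 + 2 * e * (1 + a\<^sup>2 * t\<^sup>2))"
      using t e by (intro mult_pos_pos add_pos_nonneg) auto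
    then have "(1 + t) * (1 + 2 * e * (1 + a\<^sup>2 * t\<^sup>2)) \<noteq> 0" by (metis less_irrefl)
    then have "?l \<epsilon> * ((1 + t) * (1 + 2 * e * (1 + a\<^sup>2 * t\<^sup>2))) = t * (1 - a\<^sup>2 * t)"
      using nonzero_divide_eq_eq[THEN iffD1, OF _ refl] unfolding t(2)[symmetric] branch_map_def by metis
    then have "?l \<epsilon> * (1 + 2 * e * (1 + a\<^sup>2 * t\<^sup>2)) = q * (t * (1 - a\<^sup>2 * t))"
      using q by algebra
    \<comment> \<open>Multiplying by \<open>q\<^sup>2\<close> and substituting
      \<open>u = t * q\<close>, \<open>q * (1 + t) = 1\<close> undoes the passage from the branch
      equation to \<open>branch_map\<close>.\<close>
    then have "q\<^sup>2 * (u - ?l \<epsilon> - 2 * ?l \<epsilon> * e) = a\<^sup>2 * u\<^sup>2 * (q + 2 * ?l \<epsilon> * e)"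
      unfolding u by algebra
    moreover have "0 < q" using t by (simp add: q_def)
    then have "0 < u" "u < 1" using t u' by (simp_all add: u)
    ultimately show ?thesis
      unfolding u_def[symmetric] e_def[symmetric] a_def[symmetric] u' by simp
  qed
  moreover have "(?U \<longlongrightarrow> (cos \<theta>)\<^sup>2) (at_right 0)"
  proof -
    have "(?l \<longlongrightarrow> 0) (at_right 0)" by (auto intro!: tendsto_eq_intros)
    moreover have "\<forall>\<^sub>F \<epsilon> in at_right 0. ?l \<epsilon> \<in> {0..L}"
      using l L by (auto simp: eventually_at_right_field intro!: exI[of _ "2 * L"])
    ultimately have "((\<lambda>\<epsilon>. H (?l \<epsilon>)) \<longlongrightarrow> H 0) (at_right 0)"
      using L by (intro continuous_on_tendsto_compose[OF Hc]) auto
    then have "(?U \<longlongrightarrow> H 0 / (1 + H 0)) (at_right 0)"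
      using a2 unfolding H0 by (intro tendsto_intros) (auto simp: add_nonneg_eq_0_iff)
    moreover have "H 0 / (1 + H 0) = (cos \<theta>)\<^sup>2"
    proof -
      have "H 0 / (1 + H 0) = 1 / (1 + a\<^sup>2)" using a2 by (simp add: H0 field_simps)
      also have "1 + a\<^sup>2 = 1 / (cos \<theta>)\<^sup>2"
        unfolding a_def using tan_sec[of \<theta>] cos by (simp add: inverse_eq_divide power_one_over)
      finally show ?thesis by simp
    qed
    ultimately show ?thesis by simp
  qed
  ultimately have "shock_branch \<theta> E0 ?U"
    unfolding shock_branch_def Let_def using L by (intro conjI exI[of _ "2 * L"] ballI) auto
  then show ?thesis by (rule exI[where x = ?U])
qed

section \<open>The vague limit\<close>

lemma shock_branch_eventually:
  assumes "shock_branch \<theta> E0 U"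
  shows "\<forall>\<^sub>F \<epsilon> in at_right 0. 0 < \<epsilon> \<and> 0 < U \<epsilon> \<and> U \<epsilon> < 1 \<and>
    (1 - U \<epsilon>)\<^sup>2 * (U \<epsilon> - \<epsilon> / (\<epsilon> + 2) - 2 * (\<epsilon> / (\<epsilon> + 2)) * (E0 - 1/2)) =
      (tan \<theta>)\<^sup>2 * (U \<epsilon>)\<^sup>2 * (1 - U \<epsilon> + 2 * (\<epsilon> / (\<epsilon> + 2)) * (E0 - 1/2))"
proof -
  obtain e where e: "0 < e" "\<forall>\<epsilon>\<in>{0<..<e}. U \<epsilon> \<in> {0<..<1} \<and>
      (1 - U \<epsilon>)\<^sup>2 * (U \<epsilon> - \<epsilon> / (\<epsilon> + 2) - 2 * (\<epsilon> / (\<epsilon> + 2)) * (E0 - 1/2)) =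
      (tan \<theta>)\<^sup>2 * (U \<epsilon>)\<^sup>2 * (1 - U \<epsilon> + 2 * (\<epsilon> / (\<epsilon> + 2)) * (E0 - 1/2))"
    using assms unfolding shock_branch_def Let_def by blast
  then show ?thesis
    by (auto simp: eventually_at_right_field intro!: exI[of _ e])
qed

text \<open>\<open>f1\<close> may be unbounded, so only its product with the opening
  \<open>\<sigma> \<epsilon> - a\<close> can be used; the difference of the wedge integrals is
  therefore written as that opening times a difference quotient.\<close>

lemma wedge_integral_limit:
  assumes g: "g \<in> C0_test" and a: "0 < a" and \<sigma>: "filterlim \<sigma> (at a) F"
    and f: "(f0 \<longlongrightarrow> b) F" "((\<lambda>\<epsilon>. f1 \<epsilon> * (\<sigma> \<epsilon> - a)) \<longlongrightarrow> c) F"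
  shows "((\<lambda>\<epsilon>. f0 \<epsilon> * wedge_integral (\<sigma> \<epsilon>) g + f1 \<epsilon> * (wedge_integral a g - wedge_integral (\<sigma> \<epsilon>) g))
    \<longlongrightarrow> b * wedge_integral a g + c * ray_integral a (\<lambda>x. x) g) F"
proof -
  note D = wedge_integral_has_derivative[OF g a]
  have "((\<lambda>s. (wedge_integral s g - wedge_integral a g) / (s - a)) \<longlongrightarrow> - ray_integral a (\<lambda>x. x) g) (at a)"
    using D by (simp add: has_field_derivative_iff)
  from filterlim_compose[OF this \<sigma>]
  have 1: "((\<lambda>\<epsilon>. (wedge_integral (\<sigma> \<epsilon>) g - wedge_integral a g) / (\<sigma> \<epsilon> - a))
      \<longlongrightarrow> - ray_integral a (\<lambda>x. x) g) F" .
  have "((\<lambda>s. wedge_integral s g) \<longlongrightarrow> wedge_integral a g) (at a)"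
    using DERIV_isCont[OF D] by (simp add: isCont_def)
  from filterlim_compose[OF this \<sigma>]
  have 2: "((\<lambda>\<epsilon>. wedge_integral (\<sigma> \<epsilon>) g) \<longlongrightarrow> wedge_integral a g) F" .
  have "((\<lambda>\<epsilon>. f0 \<epsilon> * wedge_integral (\<sigma> \<epsilon>) g + f1 \<epsilon> * (\<sigma> \<epsilon> - a) *
      - ((wedge_integral (\<sigma> \<epsilon>) g - wedge_integral a g) / (\<sigma> \<epsilon> - a)))
    \<longlongrightarrow> b * wedge_integral a g + c * ray_integral a (\<lambda>x. x) g) F"
    using tendsto_add[OF tendsto_mult[OF f(1) 2] tendsto_mult[OF f(2) tendsto_minus[OF 1]]] by simp
  moreover have "\<forall>\<^sub>F \<epsilon> in F. f0 \<epsilon> * wedge_integral (\<sigma> \<epsilon>) g + f1 \<epsilon> * (\<sigma> \<epsilon> - a) *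
      - ((wedge_integral (\<sigma> \<epsilon>) g - wedge_integral a g) / (\<sigma> \<epsilon> - a)) =
    f0 \<epsilon> * wedge_integral (\<sigma> \<epsilon>) g + f1 \<epsilon> * (wedge_integral a g - wedge_integral (\<sigma> \<epsilon>) g)"
    \<comment> \<open>The filter \<open>at a\<close> excludes
      \<open>\<sigma> \<epsilon> = a\<close>, so the division is exact.\<close>
    using \<sigma> unfolding filterlim_at by (auto elim!: eventually_mono simp: field_simps)
  ultimately show ?thesis
    by (rule Lim_transform_eventually)
qed

lemma shock_branch_limits:
  assumes U: "shock_branch \<theta> E0 U" and \<theta>: "0 < \<theta>" "\<theta> < pi / 2" and E0: "1 / 2 < E0"
    and a: "a = tan \<theta>"
  shows "filterlim (\<lambda>\<epsilon>. shock_slope a (U \<epsilon>)) (at a) (at_right 0)"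
    and "\<forall>\<^sub>F \<epsilon> in at_right 0. a < shock_slope a (U \<epsilon>)"
    and "\<forall>\<^sub>F \<epsilon> in at_right 0. 0 < rho1 a E0 \<epsilon> (U \<epsilon>) \<and> 0 \<le> p0 E0 \<epsilon> \<and> 0 \<le> p1 a E0 \<epsilon> (U \<epsilon>) \<and> 0 \<le> U \<epsilon>"
    and "((\<lambda>\<epsilon>. rho1 a E0 \<epsilon> (U \<epsilon>) * (shock_slope a (U \<epsilon>) - a)) \<longlongrightarrow> a / (cos \<theta>)\<^sup>2) (at_right 0)"
    and "((\<lambda>\<epsilon>. p1 a E0 \<epsilon> (U \<epsilon>) * (shock_slope a (U \<epsilon>) - a)) \<longlongrightarrow> 0) (at_right 0)"
    and "((\<lambda>\<epsilon>. p0 E0 \<epsilon>) \<longlongrightarrow> 0) (at_right 0)"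
proof -
  have sin: "0 < sin \<theta>" and cos: "0 < cos \<theta>"
    using \<theta> by (auto intro: sin_gt_zero cos_gt_zero_pi)
  have a0: "0 < a" using sin cos by (simp add: a tan_def)
  have Ul: "(U \<longlongrightarrow> (cos \<theta>)\<^sup>2) (at_right 0)" using U by (simp add: shock_branch_def)
  note ev = shock_branch_eventually[OF U, folded a]
  note st = shock_state[OF _ a0 E0]
  have "(1 - (cos \<theta>)\<^sup>2) / (a * (cos \<theta>)\<^sup>2) = a"
    unfolding sin_squared_eq[symmetric] using cos sin by (simp add: a tan_def power2_eq_square)
  moreover have "((\<lambda>\<epsilon>. shock_slope a (U \<epsilon>)) \<longlongrightarrow> (1 - (cos \<theta>)\<^sup>2) / (a * (cos \<theta>)\<^sup>2)) (at_right 0)"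
    unfolding shock_slope_def using a0 cos by (intro tendsto_intros Ul) auto
  ultimately have \<sigma>: "((\<lambda>\<epsilon>. shock_slope a (U \<epsilon>)) \<longlongrightarrow> a) (at_right 0)" by simp
  show gt: "\<forall>\<^sub>F \<epsilon> in at_right 0. a < shock_slope a (U \<epsilon>)"
    using ev by eventually_elim (auto intro: st(5))
  \<comment> \<open>The strict inequality keeps the slope away from \<open>a\<close>, which upgrades
    the limit from \<open>nhds a\<close> to \<open>at a\<close>.\<close>
  then show "filterlim (\<lambda>\<epsilon>. shock_slope a (U \<epsilon>)) (at a) (at_right 0)"
    unfolding filterlim_at using \<sigma> by (auto elim: eventually_mono)
  show "\<forall>\<^sub>F \<epsilon> in at_right 0. 0 < rho1 a E0 \<epsilon> (U \<epsilon>) \<and> 0 \<le> p0 E0 \<epsilon> \<and> 0 \<le> p1 a E0 \<epsilon> (U \<epsilon>) \<and> 0 \<le> U \<epsilon>"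
    using ev
  proof eventually_elim
    case (elim \<epsilon>)
    moreover have "0 \<le> p0 E0 \<epsilon>" using elim E0 by (simp add: p0_def)
    ultimately show ?case using st(2,3)[of \<epsilon> "U \<epsilon>"] by auto
  qed
  have "\<forall>\<^sub>F \<epsilon> in at_right 0. shock_slope a (U \<epsilon>) / U \<epsilon> = rho1 a E0 \<epsilon> (U \<epsilon>) * (shock_slope a (U \<epsilon>) - a)"
    using ev
  proof eventually_elim
    case (elim \<epsilon>)
    then have "rho1 a E0 \<epsilon> (U \<epsilon>) * U \<epsilon> * (shock_slope a (U \<epsilon>) - a) = shock_slope a (U \<epsilon>)" and "U \<epsilon> \<noteq> 0"
      using st(6)[of \<epsilon> "U \<epsilon>"] by auto
    then show ?case by (simp add: divide_eq_eq mult.commute mult.left_commute)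
  qed
  moreover have "((\<lambda>\<epsilon>. shock_slope a (U \<epsilon>) / U \<epsilon>) \<longlongrightarrow> a / (cos \<theta>)\<^sup>2) (at_right 0)"
    using cos by (intro tendsto_intros \<sigma> Ul) auto
  ultimately show "((\<lambda>\<epsilon>. rho1 a E0 \<epsilon> (U \<epsilon>) * (shock_slope a (U \<epsilon>) - a)) \<longlongrightarrow> a / (cos \<theta>)\<^sup>2) (at_right 0)"
    by (rule Lim_transform_eventually[rotated])
  show p0: "((\<lambda>\<epsilon>. p0 E0 \<epsilon>) \<longlongrightarrow> 0) (at_right 0)"
    unfolding p0_def by (auto intro!: tendsto_eq_intros)
  \<comment> \<open>Unlike the density, the pressure behind the shock stays bounded, so its product
    with the vanishing opening tends to 0 and leaves no layer.\<close>
  have "\<forall>\<^sub>F \<epsilon> in at_right 0. (p0 E0 \<epsilon> + (1 - U \<epsilon>)) * (shock_slope a (U \<epsilon>) - a) =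
      p1 a E0 \<epsilon> (U \<epsilon>) * (shock_slope a (U \<epsilon>) - a)"
    using ev by eventually_elim (use st(3) in auto)
  moreover have "((\<lambda>\<epsilon>. (p0 E0 \<epsilon> + (1 - U \<epsilon>)) * (shock_slope a (U \<epsilon>) - a))
      \<longlongrightarrow> 0) (at_right 0)"
    using tendsto_mult[OF tendsto_add[OF p0 tendsto_diff[OF tendsto_const[of 1] Ul]]
        tendsto_diff[OF \<sigma> tendsto_const[of a]]]
    by simp
  ultimately show "((\<lambda>\<epsilon>. p1 a E0 \<epsilon> (U \<epsilon>) * (shock_slope a (U \<epsilon>) - a)) \<longlongrightarrow> 0) (at_right 0)"
    by (rule Lim_transform_eventually[rotated])
qed

lemma vague_tendsto_layer:
  assumes M: "\<forall>\<^sub>F \<epsilon> in at_right 0. M \<epsilon> = leb (\<lambda>z. two_state a (U \<epsilon>) (f0 \<epsilon>) (f1 \<epsilon>) z * indicator (Omega a) z)"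
    and f: "\<forall>\<^sub>F \<epsilon> in at_right 0. 0 \<le> f0 \<epsilon> \<and> 0 \<le> f1 \<epsilon>"
    and \<sigma>: "filterlim (\<lambda>\<epsilon>. shock_slope a (U \<epsilon>)) (at a) (at_right 0)"
      "\<forall>\<^sub>F \<epsilon> in at_right 0. a < shock_slope a (U \<epsilon>)"
    and a: "0 < a" and nn: "0 \<le> b" "0 \<le> c"
    and lim: "(f0 \<longlongrightarrow> b) (at_right 0)"
      "((\<lambda>\<epsilon>. f1 \<epsilon> * (shock_slope a (U \<epsilon>) - a)) \<longlongrightarrow> c * sqrt (1 + a\<^sup>2)) (at_right 0)"
  shows "vague_tendsto M (pos (layer a b c)) (at_right 0)"
  unfolding vague_tendsto_def
proof
  fix \<phi> assume \<phi>: "\<phi> \<in> C0_test"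
  note [measurable] = C0_test_measurable[OF \<phi>]
  have "\<forall>\<^sub>F \<epsilon> in at_right 0. f0 \<epsilon> * wedge_integral (shock_slope a (U \<epsilon>)) \<phi> +
      f1 \<epsilon> * (wedge_integral a \<phi> - wedge_integral (shock_slope a (U \<epsilon>)) \<phi>) = pairing (M \<epsilon>) \<phi>"
    using M f \<sigma>(2)
  proof eventually_elim
    case (elim \<epsilon>)
    have "pairing (M \<epsilon>) \<phi> = (\<integral>z. two_state a (U \<epsilon>) (f0 \<epsilon>) (f1 \<epsilon>) z * indicator (Omega a) z * \<phi> z \<partial>lborel)"
      unfolding elim(1) using elim(2) by (subst leb_eq) (auto simp: pairing_density two_state_nonneg)
    then show ?case using integral_two_state[OF \<phi> a elim(3), of "f0 \<epsilon>" "f1 \<epsilon>"] by simp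
  qed
  moreover have "pairing (pos (layer a b c)) \<phi> =
      b * wedge_integral a \<phi> + c * sqrt (1 + a\<^sup>2) * ray_integral a (\<lambda>x. x) \<phi>"
    using \<phi> nn by (simp add: pairing_pos integral_layer)
  ultimately show "((\<lambda>\<epsilon>. pairing (M \<epsilon>) \<phi>) \<longlongrightarrow> pairing (pos (layer a b c)) \<phi>) (at_right 0)"
    using Lim_transform_eventually[OF wedge_integral_limit[OF \<phi> a \<sigma>(1) lim]] by simp
qed

lemma shock_vague_limit:
  assumes U: "shock_branch \<theta> E0 U" and \<theta>: "0 < \<theta>" "\<theta> < pi / 2" and E0: "1 / 2 < E0"
    and a: "a = tan \<theta>"
  shows "vague_tendsto (\<lambda>\<epsilon>. pos (sh_varrho a E0 \<epsilon> (U \<epsilon>))) (pos (lim_varrho \<theta>)) (at_right 0)"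
    and "k \<le> 3 \<Longrightarrow> vague_tendsto (\<lambda>\<epsilon>. sh_m a E0 \<epsilon> (U \<epsilon>) k) (lim_m \<theta> E0 k) (at_right 0)"
    and "k \<le> 3 \<Longrightarrow> vague_tendsto (\<lambda>\<epsilon>. sh_n a E0 \<epsilon> (U \<epsilon>) k) (lim_n \<theta> E0 k) (at_right 0)"
    and "vague_tendsto (\<lambda>\<epsilon>. sh_wp a E0 \<epsilon> (U \<epsilon>)) (pos (null_measure borel)) (at_right 0)"
proof -
  note L = shock_branch_limits[OF U \<theta> E0 a]
  have sin: "0 < sin \<theta>" and cos: "0 < cos \<theta>"
    using \<theta> by (auto intro: sin_gt_zero cos_gt_zero_pi)
  have ta: "a = sin \<theta> / cos \<theta>" by (simp add: a tan_def)
  have a0: "0 < a" using sin cos by (simp add: ta)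
  have s: "sqrt (1 + a\<^sup>2) = 1 / cos \<theta>"
  proof (rule real_sqrt_unique)
    show "(1 / cos \<theta>)\<^sup>2 = 1 + a\<^sup>2" using cos by (simp add: ta power_divide field_simps)
  qed (use cos in simp)
  have Ul: "(U \<longlongrightarrow> (cos \<theta>)\<^sup>2) (at_right 0)" using U by (simp add: shock_branch_def)
  let ?r = "\<lambda>\<epsilon>. rho1 a E0 \<epsilon> (U \<epsilon>)" and ?\<sigma> = "\<lambda>\<epsilon>. shock_slope a (U \<epsilon>)"
  \<comment> \<open>Behind the shock each of these measures has density \<open>rho1\<close> times
    some \<open>w\<close> built from the converging velocity. The last premise reads off the layer
    coefficient \<open>c\<close>, with \<open>1 / cos \<theta>\<close> in place of
    \<open>sqrt (1 + a\<^sup>2)\<close>.\<close>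
  have vt: "vague_tendsto M (pos (layer a b c)) (at_right 0)"
    if "\<And>\<epsilon>. 0 < ?r \<epsilon> \<Longrightarrow> 0 \<le> U \<epsilon> \<Longrightarrow> M \<epsilon> = leb (\<lambda>z. two_state a (U \<epsilon>) b (?r \<epsilon> * w \<epsilon>) z * indicator (Omega a) z)"
      "\<And>\<epsilon>. 0 \<le> U \<epsilon> \<Longrightarrow> 0 \<le> w \<epsilon>" "0 \<le> b" "0 \<le> c" "(w \<longlongrightarrow> w0) (at_right 0)" "a / (cos \<theta>)\<^sup>2 * w0 = c / cos \<theta>"
    for M b c w w0
  proof (rule vague_tendsto_layer[OF _ _ L(1,2) a0 that(3,4)])
    show "\<forall>\<^sub>F \<epsilon> in at_right 0. M \<epsilon> = leb (\<lambda>z. two_state a (U \<epsilon>) b (?r \<epsilon> * w \<epsilon>) z * indicator (Omega a) z)"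
      using L(3) by eventually_elim (use that(1) in auto)
    show "\<forall>\<^sub>F \<epsilon> in at_right 0. 0 \<le> b \<and> 0 \<le> ?r \<epsilon> * w \<epsilon>"
      using L(3) by eventually_elim (use that(2,3) in auto)
    have "((\<lambda>\<epsilon>. ?r \<epsilon> * (?\<sigma> \<epsilon> - a) * w \<epsilon>) \<longlongrightarrow> a / (cos \<theta>)\<^sup>2 * w0) (at_right 0)"
      by (intro tendsto_mult[OF L(4) that(5)])
    then show "((\<lambda>\<epsilon>. ?r \<epsilon> * w \<epsilon> * (?\<sigma> \<epsilon> - a)) \<longlongrightarrow> c * sqrt (1 + a\<^sup>2)) (at_right 0)"
      using that(6) by (simp add: s ac_simps)
  qed auto
  let ?ts = "\<lambda>\<epsilon>. two_state a (U \<epsilon>)"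
  have mE: "?ts \<epsilon> f0 f1 z * E0 = ?ts \<epsilon> (f0 * E0) (f1 * E0) z" for \<epsilon> f0 f1 z
    by (simp add: two_state_def split: prod.split)
  have sq: "(?ts \<epsilon> f0 f1 z)\<^sup>2 = ?ts \<epsilon> (f0\<^sup>2) (f1\<^sup>2) z" for \<epsilon> f0 f1 z
    by (simp add: power2_eq_square two_state_mult)
  note ts = two_state_mult sq mE sh_rho_def sh_u_def sh_v_def sh_p_def
  note lim_m = lim_m_def[of \<theta> E0, folded a] and lim_n = lim_n_def[of \<theta> E0, folded a]
  have "pos (sh_varrho a E0 \<epsilon> (U \<epsilon>)) = leb (\<lambda>z. ?ts \<epsilon> 1 (?r \<epsilon> * 1) z * indicator (Omega a) z)"
    if "0 < ?r \<epsilon>" for \<epsilon>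
    using that by (subst leb_eq) (auto simp: sh_varrho_def sh_rho_def two_state_nonneg)
  then show "vague_tendsto (\<lambda>\<epsilon>. pos (sh_varrho a E0 \<epsilon> (U \<epsilon>))) (pos (lim_varrho \<theta>)) (at_right 0)"
    unfolding lim_varrho_def a[symmetric] using sin cos
    by (intro vt[where w = "\<lambda>_. 1" and ?w0.0 = 1]) (auto simp: ta power2_eq_square)
  show "vague_tendsto (\<lambda>\<epsilon>. sh_m a E0 \<epsilon> (U \<epsilon>) k) (lim_m \<theta> E0 k) (at_right 0)" if "k \<le> 3"
    using that
  proof (rule le_3_cases)
    have T: "((\<lambda>\<epsilon>. U \<epsilon>) \<longlongrightarrow> (cos \<theta>)\<^sup>2) (at_right 0)" by (intro tendsto_intros Ul)
    have e: "a / (cos \<theta>)\<^sup>2 * ((cos \<theta>)\<^sup>2) = sin \<theta> / cos \<theta>"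
      using cos by (simp add: ta power2_eq_square power3_eq_cube)
    show "vague_tendsto (\<lambda>\<epsilon>. sh_m a E0 \<epsilon> (U \<epsilon>) 0) (lim_m \<theta> E0 0) (at_right 0)"
      by (simp add: lim_m) (rule vt[OF _ _ _ _ T e]; use sin cos a0 E0 in \<open>simp add: sh_m_def ts mult.assoc\<close>)
    have T: "((\<lambda>\<epsilon>. (U \<epsilon>)\<^sup>2) \<longlongrightarrow> ((cos \<theta>)\<^sup>2)\<^sup>2) (at_right 0)" by (intro tendsto_intros Ul)
    have e: "a / (cos \<theta>)\<^sup>2 * (((cos \<theta>)\<^sup>2)\<^sup>2) = sin \<theta> * (cos \<theta>)\<^sup>2 / cos \<theta>"
      using cos by (simp add: ta power2_eq_square power3_eq_cube)
    show "vague_tendsto (\<lambda>\<epsilon>. sh_m a E0 \<epsilon> (U \<epsilon>) 1) (lim_m \<theta> E0 1) (at_right 0)"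
      by (simp add: lim_m) (rule vt[OF _ _ _ _ T e]; use sin cos a0 E0 in \<open>simp add: sh_m_def ts mult.assoc\<close>)
    have T: "((\<lambda>\<epsilon>. U \<epsilon> * (a * U \<epsilon>)) \<longlongrightarrow> (cos \<theta>)\<^sup>2 * (a * (cos \<theta>)\<^sup>2)) (at_right 0)" by (intro tendsto_intros Ul)
    have e: "a / (cos \<theta>)\<^sup>2 * ((cos \<theta>)\<^sup>2 * (a * (cos \<theta>)\<^sup>2)) = (sin \<theta>)\<^sup>2 * cos \<theta> / cos \<theta>"
      using cos by (simp add: ta power2_eq_square power3_eq_cube)
    show "vague_tendsto (\<lambda>\<epsilon>. sh_m a E0 \<epsilon> (U \<epsilon>) 2) (lim_m \<theta> E0 2) (at_right 0)"
      by (simp add: lim_m) (rule vt[OF _ _ _ _ T e]; use sin cos a0 E0 in \<open>simp add: sh_m_def ts mult.assoc\<close>)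
    have T: "((\<lambda>\<epsilon>. U \<epsilon> * E0) \<longlongrightarrow> (cos \<theta>)\<^sup>2 * E0) (at_right 0)" by (intro tendsto_intros Ul)
    have e: "a / (cos \<theta>)\<^sup>2 * ((cos \<theta>)\<^sup>2 * E0) = E0 * sin \<theta> / cos \<theta>"
      using cos by (simp add: ta power2_eq_square power3_eq_cube)
    show "vague_tendsto (\<lambda>\<epsilon>. sh_m a E0 \<epsilon> (U \<epsilon>) 3) (lim_m \<theta> E0 3) (at_right 0)"
      by (simp add: lim_m) (rule vt[OF _ _ _ _ T e]; use sin cos a0 E0 in \<open>simp add: sh_m_def ts mult.assoc\<close>)
  qed
  show "vague_tendsto (\<lambda>\<epsilon>. sh_n a E0 \<epsilon> (U \<epsilon>) k) (lim_n \<theta> E0 k) (at_right 0)" if "k \<le> 3"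
    using that
  proof (rule le_3_cases)
    have T: "((\<lambda>\<epsilon>. a * U \<epsilon>) \<longlongrightarrow> a * (cos \<theta>)\<^sup>2) (at_right 0)" by (intro tendsto_intros Ul)
    have e: "a / (cos \<theta>)\<^sup>2 * (a * (cos \<theta>)\<^sup>2) = (sin \<theta>)\<^sup>2 / cos \<theta> / cos \<theta>"
      using cos by (simp add: ta power2_eq_square power3_eq_cube)
    show "vague_tendsto (\<lambda>\<epsilon>. sh_n a E0 \<epsilon> (U \<epsilon>) 0) (lim_n \<theta> E0 0) (at_right 0)"
      by (simp add: lim_n) (rule vt[OF _ _ _ _ T e]; use sin cos a0 E0 in \<open>simp add: sh_n_def ts mult.assoc\<close>)
    have T: "((\<lambda>\<epsilon>. U \<epsilon> * (a * U \<epsilon>)) \<longlongrightarrow> (cos \<theta>)\<^sup>2 * (a * (cos \<theta>)\<^sup>2)) (at_right 0)" by (intro tendsto_intros Ul)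
    have e: "a / (cos \<theta>)\<^sup>2 * ((cos \<theta>)\<^sup>2 * (a * (cos \<theta>)\<^sup>2)) = (sin \<theta>)\<^sup>2 * cos \<theta> / cos \<theta>"
      using cos by (simp add: ta power2_eq_square power3_eq_cube)
    show "vague_tendsto (\<lambda>\<epsilon>. sh_n a E0 \<epsilon> (U \<epsilon>) 1) (lim_n \<theta> E0 1) (at_right 0)"
      by (simp add: lim_n) (rule vt[OF _ _ _ _ T e]; use sin cos a0 E0 in \<open>simp add: sh_n_def ts mult.assoc\<close>)
    have T: "((\<lambda>\<epsilon>. (a * U \<epsilon>)\<^sup>2) \<longlongrightarrow> (a * (cos \<theta>)\<^sup>2)\<^sup>2) (at_right 0)" by (intro tendsto_intros Ul)
    have e: "a / (cos \<theta>)\<^sup>2 * ((a * (cos \<theta>)\<^sup>2)\<^sup>2) = sin \<theta> ^ 3 / cos \<theta>"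
      using cos by (simp add: ta power2_eq_square power3_eq_cube)
    show "vague_tendsto (\<lambda>\<epsilon>. sh_n a E0 \<epsilon> (U \<epsilon>) 2) (lim_n \<theta> E0 2) (at_right 0)"
      by (simp add: lim_n) (rule vt[OF _ _ _ _ T e]; use sin cos a0 E0 in \<open>simp add: sh_n_def ts mult.assoc\<close>)
    have T: "((\<lambda>\<epsilon>. a * U \<epsilon> * E0) \<longlongrightarrow> a * (cos \<theta>)\<^sup>2 * E0) (at_right 0)" by (intro tendsto_intros Ul)
    have e: "a / (cos \<theta>)\<^sup>2 * (a * (cos \<theta>)\<^sup>2 * E0) = E0 * (sin \<theta>)\<^sup>2 / cos \<theta> / cos \<theta>"
      using cos by (simp add: ta power2_eq_square power3_eq_cube)
    show "vague_tendsto (\<lambda>\<epsilon>. sh_n a E0 \<epsilon> (U \<epsilon>) 3) (lim_n \<theta> E0 3) (at_right 0)"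
      by (simp add: lim_n) (rule vt[OF _ _ _ _ T e]; use sin cos a0 E0 in \<open>simp add: sh_n_def ts mult.assoc\<close>)
  qed
  \<comment> \<open>The pressure does not fit \<open>vt\<close>: its value \<open>p0\<close> in
    front varies with \<open>\<epsilon>\<close>, and \<open>p1\<close> is not presented as a
    multiple of \<open>rho1\<close>.\<close>
  have "vague_tendsto (\<lambda>\<epsilon>. sh_wp a E0 \<epsilon> (U \<epsilon>)) (pos (layer a 0 0)) (at_right 0)"
  proof (rule vague_tendsto_layer[OF _ _ L(1,2) a0 _ _ L(6)])
    show "\<forall>\<^sub>F \<epsilon> in at_right 0. 0 \<le> p0 E0 \<epsilon> \<and> 0 \<le> p1 a E0 \<epsilon> (U \<epsilon>)"
      using L(3) by eventually_elim auto
  qed (use L(5) in \<open>auto simp: sh_wp_def sh_p_def\<close>)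
  then show "vague_tendsto (\<lambda>\<epsilon>. sh_wp a E0 \<epsilon> (U \<epsilon>)) (pos (null_measure borel)) (at_right 0)"
    by (simp add: layer_0_0)
qed

text \<open>Equality of filters makes the two limits, \<open>\<epsilon>\<close> to zero and Mach
  number to infinity, interchangeable. It follows from the inverse
  \<open>x \<mapsto> 1 / (x\<^sup>2 * (E0 - 1/2))\<close> once the limits in both directions are
  known.\<close>

lemma filtermap_mach:
  assumes "1 / 2 < E0"
  shows "filtermap (mach E0) (at_right 0) = at_top"
proof (rule filtermap_fun_inverse)
  define e where "e = E0 - 1/2"
  have e: "0 < e" using assms by (simp add: e_def)
  have m: "mach E0 \<epsilon> = inverse (sqrt (\<epsilon> * e))" if "0 < \<epsilon>" for \<epsilon>
    using that e by (simp add: mach_def e_def powr_minus powr_half_sqrt)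
  let ?g = "\<lambda>x. inverse (x\<^sup>2 * e)"
  have "filterlim (\<lambda>x::real. x\<^sup>2 * e) at_top at_top"
    using e by (intro filterlim_at_top_mult_tendsto_pos[OF tendsto_const] filterlim_pow_at_top filterlim_ident) auto
  then show "filterlim ?g (at_right 0) at_top"
    by (rule filterlim_compose[OF filterlim_inverse_at_right_top])
  show "\<forall>\<^sub>F x in at_top. mach E0 (?g x) = x"
    using eventually_gt_at_top[of 0]
  proof eventually_elim
    case (elim x)
    then have "?g x * e = (inverse x)\<^sup>2" using e by (simp add: power_inverse)
    then show ?case using elim e by (simp add: m)
  qed
  have "filterlim (\<lambda>\<epsilon>. sqrt (\<epsilon> * e)) (at_right 0) (at_right 0)"
    unfolding filterlim_at
  proof
    show "((\<lambda>\<epsilon>. sqrt (\<epsilon> * e)) \<longlongrightarrow> 0) (at_right 0)" by (auto intro!: tendsto_eq_intros)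
    show "\<forall>\<^sub>F \<epsilon> in at_right 0. sqrt (\<epsilon> * e) \<in> {0<..} \<and> sqrt (\<epsilon> * e) \<noteq> 0"
      using e by (auto simp: eventually_at_right_field intro!: exI[of _ 1])
  qed
  then have "filterlim (\<lambda>\<epsilon>. inverse (sqrt (\<epsilon> * e))) at_top (at_right 0)"
    by (rule filterlim_compose[OF filterlim_inverse_at_top_right])
  moreover have "\<forall>\<^sub>F \<epsilon> in at_right 0. inverse (sqrt (\<epsilon> * e)) = mach E0 \<epsilon>"
    using m by (auto simp: eventually_at_right_field intro!: exI[of _ 1])
  ultimately show "filterlim (mach E0) at_top (at_right 0)"
    by (rule filterlim_cong[OF refl refl, THEN iffD1, rotated])
qed

theorem theorem4p1:
  fixes \<theta> E0 a :: real
  assumes "0 < \<theta>" "\<theta> < pi / 2" "E0 > 1 / 2" and "a = tan \<theta>"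
  shows
   "(\<forall>\<epsilon>\<ge>0. \<exists>\<rho> u v E. measure_solution a E0 \<epsilon> \<rho> u v E) \<and>
    (\<exists>U. shock_branch \<theta> E0 U) \<and>
    (\<forall>U. shock_branch \<theta> E0 U \<longrightarrow>
       (\<forall>\<^sub>F \<epsilon> in at_right 0.
          measure_solution_with a E0 \<epsilon>
            (sh_varrho a E0 \<epsilon> (U \<epsilon>)) (sh_u a (U \<epsilon>)) (sh_v a (U \<epsilon>)) (\<lambda>_. E0)
            (sh_m a E0 \<epsilon> (U \<epsilon>)) (sh_n a E0 \<epsilon> (U \<epsilon>)) (sh_wp a E0 \<epsilon> (U \<epsilon>))
            (\<lambda>_. - a / sqrt (1 + a\<^sup>2) * p1 a E0 \<epsilon> (U \<epsilon>))
            (\<lambda>_. 1 / sqrt (1 + a\<^sup>2) * p1 a E0 \<epsilon> (U \<epsilon>)))) \<and>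
    measure_solution_with a E0 0
      (lim_varrho \<theta>) (lim_u \<theta>) (lim_v \<theta>) (\<lambda>_. E0)
      (lim_m \<theta> E0) (lim_n \<theta> E0) (pos (null_measure borel))
      (\<lambda>_. - ((sin \<theta>) ^ 3)) (\<lambda>_. (sin \<theta>)\<^sup>2 * cos \<theta>) \<and>
    sqrt ((- ((sin \<theta>) ^ 3))\<^sup>2 + ((sin \<theta>)\<^sup>2 * cos \<theta>)\<^sup>2) = (sin \<theta>)\<^sup>2 \<and>
    filtermap (mach E0) (at_right 0) = at_top \<and>
    (\<forall>U. shock_branch \<theta> E0 U \<longrightarrow>
       vague_tendsto (\<lambda>\<epsilon>. pos (sh_varrho a E0 \<epsilon> (U \<epsilon>))) (pos (lim_varrho \<theta>)) (at_right 0) \<and>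
       (\<forall>k\<le>3. vague_tendsto (\<lambda>\<epsilon>. sh_m a E0 \<epsilon> (U \<epsilon>) k) (lim_m \<theta> E0 k) (at_right 0) \<and>
              vague_tendsto (\<lambda>\<epsilon>. sh_n a E0 \<epsilon> (U \<epsilon>) k) (lim_n \<theta> E0 k) (at_right 0)) \<and>
       vague_tendsto (\<lambda>\<epsilon>. sh_wp a E0 \<epsilon> (U \<epsilon>)) (pos (null_measure borel)) (at_right 0))"
proof (intro conjI allI impI)
  note layer = layer_measure_solution[OF assms(1-3), folded assms(4)]
  have a0: "0 < a" using assms by (simp add: tan_gt_zero)
  show "\<exists>\<rho> u v E. measure_solution a E0 \<epsilon> \<rho> u v E" if "0 \<le> \<epsilon>" for \<epsilon>
    using layer[OF that] unfolding measure_solution_def by blast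
  show "\<exists>U. shock_branch \<theta> E0 U"
    using assms by (intro shock_branch_exists)
  show "\<forall>\<^sub>F \<epsilon> in at_right 0. measure_solution_with a E0 \<epsilon>
      (sh_varrho a E0 \<epsilon> (U \<epsilon>)) (sh_u a (U \<epsilon>)) (sh_v a (U \<epsilon>)) (\<lambda>_. E0)
      (sh_m a E0 \<epsilon> (U \<epsilon>)) (sh_n a E0 \<epsilon> (U \<epsilon>)) (sh_wp a E0 \<epsilon> (U \<epsilon>))
      (\<lambda>_. - a / sqrt (1 + a\<^sup>2) * p1 a E0 \<epsilon> (U \<epsilon>)) (\<lambda>_. 1 / sqrt (1 + a\<^sup>2) * p1 a E0 \<epsilon> (U \<epsilon>))"
    if "shock_branch \<theta> E0 U" for U
    using shock_branch_eventually[OF that]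
    by eventually_elim (use assms a0 in \<open>intro shock_measure_solution; simp\<close>)
  \<comment> \<open>At \<open>\<epsilon> = 0\<close> the stream has no pressure, so the pressure
    measure \<open>layer a 0 0\<close> is the null measure.\<close>
  have "p0 E0 0 = 0" by (simp add: p0_def)
  then show "measure_solution_with a E0 0
      (lim_varrho \<theta>) (lim_u \<theta>) (lim_v \<theta>) (\<lambda>_. E0)
      (lim_m \<theta> E0) (lim_n \<theta> E0) (pos (null_measure borel))
      (\<lambda>_. - ((sin \<theta>) ^ 3)) (\<lambda>_. (sin \<theta>)\<^sup>2 * cos \<theta>)"
    using layer[of 0] by (simp add: layer_0_0 power3_eq_cube power2_eq_square ac_simps)
  have "(- (x ^ 3))\<^sup>2 + (x\<^sup>2 * y)\<^sup>2 = (x\<^sup>2)\<^sup>2 * (x\<^sup>2 + y\<^sup>2)" for x y :: real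
    by algebra
  then have "(- ((sin \<theta>) ^ 3))\<^sup>2 + ((sin \<theta>)\<^sup>2 * cos \<theta>)\<^sup>2 = ((sin \<theta>)\<^sup>2)\<^sup>2"
    by (simp only: sin_cos_squared_add mult_1_right)
  then show "sqrt ((- ((sin \<theta>) ^ 3))\<^sup>2 + ((sin \<theta>)\<^sup>2 * cos \<theta>)\<^sup>2) = (sin \<theta>)\<^sup>2"
    by (simp only: real_sqrt_abs abs_power2)
  show "filtermap (mach E0) (at_right 0) = at_top"
    using assms(3) by (rule filtermap_mach)
qed (use shock_vague_limit[OF _ assms] in blast)+

end
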